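(* Let $n\ge2$ and $t\in(0,1]$. (1) The set $C_t$ coincides with the closed convex hull of $f_t(\mathbf{H}^n)$. (2) The set $C_t$ coincides with the closed convex hull of $f_t(\partial\mathbf{H}^n)$, and $\partial C_t=f_t(\partial\mathbf{H}^n)$. (3) $\mathrm{Isom}(C_t)=\mathrm{Isom}(\mathbf{H}^n)$ (the action of $\mathrm{Isom}(\mathbf{H}^n)$ on $C_t$ induces an isomorphism onto $\mathrm{Isom}(C_t)$).
   Context: $\mathbf{H}^n$ is real hyperbolic $n$-space. The infinite-dimensional hyperbolic space: let $\mathscr{H}$ be an infinite-dimensional separable real Hilbert space, $L\subset\mathscr{H}$ a line, $0\ne e\in L$, and let $B$ be the symmetric bilinear form with $B(v,v)=|v_L|^2-|v_{L^\perp}|^2$. Then $\mathbf{H}^\infty=\{v\in\mathscr{H}: B(v,v)=1,\ B(v,e)>0\}$ with $\cosh d(x,y)=B(x,y)$, a complete CAT($-1$) space; $\partial$ denotes the geometric boundary and bordifications carry the cone topology. For $t\in(0,1)$, $\varrho_t\colon\mathrm{Isom}(\mathbf{H}^n)\to\mathrm{Isom}(\mathbf{H}^\infty)$ denotes the irreducible continuous representation (the associated linear representation on $\mathscr{H}$ has no non-trivial closed invariant subspace; orbit maps are continuous), which exists and is unique up to conjugacy, whose translation length function satisfies $\inf_{x\in\mathbf{H}^\infty}d(\varrho_t(g)x,x)=t\inf_{x\in\mathbf{H}^n}d(gx,x)$ for all $g$. For $t\in(0,1)$, $C_t\subseteq\mathbf{H}^\infty$ is the unique minimal non-empty closed convex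 $\varrho_t(\mathrm{Isom}(\mathbf{H}^n))$-invariant subset, with the induced metric and action, and $f_t\colon\mathbf{H}^n\to\mathbf{H}^\infty$ is the unique $\varrho_t$-equivariant map; it extends continuously to a map $\mathbf{H}^n\cup\partial\mathbf{H}^n\to\mathbf{H}^\infty\cup\partial\mathbf{H}^\infty$, still denoted $f_t$. By convention $C_1=\mathbf{H}^n$ with the standard action and $f_1$ is the identity $\mathbf{H}^n\to C_1$ (so for $t=1$ hulls are taken in $\mathbf{H}^n$). The closed convex hull of a subset of the boundary at infinity is the intersection of all closed convex subsets of the hyperbolic space whose boundary at infinity contains the given subset. *)

theory Defs
  imports "HOL-Analysis.Analysis" "HOL-Algebra.Bij"
begin

text \<open>Hyperboloid model over a real inner product space: \<open>e \<noteq> 0\<close> spans the line \<open>L\<close>, and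
  \<open>lorentz e\<close> is the polarization of \<open>|v\<^sub>L|\<^sup>2 - |v\<^sub>L\<^sub>\<bottom>|\<^sup>2\<close>. An ambient space of dimension
  \<open>n + 1\<close> gives \<open>H\<^sup>n\<close>, an infinite-dimensional separable Hilbert space gives \<open>H\<^sup>\<infinity>\<close>.\<close>

definition line_proj :: "'v::real_inner \<Rightarrow> 'v \<Rightarrow> 'v" where
  "line_proj e v = ((v \<bullet> e) / (e \<bullet> e)) *\<^sub>R e"

definition lorentz :: "'v::real_inner \<Rightarrow> 'v \<Rightarrow> 'v \<Rightarrow> real" where
  "lorentz e v w =
     line_proj e v \<bullet> line_proj e w - (v - line_proj e v) \<bullet> (w - line_proj e w)"

definition hyperbolic_space :: "'v::real_inner \<Rightarrow> 'v set" where
  "hyperbolic_space e = {v. lorentz e v v = 1 \<and> lorentz e v e > 0}"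

text \<open>The value off the hyperboloid is immaterial; it is set to 0 because the locale
  \<^locale>\<open>Metric_space\<close> asks for nonnegativity on the whole type.\<close>

definition hyp_dist :: "'v::real_inner \<Rightarrow> 'v \<Rightarrow> 'v \<Rightarrow> real" where
  "hyp_dist e x y =
     (if x \<in> hyperbolic_space e \<and> y \<in> hyperbolic_space e then arcosh (lorentz e x y) else 0)"

lemma lorentz_alt: "lorentz e v w = 2 * (v \<bullet> e) * (w \<bullet> e) / (e \<bullet> e) - v \<bullet> w"
  by (cases "e = 0")
    (simp_all add: lorentz_def line_proj_def inner_diff_left inner_diff_right inner_commute
      field_simps)

lemma lorentz_commute: "lorentz e v w = lorentz e w v"
  by (simp add: lorentz_alt inner_commute mult.commute mult.left_commute)

lemma lorentz_linear:
  "lorentz e (v - v') w = lorentz e v w - lorentz e v' w"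
  "lorentz e v (w - w') = lorentz e v w - lorentz e v w'"
  "lorentz e (a *\<^sub>R v) w = a * lorentz e v w"
  "lorentz e v (a *\<^sub>R w) = a * lorentz e v w"
  by (simp_all add: lorentz_alt inner_diff_left inner_diff_right algebra_simps diff_divide_distrib
      add_divide_distrib)

lemma lorentz_split:
  fixes e v w :: "'v::real_inner"
  assumes "e \<noteq> 0"
  defines "p \<equiv> \<lambda>v. v - line_proj e v"
  shows "lorentz e v w = (v \<bullet> e) / norm e * ((w \<bullet> e) / norm e) - p v \<bullet> p w"
  using assms by (simp add: lorentz_def line_proj_def norm_eq_sqrt_inner field_simps)

lemma lorentz_neg_def:
  assumes x: "x \<in> hyperbolic_space e" and orth: "lorentz e u x = 0"
  shows "lorentz e u u \<le> 0" and "lorentz e u u = 0 \<Longrightarrow> u = 0"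
proof -
  have e: "e \<noteq> 0" using x by (auto simp: hyperbolic_space_def lorentz_alt)
  define a where "a = (x \<bullet> e) / norm e"
  define b where "b = (u \<bullet> e) / norm e"
  define p where "p = x - line_proj e x"
  define q where "q = u - line_proj e u"
  have 1: "a * a - p \<bullet> p = 1" using x
    by (simp add: hyperbolic_space_def lorentz_split[OF e] a_def p_def)
  have 2: "b * a = q \<bullet> p" using orth by (simp add: lorentz_split[OF e] a_def b_def p_def q_def)
  have 3: "lorentz e u u = b * b - q \<bullet> q" by (simp add: lorentz_split[OF e] b_def q_def)
  have "(q \<bullet> p)\<^sup>2 \<le> (q \<bullet> q) * (p \<bullet> p)" by (rule Cauchy_Schwarz_ineq)
  moreover have "p \<bullet> p = a * a - 1" using 1 by linarith
  moreover have "(q \<bullet> p)\<^sup>2 = b * b * (a * a)" by (simp add: 2[symmetric] power2_eq_square)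
  ultimately have 4: "b * b * (a * a) \<le> (q \<bullet> q) * (a * a - 1)" by simp
  have pp: "p \<bullet> p \<ge> 0" by simp
  have a1: "a * a \<ge> 1" using 1 pp by linarith
  have key: "b * b = 0 \<and> q \<bullet> q = 0" if "b * b \<ge> q \<bullet> q"
  proof -
    have "(q \<bullet> q) * (a * a - 1) \<le> b * b * (a * a - 1)"
      using that a1 by (intro mult_right_mono) auto
    then have "b * b \<le> 0" using 4 by (simp add: algebra_simps)
    then have "b * b = 0" by (metis antisym zero_le_square)
    moreover have "q \<bullet> q \<ge> 0" by simp
    ultimately show ?thesis using that by linarith
  qed
  show "lorentz e u u \<le> 0" using key 3 by fastforce
  show "u = 0" if "lorentz e u u = 0"
  proof -
    have "b * b = 0 \<and> q \<bullet> q = 0" using key that 3 by simp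
    then have "u \<bullet> e = 0" "q = 0" using e by (auto simp: b_def)
    then show "u = 0" by (simp add: q_def line_proj_def)
  qed
qed

lemma lorentz_ge_1:
  assumes x: "x \<in> hyperbolic_space e" and y: "y \<in> hyperbolic_space e"
  shows "lorentz e x y \<ge> 1" and "lorentz e x y = 1 \<Longrightarrow> x = y"
proof -
  have e: "e \<noteq> 0" using x by (auto simp: hyperbolic_space_def lorentz_alt)
  define u where "u = y - lorentz e x y *\<^sub>R x"
  have xx: "lorentz e x x = 1" and yy: "lorentz e y y = 1"
    using x y by (auto simp: hyperbolic_space_def)
  have ux: "lorentz e u x = 0" by (simp add: u_def lorentz_linear xx lorentz_commute)
  have uu: "lorentz e u u = 1 - lorentz e x y * lorentz e x y"
    by (simp add: u_def lorentz_linear xx yy lorentz_commute[of e y x])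
  have sq: "lorentz e x y * lorentz e x y \<ge> 1" using lorentz_neg_def(1)[OF x ux] uu by simp
  define a where "a = (x \<bullet> e) / norm e"
  define b where "b = (y \<bullet> e) / norm e"
  define p where "p = x - line_proj e x"
  define q where "q = y - line_proj e y"
  have ee: "lorentz e z e = z \<bullet> e" for z by (simp add: lorentz_alt e)
  have ab: "a > 0" "b > 0" using x y e by (auto simp: hyperbolic_space_def a_def b_def ee)
  have A: "a * a - p \<bullet> p = 1" "b * b - q \<bullet> q = 1"
    using xx yy by (auto simp: lorentz_split[OF e] a_def b_def p_def q_def)
  have "norm p < a" "norm q < b"
    using A ab by (auto intro!: power2_less_imp_less[of _ a] power2_less_imp_less[of _ b]
        simp: power2_norm_eq_inner) (auto simp: power2_eq_square)
  then have "norm p * norm q < a * b" using ab by (intro mult_strict_mono) auto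
  then have "p \<bullet> q < a * b" using norm_cauchy_schwarz[of p q] by linarith
  then have pos: "lorentz e x y > 0"
    by (simp add: lorentz_split[OF e] a_def b_def p_def q_def)
  show "lorentz e x y \<ge> 1"
  proof (rule ccontr)
    assume "\<not> lorentz e x y \<ge> 1"
    then have "lorentz e x y * lorentz e x y < 1 * 1" using pos by (intro mult_strict_mono) auto
    then show False using sq by simp
  qed
  show "x = y" if "lorentz e x y = 1"
    using lorentz_neg_def(2)[OF x ux] uu that by (simp add: u_def)
qed

lemma lorentz_Cauchy_Schwarz:
  assumes x: "x \<in> hyperbolic_space e" and u: "lorentz e u x = 0" and w: "lorentz e w x = 0"
  shows "(lorentz e u w)\<^sup>2 \<le> lorentz e u u * lorentz e w w"
proof (cases "w = 0")
  case True
  then show ?thesis by (simp add: lorentz_alt)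
next
  case False
  define c where "c = lorentz e w w"
  define v where "v = c *\<^sub>R u - lorentz e u w *\<^sub>R w"
  have c: "c < 0" using lorentz_neg_def[OF x w] False by (fastforce simp: c_def)
  have "lorentz e v x = 0" by (simp add: v_def lorentz_linear u w)
  then have "lorentz e v v \<le> 0" by (rule lorentz_neg_def(1)[OF x])
  also have "lorentz e v v = c * (lorentz e u u * c - (lorentz e u w)\<^sup>2)"
    by (simp add: v_def lorentz_linear lorentz_commute[of e w u] c_def[symmetric]
        power2_eq_square algebra_simps)
  finally show ?thesis using c by (auto simp: mult_le_0_iff c_def)
qed

lemma hyp_dist_triangle:
  assumes x: "x \<in> hyperbolic_space e" and y: "y \<in> hyperbolic_space e"
    and z: "z \<in> hyperbolic_space e"
  shows "hyp_dist e x z \<le> hyp_dist e x y + hyp_dist e y z"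
proof -
  define q where "q = lorentz e x y"
  define r where "r = lorentz e y z"
  define u where "u = x - q *\<^sub>R y"
  define w where "w = z - r *\<^sub>R y"
  have norm1: "lorentz e x x = 1" "lorentz e y y = 1" "lorentz e z z = 1"
    using x y z by (auto simp: hyperbolic_space_def)
  have qr: "q \<ge> 1" "r \<ge> 1" and xz: "lorentz e x z \<ge> 1"
    using lorentz_ge_1(1) x y z by (auto simp: q_def r_def)
  have orth: "lorentz e u y = 0" "lorentz e w y = 0"
    by (simp_all add: u_def w_def lorentz_linear norm1 q_def r_def lorentz_commute)
  have uw: "lorentz e u w = lorentz e x z - q * r"
    using norm1 by (simp add: u_def w_def lorentz_linear q_def r_def lorentz_commute)
  have uu: "lorentz e u u = 1 - q\<^sup>2" "lorentz e w w = 1 - r\<^sup>2"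
    using norm1 by (simp_all add: u_def w_def lorentz_linear q_def r_def lorentz_commute
        power2_eq_square algebra_simps)
  have "(lorentz e u w)\<^sup>2 \<le> (q\<^sup>2 - 1) * (r\<^sup>2 - 1)"
    using lorentz_Cauchy_Schwarz[OF y orth] unfolding uu by (simp add: algebra_simps)
  then have "lorentz e u w \<le> sqrt ((q\<^sup>2 - 1) * (r\<^sup>2 - 1))" by (rule real_le_rsqrt)
  then have "lorentz e x z \<le> q * r + sqrt (q\<^sup>2 - 1) * sqrt (r\<^sup>2 - 1)"
    by (simp add: uw real_sqrt_mult)
  also have "\<dots> = cosh (arcosh q + arcosh r)"
    using qr by (simp add: cosh_add sinh_arcosh_real)
  finally have "cosh (arcosh (lorentz e x z)) \<le> cosh (arcosh q + arcosh r)"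
    using xz by simp
  then have "arcosh (lorentz e x z) \<le> arcosh q + arcosh r"
    using qr xz by (subst (asm) cosh_real_nonneg_le_iff) auto
  then show ?thesis using x y z by (simp add: hyp_dist_def q_def r_def)
qed

context Metric_space
begin

definition geodesic_on :: "real set \<Rightarrow> (real \<Rightarrow> 'a) \<Rightarrow> bool" where
  "geodesic_on I c \<longleftrightarrow> c ` I \<subseteq> M \<and> (\<forall>s\<in>I. \<forall>t\<in>I. d (c s) (c t) = \<bar>s - t\<bar>)"

definition geodesically_convex :: "'a set \<Rightarrow> bool" where
  "geodesically_convex S \<longleftrightarrow>
     S \<subseteq> M \<and> (\<forall>l\<ge>0. \<forall>c. geodesic_on {0..l} c \<and> c 0 \<in> S \<and> c l \<in> S \<longrightarrow> c ` {0..l} \<subseteq> S)"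

definition closed_convex :: "'a set \<Rightarrow> bool" where
  "closed_convex S \<longleftrightarrow> closedin mtopology S \<and> geodesically_convex S"

definition closed_convex_hull :: "'a set \<Rightarrow> 'a set" where
  "closed_convex_hull S = closed_convex hull S"

text \<open>Rays are total functions of which only the values on \<open>[0,\<infinity>)\<close> matter; functions
  agreeing there are asymptotic, so they represent the same boundary point.\<close>

definition asymptotic :: "((real \<Rightarrow> 'a) \<times> (real \<Rightarrow> 'a)) set" where
  "asymptotic = {(c, c'). geodesic_on {0..} c \<and> geodesic_on {0..} c' \<and>
                          (\<exists>K. \<forall>t\<ge>0. d (c t) (c' t) \<le> K)}"

definition boundary :: "(real \<Rightarrow> 'a) set set" where
  "boundary = {c. geodesic_on {0..} c} // asymptotic"

text \<open>The boundary of a closed convex subset, viewed inside the boundary of the whole space.\<close>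

definition boundary_of :: "'a set \<Rightarrow> (real \<Rightarrow> 'a) set set" where
  "boundary_of S = {\<xi> \<in> boundary. \<exists>c\<in>\<xi>. c ` {0..} \<subseteq> S}"

text \<open>In the bordification \<open>M \<union> \<partial>M\<close>, points of \<open>M\<close> are tagged with \<^const>\<open>Inl\<close>
  and points of \<open>\<partial>M\<close> with \<^const>\<open>Inr\<close>. A basic neighbourhood of the
  endpoint of the ray \<open>c\<close> consists of all points at distance greater than \<open>r\<close> from \<open>c 0\<close>
  whose geodesic from \<open>c 0\<close> passes at time \<open>r\<close> within \<open>\<epsilon>\<close> of \<open>c r\<close>. All base points
  \<open>c 0\<close> are allowed; on a complete CAT(0) space each of them yields the same topology.\<close>

definition cone_nbhd :: "(real \<Rightarrow> 'a) \<Rightarrow> real \<Rightarrow> real \<Rightarrow> ('a + (real \<Rightarrow> 'a) set) set" where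
  "cone_nbhd c r \<epsilon> =
     Inl ` {x \<in> M. d (c 0) x > r \<and>
              (\<exists>\<gamma>. geodesic_on {0..d (c 0) x} \<gamma> \<and> \<gamma> 0 = c 0 \<and> \<gamma> (d (c 0) x) = x \<and>
                   d (\<gamma> r) (c r) < \<epsilon>)} \<union>
     Inr ` {\<xi> \<in> boundary. \<exists>\<gamma>\<in>\<xi>. \<gamma> 0 = c 0 \<and> d (\<gamma> r) (c r) < \<epsilon>}"

definition cone_topology :: "('a + (real \<Rightarrow> 'a) set) topology" where
  "cone_topology = topology_generated_by
     ({Inl ` mball x r | x r. x \<in> M \<and> r > 0} \<union>
      {cone_nbhd c r \<epsilon> | c r \<epsilon>. geodesic_on {0..} c \<and> r > 0 \<and> \<epsilon> > 0})"

definition boundary_hull :: "('a + (real \<Rightarrow> 'a) set) set \<Rightarrow> 'a set" where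
  "boundary_hull T = \<Inter>{K. closed_convex K \<and> T \<subseteq> Inr ` boundary_of K}"

end

interpretation hyp: Metric_space "hyperbolic_space e" "hyp_dist e" for e :: "'v::real_inner"
proof
  fix x y z :: 'v
  show "0 \<le> hyp_dist e x y" by (simp add: hyp_dist_def lorentz_ge_1)
  show "hyp_dist e x y = hyp_dist e y x" by (simp add: hyp_dist_def lorentz_commute)
  show "hyp_dist e x z \<le> hyp_dist e x y + hyp_dist e y z"
    if "x \<in> hyperbolic_space e" "y \<in> hyperbolic_space e" "z \<in> hyperbolic_space e"
    using that by (rule hyp_dist_triangle)
  show "hyp_dist e x y = 0 \<longleftrightarrow> x = y" if xy: "x \<in> hyperbolic_space e" "y \<in> hyperbolic_space e"
  proof
    assume "hyp_dist e x y = 0"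
    then have "cosh (arcosh (lorentz e x y)) = 1" using xy by (simp add: hyp_dist_def)
    then show "x = y" using lorentz_ge_1[OF xy] by simp
  next
    assume "x = y"
    then show "hyp_dist e x y = 0" using xy by (auto simp: hyp_dist_def hyperbolic_space_def)
  qed
qed

definition isom_group :: "'a set \<Rightarrow> ('a \<Rightarrow> 'a \<Rightarrow> real) \<Rightarrow> ('a \<Rightarrow> 'a) monoid" where
  "isom_group M d =
     (BijGroup M)\<lparr>carrier := {g \<in> Bij M. \<forall>x\<in>M. \<forall>y\<in>M. d (g x) (g y) = d x y}\<rparr>"

text \<open>Topology of pointwise convergence; for a proper space this is the usual (compact-open)
  topology of the isometry group.\<close>

definition isom_topology :: "'a set \<Rightarrow> ('a \<Rightarrow> 'a \<Rightarrow> real) \<Rightarrow> ('a \<Rightarrow> 'a) topology" where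
  "isom_topology M d =
     subtopology (product_topology (\<lambda>_. Metric_space.mtopology M d) M) (carrier (isom_group M d))"

definition translation_length :: "'a set \<Rightarrow> ('a \<Rightarrow> 'a \<Rightarrow> real) \<Rightarrow> ('a \<Rightarrow> 'a) \<Rightarrow> real" where
  "translation_length M d g = (INF x\<in>M. d (g x) x)"

abbreviation Isom_hyp :: "'v::real_inner \<Rightarrow> ('v \<Rightarrow> 'v) monoid" where
  "Isom_hyp e \<equiv> isom_group (hyperbolic_space e) (hyp_dist e)"

lemma subgroup_isom: "subgroup (carrier (isom_group M d)) (BijGroup M)"
proof -
  interpret group "BijGroup M" by (rule group_BijGroup)
  have c: "carrier (isom_group M d) \<subseteq> Bij M" by (auto simp: isom_group_def)
  have ext: "g x \<in> M" if "g \<in> Bij M" "x \<in> M" for g x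
    using that by (auto simp: Bij_def bij_betw_def)
  show ?thesis
  proof (rule subgroupI)
    show "carrier (isom_group M d) \<subseteq> carrier (BijGroup M)" using c by (simp add: BijGroup_def)
    show "carrier (isom_group M d) \<noteq> {}"
      using id_Bij[of M] by (force simp: isom_group_def)
    show "inv\<^bsub>BijGroup M\<^esub> g \<in> carrier (isom_group M d)" if g: "g \<in> carrier (isom_group M d)" for g
    proof -
      have gB: "g \<in> Bij M" using g c by blast
      have gd: "d (g x) (g y) = d x y" if "x \<in> M" "y \<in> M" for x y
        using g that by (simp add: isom_group_def)
      have surj: "g ` M = M" using gB by (auto simp: Bij_def bij_betw_def)
      show ?thesis
        unfolding inv_BijGroup[OF gB]
        using restrict_inv_into_Bij[OF gB] surj
        by (auto simp: isom_group_def inv_into_into f_inv_into_f gd[symmetric])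
    qed
    show "g \<otimes>\<^bsub>BijGroup M\<^esub> h \<in> carrier (isom_group M d)"
      if "g \<in> carrier (isom_group M d)" "h \<in> carrier (isom_group M d)" for g h
      using that c compose_Bij ext by (auto simp: isom_group_def BijGroup_def compose_eq)
  qed
qed

lemma group_isom_group: "group (isom_group M d)"
  using group.subgroup_imp_group[OF group_BijGroup subgroup_isom[of M d]]
  by (simp add: isom_group_def)

text \<open>The hyperboloid spans the ambient space, so the linear extension \<open>\<pi> g\<close> of
  \<open>\<rho> g\<close> is unique; it automatically preserves the form.\<close>

definition irreducible_rep :: "('g, 'm) monoid_scheme \<Rightarrow> 'h::real_inner \<Rightarrow> ('g \<Rightarrow> 'h \<Rightarrow> 'h) \<Rightarrow> bool" where
  "irreducible_rep G \<omega> \<rho> \<longleftrightarrow>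
     (\<exists>\<pi>. (\<forall>g\<in>carrier G. bounded_linear (\<pi> g) \<and> (\<forall>x\<in>hyperbolic_space \<omega>. \<pi> g x = \<rho> g x)) \<and>
          (\<forall>V. subspace V \<and> closed V \<and> (\<forall>g\<in>carrier G. \<pi> g ` V \<subseteq> V) \<longrightarrow> V = {0} \<or> V = UNIV))"

definition exotic_rep ::
    "real \<Rightarrow> 'a::euclidean_space \<Rightarrow> 'h::real_inner \<Rightarrow> (('a \<Rightarrow> 'a) \<Rightarrow> 'h \<Rightarrow> 'h) \<Rightarrow> bool" where
  "exotic_rep t e \<omega> \<rho> \<longleftrightarrow>
     \<rho> \<in> hom (Isom_hyp e) (Isom_hyp \<omega>) \<and>
     (\<forall>x\<in>hyperbolic_space \<omega>.
        continuous_map (isom_topology (hyperbolic_space e) (hyp_dist e)) (hyp.mtopology \<omega>)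
          (\<lambda>g. \<rho> g x)) \<and>
     irreducible_rep (Isom_hyp e) \<omega> \<rho> \<and>
     (\<forall>g\<in>carrier (Isom_hyp e).
        translation_length (hyperbolic_space \<omega>) (hyp_dist \<omega>) (\<rho> g) =
        t * translation_length (hyperbolic_space e) (hyp_dist e) g)"

definition invariant_closed_convex ::
    "('g, 'm) monoid_scheme \<Rightarrow> 'h::real_inner \<Rightarrow> ('g \<Rightarrow> 'h \<Rightarrow> 'h) \<Rightarrow> 'h set \<Rightarrow> bool" where
  "invariant_closed_convex G \<omega> \<rho> C \<longleftrightarrow>
     C \<noteq> {} \<and> hyp.closed_convex \<omega> C \<and> (\<forall>g\<in>carrier G. \<rho> g ` C \<subseteq> C)"

definition minimal_invariant ::
    "('g, 'm) monoid_scheme \<Rightarrow> 'h::real_inner \<Rightarrow> ('g \<Rightarrow> 'h \<Rightarrow> 'h) \<Rightarrow> 'h set \<Rightarrow> bool" where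
  "minimal_invariant G \<omega> \<rho> C \<longleftrightarrow>
     invariant_closed_convex G \<omega> \<rho> C \<and>
     (\<forall>D. invariant_closed_convex G \<omega> \<rho> D \<and> D \<subseteq> C \<longrightarrow> D = C)"

definition equivariant_map ::
    "'a::real_inner \<Rightarrow> 'h::real_inner \<Rightarrow> (('a \<Rightarrow> 'a) \<Rightarrow> 'h \<Rightarrow> 'h) \<Rightarrow> ('a \<Rightarrow> 'h) \<Rightarrow> bool" where
  "equivariant_map e \<omega> \<rho> f \<longleftrightarrow>
     f ` hyperbolic_space e \<subseteq> hyperbolic_space \<omega> \<and>
     (\<forall>g\<in>carrier (Isom_hyp e). \<forall>x\<in>hyperbolic_space e. f (g x) = \<rho> g (f x))"

definition continuous_extension ::
    "'a::real_inner \<Rightarrow> 'h::real_inner \<Rightarrow> ('a \<Rightarrow> 'h) \<Rightarrow>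
     ('a + (real \<Rightarrow> 'a) set \<Rightarrow> 'h + (real \<Rightarrow> 'h) set) \<Rightarrow> bool" where
  "continuous_extension e \<omega> f F \<longleftrightarrow>
     continuous_map (hyp.cone_topology e) (hyp.cone_topology \<omega>) F \<and>
     (\<forall>x\<in>hyperbolic_space e. F (Inl x) = Inl (f x))"

end

theory Submission
  imports Defs
begin

text \<open>Boundary points are rays of null vectors. For a null vector \<open>w\<close> let \<open>bv w\<close> be the null vector
  representing \<open>F [w]\<close>, normalised against \<open>p = f x0\<close>. The vectors orthogonal to all \<open>bv w\<close> form
  an invariant closed subspace, so by irreducibility they vanish. As the stabiliser of \<open>x0\<close> is transitive
  on the boundary, a point fixed by it pairs with all \<open>bv w\<close> equally and hence equals \<open>p\<close>; projecting
  \<open>p\<close> to \<open>C\<close> then yields \<open>p \<in> C\<close>, and minimality identifies \<open>C\<close> with both hulls.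

  The translation lengths determine how \<open>B' (f x) (f y)\<close> grows with \<open>B x y\<close>, and letting \<open>x\<close> and \<open>y\<close>
  tend to the boundary gives \<open>B' (bv w) (bv u) = (B w u)\<^sup>t / L\<close>. Hence the limit set is compact, so that any
  other boundary point is cut off from it by a half-space; and an isometry of \<open>C\<close>, which acts on
  the limit set preserving cross-ratios, induces on the null vectors of the source a map preserving the
  Gram matrix after rescaling by \<open>1/t\<close>-th powers. That map is linear, and it is the isometry sought.\<close>

section \<open>The Lorentz form\<close>

text \<open>The target is infinite-dimensional and its boundary is not compact, so all limits are
  read off from the numbers \<open>B' x y\<close>. This loses nothing: on the complement of a point
  of the hyperboloid the form is negative definite, hence pairings with a point that tend to 1 mean
  metric convergence to it, and two null vectors of the same sheet with pairing 0 span the same ray.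
  The quantitative input is a boost of the source along a geodesic line through \<open>x0\<close>.
  Its image scales the boundary values of both ends of the line, so its translation length t s makes
  the scaling factor exp (t s) or its inverse. How it acts on the complement of these two null
  vectors is unknown, but that changes the displacement of \<open>p\<close> only by a bounded
  amount, which disappears after division by (cosh s) powr t. An isometry of \<open>C\<close> need
  not fix \<open>p\<close>, so it carries the normalised null vectors to normalised ones only up to
  factors m w. The form controls only the products m w * m u for distinct boundary points, and three
  distinct points are needed to recover each factor. Here n \<ge> 2 enters, since for n = 1 the
  boundary has only two points.\<close>

notation hyperbolic_space ("\<H>")

lemma lorentz_add:
  "lorentz e (v + v') w = lorentz e v w + lorentz e v' w"
  "lorentz e v (w + w') = lorentz e v w + lorentz e v w'"
  by (simp_all add: lorentz_alt inner_add_left inner_add_right algebra_simps add_divide_distrib)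

lemma lorentz_minus:
  "lorentz e (- v) w = - lorentz e v w" "lorentz e v (- w) = - lorentz e v w"
  by (simp_all add: lorentz_alt)

lemma lorentz_zero [simp]: "lorentz e 0 w = 0" "lorentz e w 0 = 0"
  by (simp_all add: lorentz_alt)

lemmas lorentz_bilin = lorentz_linear lorentz_add lorentz_minus

lemma lorentz_base: "lorentz e v e = v \<bullet> e"
  by (cases "e = 0") (simp_all add: lorentz_alt)

lemma continuous_on_lorentz [continuous_intros]:
  assumes "continuous_on S f" "continuous_on S g"
  shows "continuous_on S (\<lambda>x. lorentz e (f x) (g x))"
  unfolding lorentz_alt by (cases "e = 0") (auto intro!: continuous_intros assms)

lemma tendsto_lorentz:
  assumes "(f \<longlongrightarrow> a) G" "(g \<longlongrightarrow> b) G"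
  shows "((\<lambda>x. lorentz e (f x) (g x)) \<longlongrightarrow> lorentz e a b) G"
  unfolding lorentz_alt by (cases "e = 0") (auto intro!: tendsto_intros assms)

lemma hyperbolic_space_nonzero: "x \<in> \<H> e \<Longrightarrow> e \<noteq> 0"
  by (auto simp: hyperbolic_space_def lorentz_alt)

lemma hyp_unit: "x \<in> \<H> e \<Longrightarrow> lorentz e x x = 1"
  by (simp add: hyperbolic_space_def)

lemma hyperbolic_space_pos: "x \<in> \<H> e \<Longrightarrow> lorentz e x e > 0"
  by (simp add: hyperbolic_space_def)

section \<open>Null vectors and the reversed Cauchy-Schwarz inequality\<close>

definition null_cone :: "'v::real_inner \<Rightarrow> 'v set" where
  "null_cone e = {v. lorentz e v v = 0 \<and> lorentz e v e > 0}"

lemma null_coneD: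
  assumes "v \<in> null_cone e"
  shows "lorentz e v v = 0" "lorentz e v e > 0" "e \<noteq> 0" "v \<noteq> 0"
proof -
  show 1: "lorentz e v v = 0" "lorentz e v e > 0" using assms by (auto simp: null_cone_def)
  show "e \<noteq> 0" "v \<noteq> 0" using 1(2) by auto
qed

lemma null_cone_scale: "v \<in> null_cone e \<Longrightarrow> a > 0 \<Longrightarrow> a *\<^sub>R v \<in> null_cone e"
  by (simp add: null_cone_def lorentz_linear)

text \<open>Split off the components along \<open>e\<close>: causality says that the remainders
  satisfy norm p \<le> a and norm q \<le> b, so p \<bullet> q cannot exceed a b. Equality forces a q
  = b p, so that the two vectors are proportional and null.\<close>

lemma causal_nonneg:
  assumes v: "lorentz e v v \<ge> 0" "lorentz e v e > 0" and w: "lorentz e w w \<ge> 0" "lorentz e w e > 0"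
  shows "lorentz e v w \<ge> 0"
    and "lorentz e v w = 0 \<Longrightarrow> lorentz e v v = 0 \<and> w = (lorentz e w e / lorentz e v e) *\<^sub>R v"
proof -
  have e: "e \<noteq> 0" using v by (auto simp: lorentz_alt)
  define p where "p = v - line_proj e v"
  define q where "q = w - line_proj e w"
  define a where "a = (v \<bullet> e) / norm e"
  define b where "b = (w \<bullet> e) / norm e"
  have ab: "a > 0" "b > 0" using v w e by (auto simp: a_def b_def lorentz_base)
  have vv: "lorentz e v v = a * a - p \<bullet> p" by (simp only: lorentz_split[OF e] a_def p_def)
  have ww: "lorentz e w w = b * b - q \<bullet> q" by (simp only: lorentz_split[OF e] b_def q_def)
  have vw: "lorentz e v w = a * b - p \<bullet> q"
    by (simp only: lorentz_split[OF e] a_def b_def p_def q_def)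
  have "(norm p)\<^sup>2 \<le> a\<^sup>2" "(norm q)\<^sup>2 \<le> b\<^sup>2"
    using v(1) w(1) vv ww
    by (simp_all add: power2_norm_eq_inner power2_eq_square[of a] power2_eq_square[of b])
  then have na: "norm p \<le> a" "norm q \<le> b"
    using ab by (auto intro: power2_le_imp_le)
  have le: "p \<bullet> q \<le> norm p * norm q" by (rule norm_cauchy_schwarz)
  have "norm p * norm q \<le> a * b" using na ab by (intro mult_mono) auto
  then show "lorentz e v w \<ge> 0" using le vw by linarith
  assume "lorentz e v w = 0"
  then have pq: "p \<bullet> q = a * b" using vw by simp
  have "(norm (a *\<^sub>R q - b *\<^sub>R p))\<^sup>2 = a * a * (q \<bullet> q) - 2 * a * b * (p \<bullet> q) + b * b * (p \<bullet> p)"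
    by (simp add: power2_norm_eq_inner inner_diff_left inner_diff_right inner_commute algebra_simps)
  also have "\<dots> \<le> a * a * (b * b) - 2 * a * b * (a * b) + b * b * (a * a)"
    using v(1) w(1) vv ww unfolding pq
    using ab by (intro add_mono diff_mono mult_left_mono) auto
  also have "\<dots> = 0" by simp
  finally have n0: "(norm (a *\<^sub>R q - b *\<^sub>R p))\<^sup>2 = 0"
    using zero_le_power2[of "norm (a *\<^sub>R q - b *\<^sub>R p)"] by linarith
  then have aq: "a *\<^sub>R q = b *\<^sub>R p" by simp
  have "a * (p \<bullet> q) = b * (p \<bullet> p)" using aq by (metis inner_scaleR_right)
  then have "b * (a * a) = b * (p \<bullet> p)" by (simp add: pq)
  then have "a * a = p \<bullet> p" using ab by simp
  then have "lorentz e v v = 0" by (simp add: vv)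
  moreover have "w = (lorentz e w e / lorentz e v e) *\<^sub>R v"
  proof -
    have ne: "v \<bullet> e = a * norm e" "w \<bullet> e = b * norm e" using e by (auto simp: a_def b_def)
    have "a *\<^sub>R w = a *\<^sub>R q + (a * b * norm e / (e \<bullet> e)) *\<^sub>R e"
      by (simp add: q_def line_proj_def ne scaleR_diff_right)
    also have "\<dots> = b *\<^sub>R v" by (simp add: aq p_def line_proj_def ne scaleR_diff_right algebra_simps)
    finally have "a *\<^sub>R w = b *\<^sub>R v" .
    then have "w = (b / a) *\<^sub>R v" using ab
      by (metis (no_types, lifting) divide_inverse_commute less_irrefl scaleR_scaleR vector_fraction_eq_iff)
    then show ?thesis using e ab by (simp add: lorentz_base ne)
  qed
  ultimately show "lorentz e v v = 0 \<and> w = (lorentz e w e / lorentz e v e) *\<^sub>R v" by simp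
qed

lemma null_hyp_pos:
  assumes "v \<in> null_cone e" "x \<in> \<H> e"
  shows "lorentz e v x > 0" "lorentz e x v > 0"
proof -
  have "lorentz e x v \<ge> 0" "lorentz e x v = 0 \<Longrightarrow> lorentz e x x = 0"
    using causal_nonneg[of e x v] assms by (auto simp: null_cone_def hyperbolic_space_def)
  then show "lorentz e x v > 0"
    using assms(2) by (fastforce simp: hyperbolic_space_def)
  then show "lorentz e v x > 0" by (simp add: lorentz_commute)
qed

text \<open>Equality of boundary points becomes the vanishing of a pairing, a condition that can be
  checked in the limit.\<close>

lemma null_null:
  assumes "v \<in> null_cone e" "w \<in> null_cone e"
  shows "lorentz e v w \<ge> 0"
    and "lorentz e v w = 0 \<longleftrightarrow> (\<exists>a>0. w = a *\<^sub>R v)"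
proof -
  show "lorentz e v w \<ge> 0" using causal_nonneg(1)[of e v w] assms by (simp add: null_cone_def)
  show "lorentz e v w = 0 \<longleftrightarrow> (\<exists>a>0. w = a *\<^sub>R v)"
  proof
    assume "lorentz e v w = 0"
    then have "w = (lorentz e w e / lorentz e v e) *\<^sub>R v"
      using causal_nonneg(2)[of e v w] assms by (auto simp: null_cone_def)
    then show "\<exists>a>0. w = a *\<^sub>R v" using null_coneD(2) assms by (metis divide_pos_pos)
  next
    assume "\<exists>a>0. w = a *\<^sub>R v"
    then show "lorentz e v w = 0" using assms by (auto simp: lorentz_linear null_cone_def)
  qed
qed

text \<open>The sheet can be tested against any of its points in place of \<open>e\<close>: a unit
  vector outside the sheet is minus a point of it, and would pair negatively with
  \<open>x\<close>.\<close>

lemma hyperbolic_spaceI: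
  assumes "x \<in> \<H> e" "lorentz e y y = 1" "lorentz e y x > 0"
  shows "y \<in> \<H> e"
proof (rule ccontr)
  assume n: "y \<notin> \<H> e"
  have e: "e \<noteq> 0" using assms hyperbolic_space_nonzero by blast
  have "lorentz e y e \<noteq> 0"
  proof
    assume "lorentz e y e = 0"
    then have "y \<bullet> e = 0" by (simp add: lorentz_base)
    then have "lorentz e y y = - (y \<bullet> y)" by (simp add: lorentz_alt[of e y y])
    then show False using assms(2) by (smt (verit) inner_ge_zero)
  qed
  then have "- y \<in> \<H> e"
    using n assms(2) by (auto simp: hyperbolic_space_def lorentz_minus)
  then have "lorentz e (- y) x \<ge> 1" using lorentz_ge_1 assms(1) by blast
  then show False using assms(3) by (simp add: lorentz_minus)
qed

lemma null_coneI:
  assumes "x \<in> \<H> e" "lorentz e v v = 0" "lorentz e v x > 0"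
  shows "v \<in> null_cone e"
proof -
  have e: "e \<noteq> 0" using assms hyperbolic_space_nonzero by blast
  have "lorentz e v e > 0"
  proof (rule ccontr)
    assume n: "\<not> ?thesis"
    show False
    proof (cases "lorentz e v e = 0")
      case True
      then have "lorentz e v v = - (v \<bullet> v)" by (simp add: lorentz_alt[of e v v] lorentz_base)
      then have "v = 0" using assms(2) by simp
      then show False using assms(3) by simp
    next
      case False
      then have "- v \<in> null_cone e" using n assms by (auto simp: null_cone_def lorentz_minus)
      from null_hyp_pos(1)[OF this assms(1)] show False using assms(3) by (simp add: lorentz_minus)
    qed
  qed
  then show ?thesis using assms by (simp add: null_cone_def)
qed

lemma base_point: "e \<noteq> 0 \<Longrightarrow> (1 / norm e) *\<^sub>R e \<in> \<H> e"
  by (auto simp: hyperbolic_space_def lorentz_linear lorentz_base dot_square_norm power2_eq_square)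

lemma hyperbolic_combination:
  assumes x: "x \<in> \<H> e" and y: "y \<in> \<H> e"
    and ab: "a \<ge> 0" "b \<ge> 0" and n: "lorentz e (a *\<^sub>R x + b *\<^sub>R y) (a *\<^sub>R x + b *\<^sub>R y) = 1"
  shows "a *\<^sub>R x + b *\<^sub>R y \<in> \<H> e"
proof (rule hyperbolic_spaceI[OF x n])
  have 1: "lorentz e x y \<ge> 1" using lorentz_ge_1 x y by blast
  have "a \<noteq> 0 \<or> b \<noteq> 0" using n by auto
  then have "a + b * lorentz e x y > 0" using ab 1
    by (smt (verit) mult_nonneg_nonneg mult_pos_pos)
  then show "lorentz e (a *\<^sub>R x + b *\<^sub>R y) x > 0"
    using hyp_unit[OF x] by (simp add: lorentz_bilin lorentz_commute)
qed

lemma lorentz_orth_bound: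
  assumes x: "x \<in> \<H> e" and u: "lorentz e u x = 0"
  shows "(lorentz e u z)\<^sup>2 \<le> - lorentz e u u * ((lorentz e z x)\<^sup>2 - lorentz e z z)"
proof -
  define w where "w = z - lorentz e z x *\<^sub>R x"
  have xx: "lorentz e x x = 1" using x by (simp add: hyperbolic_space_def)
  have 0: "lorentz e w x = 0" by (simp add: w_def lorentz_bilin xx)
  have "lorentz e u w = lorentz e u z" by (simp add: w_def lorentz_bilin u)
  moreover have "lorentz e w w = lorentz e z z - (lorentz e z x)\<^sup>2"
    by (simp add: w_def lorentz_bilin xx lorentz_commute[of e x z] power2_eq_square)
  moreover have "lorentz e u u * (lorentz e z z - (lorentz e z x)\<^sup>2) =
      - lorentz e u u * ((lorentz e z x)\<^sup>2 - lorentz e z z)"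
    by (simp add: algebra_simps)
  ultimately show ?thesis using lorentz_Cauchy_Schwarz[OF x u 0] by metis
qed

text \<open>Minus the form is an inner product on the complement of \<open>x\<close>, so vectors
  there whose form tends to 0 pair to 0 in the limit with every fixed \<open>z\<close>. This passes
  from metric convergence to convergence of all pairings.\<close>

lemma lorentz_orth_tendsto:
  assumes x: "x \<in> \<H> e" and u: "\<forall>\<^sub>F j in G. lorentz e (u j) x = 0"
    and lim: "((\<lambda>j. lorentz e (u j) (u j)) \<longlongrightarrow> 0) G"
  shows "((\<lambda>j. lorentz e (u j) z) \<longlongrightarrow> 0) G"
proof -
  have "((\<lambda>j. (lorentz e (u j) z)\<^sup>2) \<longlongrightarrow> 0) G"
  proof (rule tendsto_sandwich[OF _ _ tendsto_const])
    show "\<forall>\<^sub>F j in G. 0 \<le> (lorentz e (u j) z)\<^sup>2" by simp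
    show "\<forall>\<^sub>F j in G. (lorentz e (u j) z)\<^sup>2
        \<le> - lorentz e (u j) (u j) * ((lorentz e z x)\<^sup>2 - lorentz e z z)"
      using u by eventually_elim (rule lorentz_orth_bound[OF x])
    have "((\<lambda>j. - lorentz e (u j) (u j) * ((lorentz e z x)\<^sup>2 - lorentz e z z)) \<longlongrightarrow>
      - 0 * ((lorentz e z x)\<^sup>2 - lorentz e z z)) G"
      by (intro tendsto_intros lim)
    then show "((\<lambda>j. - lorentz e (u j) (u j) * ((lorentz e z x)\<^sup>2 - lorentz e z z)) \<longlongrightarrow> 0) G"
      by simp
  qed
  then show ?thesis by simp 
qed

section \<open>Distance and metric convergence in terms of the form\<close>

lemma hyp_dist_cosh:
  assumes "x \<in> \<H> e" "y \<in> \<H> e"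
  shows "cosh (hyp_dist e x y) = lorentz e x y"
  using assms lorentz_ge_1(1)[OF assms] by (simp add: hyp_dist_def)

lemma hyp_dist_eq_iff:
  assumes "x \<in> \<H> e" "y \<in> \<H> e" "r \<ge> 0"
  shows "hyp_dist e x y = r \<longleftrightarrow> lorentz e x y = cosh r"
  by (metis assms hyp.nonneg hyp_dist_cosh arcosh_cosh_real)

lemma hyp_dist_le_iff:
  assumes "x \<in> \<H> e" "y \<in> \<H> e" "r \<ge> 0"
  shows "hyp_dist e x y \<le> r \<longleftrightarrow> lorentz e x y \<le> cosh r"
  using assms hyp_dist_cosh[of x e y] cosh_real_nonneg_le_iff[of "hyp_dist e x y" r] by simp

lemma limitin_hyp_iff:
  "limitin (hyp.mtopology e) y x G \<longleftrightarrow>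
     x \<in> \<H> e \<and> (\<forall>\<^sub>F j in G. y j \<in> \<H> e) \<and>
     ((\<lambda>j. lorentz e (y j) x) \<longlongrightarrow> 1) G" (is "?L \<longleftrightarrow> ?R")
proof
  assume L: ?L
  then have x: "x \<in> \<H> e" and ev: "\<forall>\<^sub>F j in G. y j \<in> \<H> e"
    and d: "((\<lambda>j. hyp_dist e (y j) x) \<longlongrightarrow> 0) G"
    by (auto simp: hyp.limitin_metric_dist_null)
  have "((\<lambda>j. cosh (hyp_dist e (y j) x)) \<longlongrightarrow> cosh 0) G" by (intro tendsto_intros d)
  then have "((\<lambda>j. lorentz e (y j) x) \<longlongrightarrow> cosh 0) G"
    by (rule Lim_transform_eventually) (use ev in eventually_elim, simp add: hyp_dist_cosh x)
  then show ?R using x ev by simp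
next
  assume R: ?R
  show ?L unfolding hyp.limitin_metric_dist_null
  proof (intro conjI)
    show "x \<in> \<H> e" "\<forall>\<^sub>F j in G. y j \<in> \<H> e" using R by auto
    have "((\<lambda>j. arcosh (lorentz e (y j) x)) \<longlongrightarrow> arcosh 1) G"
      using R by (intro tendsto_arcosh_strong) (auto elim: eventually_mono simp: lorentz_ge_1)
    then have "((\<lambda>j. hyp_dist e (y j) x) \<longlongrightarrow> arcosh 1) G"
      by (rule Lim_transform_eventually) (use R in \<open>auto elim!: eventually_mono simp: hyp_dist_def\<close>)
    then show "((\<lambda>j. hyp_dist e (y j) x) \<longlongrightarrow> 0) G" by simp
  qed
qed

lemma hyp_limit_lorentz:
  assumes "limitin (hyp.mtopology e) y x G"
  shows "((\<lambda>j. lorentz e (y j) z) \<longlongrightarrow> lorentz e x z) G"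
proof -
  have x: "x \<in> \<H> e" and ev: "\<forall>\<^sub>F j in G. y j \<in> \<H> e"
    and l: "((\<lambda>j. lorentz e (y j) x) \<longlongrightarrow> 1) G"
    using assms by (auto simp: limitin_hyp_iff)
  \<comment> \<open>Component of \<open>y j\<close> orthogonal to the limit. Its form is 1 - (B (y
    j) x)^2, which tends to 0.\<close>
  define u where "u j = y j - lorentz e (y j) x *\<^sub>R x" for j
  have xx: "lorentz e x x = 1" using x by (simp add: hyperbolic_space_def)
  have "((\<lambda>j. lorentz e (u j) z) \<longlongrightarrow> 0) G"
  proof (rule lorentz_orth_tendsto[OF x])
    show "\<forall>\<^sub>F j in G. lorentz e (u j) x = 0" by (simp add: u_def lorentz_bilin xx)
    have "((\<lambda>j. 1 - (lorentz e (y j) x)\<^sup>2) \<longlongrightarrow> 1 - 1\<^sup>2) G" by (intro tendsto_intros l)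
    then have "((\<lambda>j. 1 - (lorentz e (y j) x)\<^sup>2) \<longlongrightarrow> 0) G" by simp
    then show "((\<lambda>j. lorentz e (u j) (u j)) \<longlongrightarrow> 0) G"
      by (rule Lim_transform_eventually)
        (use ev in \<open>auto elim!: eventually_mono simp: u_def lorentz_bilin xx
          lorentz_commute[of e x "y _"] hyp_unit power2_eq_square\<close>)
  qed
  then have "((\<lambda>j. lorentz e (u j) z + lorentz e (y j) x * lorentz e x z) \<longlongrightarrow> 0 + 1 * lorentz e x z) G"
    by (intro tendsto_intros l)
  then show ?thesis by (simp add: u_def lorentz_bilin)
qed

section \<open>Geodesics and boundary points\<close>

lemma geodesic_onD:
  assumes "hyp.geodesic_on e I c" "s \<in> I" "r \<in> I"
  shows "c s \<in> \<H> e" "lorentz e (c s) (c r) = cosh (s - r)"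
proof -
  have m: "c s \<in> \<H> e" "c r \<in> \<H> e"
    using assms unfolding hyp.geodesic_on_def by blast+
  then show "c s \<in> \<H> e" by simp
  have "hyp_dist e (c s) (c r) = \<bar>s - r\<bar>" using assms by (simp add: hyp.geodesic_on_def)
  then show "lorentz e (c s) (c r) = cosh (s - r)" using hyp_dist_cosh[OF m] by simp
qed

lemma geodesic_onI:
  assumes "\<And>s. s \<in> I \<Longrightarrow> c s \<in> \<H> e"
    and "\<And>s r. s \<in> I \<Longrightarrow> r \<in> I \<Longrightarrow> lorentz e (c s) (c r) = cosh (s - r)"
  shows "hyp.geodesic_on e I c"
  unfolding hyp.geodesic_on_def
  using assms by (auto simp: hyp_dist_eq_iff)

text \<open>Equality in the triangle inequality forces linear dependence. By the addition theorems
  the defect \<open>z\<close> is orthogonal to \<open>a\<close>, \<open>b\<close> and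
  \<open>c\<close>, of which it is a combination; so it is null as well as orthogonal to
  \<open>b\<close>, and therefore zero.\<close>

lemma geodesic_between:
  assumes a: "a \<in> \<H> e" and b: "b \<in> \<H> e" and c: "c \<in> \<H> e"
    and ab: "lorentz e a b = cosh s" and bc: "lorentz e b c = cosh r"
    and ac: "lorentz e a c = cosh (s + r)" and sr: "s + r > 0"
  shows "b = (sinh r / sinh (s + r)) *\<^sub>R a + (sinh s / sinh (s + r)) *\<^sub>R c"
proof -
  define h where "h = sinh (s + r)"
  have h: "h > 0" using sr by (simp add: h_def)
  define z where "z = h *\<^sub>R b - sinh r *\<^sub>R a - sinh s *\<^sub>R c"
  have n: "lorentz e a a = 1" "lorentz e b b = 1" "lorentz e c c = 1"
    using a b c by (auto simp: hyperbolic_space_def)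
  have ba: "lorentz e b a = cosh s" and cb: "lorentz e c b = cosh r" and ca: "lorentz e c a = cosh (s + r)"
    using ab bc ac by (simp_all add: lorentz_commute)
  have 1: "lorentz e z b = 0"
    by (simp add: z_def lorentz_bilin n ab cb h_def sinh_add algebra_simps)
  have "lorentz e z a = h * cosh s - sinh s * cosh (s + r) - sinh r"
    by (simp add: z_def lorentz_bilin n ba ca)
  also have "h * cosh s - sinh s * cosh (s + r) = sinh (s + r - s)"
    by (simp only: h_def sinh_diff) (simp add: algebra_simps)
  finally have 2: "lorentz e z a = 0" by simp
  have "lorentz e z c = h * cosh r - sinh r * cosh (s + r) - sinh s"
    by (simp add: z_def lorentz_bilin n bc ac)
  also have "h * cosh r - sinh r * cosh (s + r) = sinh (s + r - r)"
    by (simp only: h_def sinh_diff) (simp add: algebra_simps)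
  finally have 3: "lorentz e z c = 0" by simp
  have "lorentz e z z = h * lorentz e z b - sinh r * lorentz e z a - sinh s * lorentz e z c"
    by (subst (2) z_def) (simp add: lorentz_bilin)
  then have "lorentz e z z = 0" by (simp add: 1 2 3)
  then have "z = 0" using lorentz_neg_def(2)[OF b 1] by simp
  then have "h *\<^sub>R b = sinh r *\<^sub>R a + sinh s *\<^sub>R c" by (simp add: z_def algebra_simps)
  then have "(1 / h) *\<^sub>R (h *\<^sub>R b) = (1 / h) *\<^sub>R (sinh r *\<^sub>R a + sinh s *\<^sub>R c)" by simp
  then show ?thesis using h by (simp add: scaleR_add_right h_def)
qed

text \<open>The point at distance \<open>s\<close> from \<open>x\<close> on the geodesic to
  \<open>y\<close>. For x = y the divisions by 0 make it the zero vector, so the lemmas that use it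
  as a geodesic ask for distinct ends.\<close>

definition segment :: "'v::real_inner \<Rightarrow> 'v \<Rightarrow> 'v \<Rightarrow> real \<Rightarrow> 'v" where
  "segment e x y s = (sinh (hyp_dist e x y - s) / sinh (hyp_dist e x y)) *\<^sub>R x
     + (sinh s / sinh (hyp_dist e x y)) *\<^sub>R y"

lemma geodesic_segment_unique:
  assumes "hyp.geodesic_on e {0..l} c" "0 \<le> s" "s \<le> l" "l > 0"
  shows "hyp_dist e (c 0) (c l) = l" "c s = segment e (c 0) (c l) s"
proof -
  have in_i: "0 \<in> {0..l}" "s \<in> {0..l}" "l \<in> {0..l}" using assms by auto
  note D = geodesic_onD[OF assms(1)]
  show d: "hyp_dist e (c 0) (c l) = l"
    using assms in_i by (auto simp: hyp.geodesic_on_def)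
  have "c s = (sinh (l - s) / sinh (s + (l - s))) *\<^sub>R c 0 + (sinh s / sinh (s + (l - s))) *\<^sub>R c l"
    by (rule geodesic_between[where e = e])
      (use D(1)[of 0 0] D(1)[of s s] D(1)[of l l] D(2)[of 0 s] D(2)[of s l] D(2)[of 0 l] in_i assms
       cosh_minus[of "l - s"] in auto)
  then show "c s = segment e (c 0) (c l) s" by (simp add: segment_def d)
qed

lemma segment_geodesic:
  assumes x: "x \<in> \<H> e" and y: "y \<in> \<H> e" and ne: "x \<noteq> y"
  defines "l \<equiv> hyp_dist e x y"
  shows "hyp.geodesic_on e {0..l} (segment e x y)" "segment e x y 0 = x" "segment e x y l = y" "l > 0"
proof -
  have n: "lorentz e x x = 1" "lorentz e y y = 1"
    using x y by (auto simp: hyperbolic_space_def)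
  show l: "l > 0" using ne x y hyp.nonneg[of e x y] hyp.zero[OF x y] by (simp add: l_def less_le)
  have xy: "lorentz e x y = cosh l" using hyp_dist_cosh[OF x y] by (simp add: l_def)
  have h: "sinh l > 0" using l by simp
  show "segment e x y 0 = x" "segment e x y l = y" using h by (auto simp: segment_def l_def[symmetric])
  have B: "lorentz e (segment e x y s) (segment e x y r) = cosh (s - r)" for s r
  proof -
    have "lorentz e (segment e x y s) (segment e x y r) * (sinh l * sinh l) =
      sinh (l - s) * sinh (l - r) + sinh s * sinh r + (sinh (l - s) * sinh r + sinh s * sinh (l - r)) * cosh l"
      using h by (simp add: segment_def l_def[symmetric] lorentz_bilin n xy lorentz_commute[of e y x]
          field_simps)
    also have "\<dots> = cosh (s - r) * (sinh l * sinh l)"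
    proof -
      have c2: "cosh l * cosh l = 1 + sinh l * sinh l"
        using cosh_square_eq[of l] by (simp add: power2_eq_square)
      have "sinh (l - s) * sinh (l - r) + sinh s * sinh r + (sinh (l - s) * sinh r + sinh s * sinh (l - r)) * cosh l
        = (cosh s * cosh r) * (sinh l * sinh l) - (cosh l * cosh l) * (sinh s * sinh r) + sinh s * sinh r"
        by (simp add: sinh_diff algebra_simps)
      also have "\<dots> = cosh (s - r) * (sinh l * sinh l)"
        unfolding c2 by (simp add: cosh_diff algebra_simps)
      finally show ?thesis .
    qed
    finally show ?thesis using h by simp
  qed
  show "hyp.geodesic_on e {0..l} (segment e x y)"
  proof (rule geodesic_onI)
    fix s assume s: "s \<in> {0..l}"
    have "sinh (l - s) / sinh l \<ge> 0" "sinh s / sinh l \<ge> 0" using s h by auto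
    then show "segment e x y s \<in> \<H> e"
      using hyperbolic_combination[OF x y] B[of s s] by (simp add: segment_def l_def)
  qed (rule B)
qed

lemma convex_segment:
  assumes "hyp.geodesically_convex e S" "x \<in> S" "y \<in> S" "x \<noteq> y" "0 \<le> s" "s \<le> hyp_dist e x y"
  shows "segment e x y s \<in> S"
proof -
  have "S \<subseteq> \<H> e" using assms by (simp add: hyp.geodesically_convex_def)
  then have "x \<in> \<H> e" "y \<in> \<H> e" using assms by auto
  note G = segment_geodesic[OF this assms(4)]
  have "segment e x y ` {0..hyp_dist e x y} \<subseteq> S"
    using assms G unfolding hyp.geodesically_convex_def by (metis less_imp_le)
  then show ?thesis using assms by auto
qed

text \<open>Makes geodesic convexity usable as linear algebra. The point of the segment whose
  \<open>y\<close>-coefficient is \<open>b\<close> also has \<open>x\<close>-coefficient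
  \<open>a\<close>, because both are nonnegative roots of the quadratic equation that expresses norm
  one.\<close>

lemma convex_combination:
  assumes S: "hyp.geodesically_convex e S" and xy: "x \<in> S" "y \<in> S" and ab: "a \<ge> 0" "b \<ge> 0"
    and n: "lorentz e (a *\<^sub>R x + b *\<^sub>R y) (a *\<^sub>R x + b *\<^sub>R y) = 1"
  shows "a *\<^sub>R x + b *\<^sub>R y \<in> S"
proof (cases "x = y")
  case True
  have x: "x \<in> \<H> e" using assms by (auto simp: hyp.geodesically_convex_def)
  have "(a + b) * (a + b) = 1" using n hyp_unit[OF x]
    by (simp add: True lorentz_bilin algebra_simps)
  then have "(a + b)\<^sup>2 = 1" by (simp add: power2_eq_square)
  then have "a + b = 1" using ab by (simp add: power2_eq_1_iff)
  then show ?thesis using xy True by (simp add: scaleR_add_left[symmetric])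
next
  case False
  have x: "x \<in> \<H> e" and y: "y \<in> \<H> e"
    using assms by (auto simp: hyp.geodesically_convex_def)
  define l where "l = hyp_dist e x y"
  note G = segment_geodesic[OF x y False, folded l_def]
  have c: "lorentz e x y = cosh l" using hyp_dist_cosh[OF x y] by (simp add: l_def)
  have nn: "lorentz e x x = 1" "lorentz e y y = 1"
    using x y by (auto simp: hyperbolic_space_def)
  have q: "a * a + 2 * a * b * cosh l + b * b = 1"
    using n by (simp add: lorentz_bilin nn c lorentz_commute[of e y x] algebra_simps)
  have h: "sinh l > 0" using G(4) by simp
  have "b * b \<le> 1" using q ab by (smt (verit) cosh_real_nonneg mult_nonneg_nonneg)
  then have "b\<^sup>2 \<le> 1\<^sup>2" by (simp add: power2_eq_square)
  then have b1: "b \<le> 1" by (rule power2_le_imp_le) simp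
  \<comment> \<open>The time at which the segment has \<open>y\<close>-coefficient \<open>b\<close>;
    it lies in [0, l] because norm one forces b \<le> 1.\<close>
  define s where "s = arsinh (b * sinh l)"
  have ss: "sinh s = b * sinh l" by (simp add: s_def)
  have "sinh 0 \<le> sinh s" "sinh s \<le> sinh l" using ss b1 ab h by (auto simp: mult_left_le_one_le)
  then have s: "0 \<le> s" "s \<le> l" by (simp_all only: sinh_real_le_iff)
  define a' where "a' = sinh (l - s) / sinh l"
  have a': "a' \<ge> 0" using s h by (simp add: a'_def)
  have seg: "segment e x y s = a' *\<^sub>R x + b *\<^sub>R y"
    using h by (simp add: segment_def l_def[symmetric] a'_def ss)
  have "lorentz e (segment e x y s) (segment e x y s) = 1"
    using geodesic_onD(2)[OF G(1), of s s] s by simp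
  then have q': "a' * a' + 2 * a' * b * cosh l + b * b = 1"
    by (simp add: seg lorentz_bilin nn c lorentz_commute[of e y x] algebra_simps)
  have "(a - a') * (a + a' + 2 * b * cosh l) = 0" using q q' by (simp add: algebra_simps)
  then have "a = a'"
  proof (cases "a + a' + 2 * b * cosh l = 0")
    case True
    then have "a = 0 \<and> a' = 0" using ab a' by (smt (verit) cosh_real_nonneg mult_nonneg_nonneg)
    then show ?thesis by simp
  qed simp
  then show ?thesis
    using convex_segment[OF S xy False s(1)] s(2) seg by (simp add: l_def)
qed

text \<open>With v' = v / B x v this is cosh s x + sinh s (v' - x), the geodesic with initial unit
  tangent v' - x. The division makes it depend only on the ray spanned by \<open>v\<close>.\<close>

definition hray :: "'v::real_inner \<Rightarrow> 'v \<Rightarrow> 'v \<Rightarrow> real \<Rightarrow> 'v" where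
  "hray e x v s = exp (- s) *\<^sub>R x + (sinh s / lorentz e x v) *\<^sub>R v"

lemma hray_0 [simp]: "hray e x v 0 = x"
  by (simp add: hray_def)

lemma hray_scale: "a > 0 \<Longrightarrow> hray e x (a *\<^sub>R v) s = hray e x v s"
  by (simp add: hray_def lorentz_linear)

lemma exp_minus_cosh: "exp (- s) = cosh s - sinh (s::real)"
  by (simp add: cosh_field_def sinh_field_def field_simps)

lemma hray_lorentz:
  assumes x: "x \<in> \<H> e" and v: "v \<in> null_cone e"
  shows "lorentz e (hray e x v s) (hray e x v r) = cosh (s - r)"
    and "lorentz e (hray e x v s) v = exp (- s) * lorentz e x v"
    and "lorentz e (hray e x v s) x = cosh s"
proof -
  have xx: "lorentz e x x = 1" and vv: "lorentz e v v = 0" and p: "lorentz e x v > 0"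
    using hyp_unit[OF x] null_coneD(1)[OF v] null_hyp_pos(2)[OF v x] by auto
  have "lorentz e (hray e x v s) (hray e x v r) = exp (- s) * exp (- r) + exp (- s) * sinh r + sinh s * exp (- r)"
    using p by (simp add: hray_def lorentz_bilin xx vv lorentz_commute[of e v x] algebra_simps)
  also have "\<dots> = cosh (s - r)"
    by (simp add: exp_minus_cosh cosh_diff algebra_simps)
  finally show "lorentz e (hray e x v s) (hray e x v r) = cosh (s - r)" .
  show "lorentz e (hray e x v s) v = exp (- s) * lorentz e x v"
    by (simp add: hray_def lorentz_bilin vv)
  show "lorentz e (hray e x v s) x = cosh s"
    using p by (simp add: hray_def lorentz_bilin xx lorentz_commute[of e v x] exp_minus_cosh)
qed

lemma hray_in:
  assumes x: "x \<in> \<H> e" and v: "v \<in> null_cone e"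
  shows "hray e x v s \<in> \<H> e"
  by (rule hyperbolic_spaceI[OF x]) (simp_all add: hray_lorentz[OF x v])

lemma hray_geodesic:
  assumes x: "x \<in> \<H> e" and v: "v \<in> null_cone e"
  shows "hyp.geodesic_on e {0..} (hray e x v)"
  by (rule geodesic_onI) (auto simp: hray_lorentz[OF x v] hray_in[OF x v])

text \<open>Rays from all starting points are collected, with arbitrary values at negative times, so
  that the set is a full asymptotic class and can be compared with elements of the boundary by
  equality.\<close>

definition endpoint :: "'v::real_inner \<Rightarrow> 'v \<Rightarrow> (real \<Rightarrow> 'v) set" where
  "endpoint e v = {c. hyp.geodesic_on e {0..} c \<and> (\<forall>s\<ge>0. c s = hray e (c 0) v s)}"

lemma endpoint_scale: "a > 0 \<Longrightarrow> endpoint e (a *\<^sub>R v) = endpoint e v"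
  by (simp add: endpoint_def hray_scale)

lemma hray_endpoint:
  "x \<in> \<H> e \<Longrightarrow> v \<in> null_cone e \<Longrightarrow> hray e x v \<in> endpoint e v"
  by (simp add: endpoint_def hray_geodesic)

lemma geodesic_ray_endpoint:
  assumes c: "hyp.geodesic_on e {0..} c"
  obtains v where "v \<in> null_cone e" "lorentz e (c 0) v = 1" "c \<in> endpoint e v"
proof -
  note D = geodesic_onD[OF c]
  define x where "x = c 0"
  have x: "x \<in> \<H> e" using D(1)[of 0 0] by (simp add: x_def)
  have xx: "lorentz e x x = 1" using x by (simp add: hyperbolic_space_def)
  have s1: "sinh 1 > (0::real)" by simp
  \<comment> \<open>The initial unit tangent of the ray, recovered from its position at time
    1.\<close>
  define u where "u = (1 / sinh 1) *\<^sub>R (c 1 - cosh 1 *\<^sub>R x)"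
  define v where "v = x + u"
  have x1: "lorentz e x (c 1) = cosh 1" "lorentz e (c 1) x = cosh 1" "lorentz e (c 1) (c 1) = 1"
    using D(2)[of 0 1] D(2)[of 1 0] D(2)[of 1 1] by (auto simp: x_def)
  have xu: "lorentz e x u = 0" by (simp add: u_def lorentz_bilin xx x1)
  have "lorentz e u u * (sinh 1 * sinh 1) = 1 - cosh 1 * cosh 1"
    using s1 by (simp add: u_def lorentz_bilin xx x1)
  also have "\<dots> = - (sinh 1 * sinh (1::real))"
    using cosh_square_eq[of "1::real"] by (simp add: power2_eq_square)
  finally have "lorentz e u u * (sinh 1 * sinh 1) = (- 1) * (sinh 1 * sinh 1)" by simp
  then have uu: "lorentz e u u = - 1" using s1 by (metis mult_cancel_right mult_eq_0_iff less_irrefl)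
  have xv: "lorentz e x v = 1" by (simp add: v_def lorentz_bilin xx xu)
  have vv: "lorentz e v v = 0" by (simp add: v_def lorentz_bilin xx xu uu lorentz_commute[of e u x])
  have v: "v \<in> null_cone e" by (rule null_coneI[OF x vv]) (use xv in \<open>simp add: lorentz_commute[of e v x]\<close>)
  \<comment> \<open>Up to time 1 the point \<open>c s\<close> lies between \<open>c 0\<close> and
    \<open>c 1\<close>. Later \<open>c 1\<close> lies between \<open>c 0\<close> and
    \<open>c s\<close>, and the relation is solved for \<open>c s\<close>.\<close>
  have *: "c s = cosh s *\<^sub>R x + sinh s *\<^sub>R u" if s: "s \<ge> 0" for s
  proof (cases "s \<le> 1")
    case True
    have "c s = (sinh (1 - s) / sinh (s + (1 - s))) *\<^sub>R c 0 + (sinh s / sinh (s + (1 - s))) *\<^sub>R c 1"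
      by (rule geodesic_between[where e = e])
        (use D(1)[of 0 0] D(1)[of s s] D(1)[of 1 1] D(2)[of 0 s] D(2)[of s 1] D(2)[of 0 1] s True
         cosh_minus[of "1 - s"] in auto)
    then have "c s = (sinh (1 - s) / sinh 1) *\<^sub>R x + (sinh s / sinh 1) *\<^sub>R c 1" by (simp add: x_def)
    also have "c 1 = cosh 1 *\<^sub>R x + sinh 1 *\<^sub>R u" using s1 by (simp add: u_def)
    also have "(sinh (1 - s) / sinh 1) *\<^sub>R x + (sinh s / sinh 1) *\<^sub>R (cosh 1 *\<^sub>R x + sinh 1 *\<^sub>R u)
      = ((sinh (1 - s) + sinh s * cosh 1) / sinh 1) *\<^sub>R x + sinh s *\<^sub>R u"
      using s1 by (simp add: scaleR_add_right scaleR_add_left[symmetric] add_divide_distrib)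
    also have "(sinh (1 - s) + sinh s * cosh 1) / sinh 1 = cosh s"
      using s1 by (simp add: sinh_diff field_simps)
    finally show ?thesis .
  next
    case False
    have h: "sinh s > 0" using False by simp
    have "c 1 = (sinh (s - 1) / sinh (1 + (s - 1))) *\<^sub>R c 0 + (sinh 1 / sinh (1 + (s - 1))) *\<^sub>R c s"
      by (rule geodesic_between[where e = e])
        (use D(1)[of 0 0] D(1)[of s s] D(1)[of 1 1] D(2)[of 0 s] D(2)[of 1 s] D(2)[of 0 1] s False
         cosh_minus[of "s - 1"] in auto)
    then have "c 1 = (sinh (s - 1) / sinh s) *\<^sub>R x + (sinh 1 / sinh s) *\<^sub>R c s" by (simp add: x_def)
    then have "sinh s *\<^sub>R c 1 = sinh (s - 1) *\<^sub>R x + sinh 1 *\<^sub>R c s"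
      using h by (simp add: scaleR_add_right)
    then have "sinh 1 *\<^sub>R c s = sinh s *\<^sub>R c 1 - sinh (s - 1) *\<^sub>R x" by simp
    also have "c 1 = cosh 1 *\<^sub>R x + sinh 1 *\<^sub>R u" using s1 by (simp add: u_def)
    also have "sinh s *\<^sub>R (cosh 1 *\<^sub>R x + sinh 1 *\<^sub>R u) - sinh (s - 1) *\<^sub>R x
      = sinh 1 *\<^sub>R (cosh s *\<^sub>R x + sinh s *\<^sub>R u)"
      by (simp add: sinh_diff algebra_simps)
    finally show ?thesis using s1 by (simp only: scaleR_cancel_left) simp
  qed
  have "c \<in> endpoint e v"
    unfolding endpoint_def
  proof (intro CollectI conjI allI impI c)
    fix s :: real assume "s \<ge> 0"
    have "hray e (c 0) v s = exp (- s) *\<^sub>R x + sinh s *\<^sub>R v"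
      by (simp add: hray_def x_def[symmetric] xv)
    also have "\<dots> = cosh s *\<^sub>R x + sinh s *\<^sub>R u"
      by (simp add: exp_minus_cosh v_def algebra_simps)
    finally show "c s = hray e (c 0) v s" using *[OF \<open>s \<ge> 0\<close>] by simp
  qed
  then show thesis using that v xv by (simp add: x_def)
qed

lemma endpointD:
  assumes "c \<in> endpoint e v"
  shows "hyp.geodesic_on e {0..} c" "c 0 \<in> \<H> e" "s \<ge> 0 \<Longrightarrow> c s = hray e (c 0) v s"
proof -
  show g: "hyp.geodesic_on e {0..} c" using assms unfolding endpoint_def by blast
  show "c 0 \<in> \<H> e" by (rule geodesic_onD(1)[OF g]) auto
  show "s \<ge> 0 \<Longrightarrow> c s = hray e (c 0) v s" using assms unfolding endpoint_def by blast
qed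

text \<open>Along two rays the pairing of the moving points is k * (sinh s)^2 plus terms with
  bounded coefficients, where \<open>k\<close> is a positive multiple of the pairing of the null
  vectors. The distance thus stays bounded only if k = 0, and then the null vectors are
  proportional.\<close>

lemma asymptotic_iff:
  assumes v: "v \<in> null_cone e" and c: "c \<in> endpoint e v"
  shows "(c, c') \<in> hyp.asymptotic e \<longleftrightarrow> c' \<in> endpoint e v"
proof
  note cD = endpointD[OF c]
  have cx: "c 0 \<in> \<H> e" by (rule cD(2))
  { assume c': "c' \<in> endpoint e v"
    note c'D = endpointD[OF c']
    have c'x: "c' 0 \<in> \<H> e" by (rule c'D(2))
    define K where "K = lorentz e (c 0) (c' 0) + lorentz e (c 0) v / lorentz e (c' 0) v
      + lorentz e (c' 0) v / lorentz e (c 0) v"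
    have pos: "lorentz e (c 0) v > 0" "lorentz e (c' 0) v > 0" "lorentz e (c 0) (c' 0) \<ge> 1"
      using null_hyp_pos v cx c'x lorentz_ge_1(1)[OF cx c'x] by auto
    have "lorentz e (c 0) v / lorentz e (c' 0) v > 0" "lorentz e (c' 0) v / lorentz e (c 0) v > 0"
      using pos by (auto intro: divide_pos_pos)
    then have K: "K \<ge> 1" using pos(3) unfolding K_def by linarith
    have "hyp_dist e (c s) (c' s) \<le> arcosh K" if s: "s \<ge> 0" for s
    proof -
      have H: "hray e (c 0) v s \<in> \<H> e" "hray e (c' 0) v s \<in> \<H> e"
        using hray_in v cx c'x by auto
      have es: "exp (- s) * sinh s \<le> 1" "exp (- s) * exp (- s) \<le> 1" "exp (- s) * sinh s \<ge> 0"
      proof -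
        have p: "exp (- s) * exp (- s) > 0" by simp
        have "exp (- s) * sinh s = (1 - exp (- s) * exp (- s)) / 2"
          by (simp add: sinh_field_def exp_minus field_simps)
        moreover have "(1 - E) / 2 \<le> 1" if "E > 0" for E :: real using that by simp
        ultimately show "exp (- s) * sinh s \<le> 1" using p by metis
        show "exp (- s) * exp (- s) \<le> 1" using s by (simp add: mult_le_one)
        show "exp (- s) * sinh s \<ge> 0" using s by simp
      qed
      have "lorentz e (c s) (c' s) = (exp (- s) * exp (- s)) * lorentz e (c 0) (c' 0)
          + (exp (- s) * sinh s) * (lorentz e (c 0) v / lorentz e (c' 0) v)
          + (exp (- s) * sinh s) * (lorentz e (c' 0) v / lorentz e (c 0) v)"
        using null_coneD(1)[OF v]
        unfolding cD(3)[OF s] c'D(3)[OF s]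
        by (simp add: hray_def lorentz_bilin lorentz_commute[of e v "c' 0"] algebra_simps)
      also have "\<dots> \<le> 1 * lorentz e (c 0) (c' 0) + 1 * (lorentz e (c 0) v / lorentz e (c' 0) v)
          + 1 * (lorentz e (c' 0) v / lorentz e (c 0) v)"
        using pos es by (intro add_mono mult_right_mono) auto
      also have "\<dots> = K" by (simp add: K_def)
      finally show ?thesis using H K unfolding cD(3)[OF s] c'D(3)[OF s]
        by (subst hyp_dist_le_iff) auto
    qed
    then show "(c, c') \<in> hyp.asymptotic e"
      using cD(1) c'D(1) by (auto simp: hyp.asymptotic_def) }
  assume as: "(c, c') \<in> hyp.asymptotic e"
  then have c'g: "hyp.geodesic_on e {0..} c'" by (simp add: hyp.asymptotic_def)
  then obtain w where w: "w \<in> null_cone e" "c' \<in> endpoint e w" by (rule geodesic_ray_endpoint)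
  note c'D = endpointD[OF w(2)]
  have c'x: "c' 0 \<in> \<H> e" by (rule c'D(2))
  from as obtain K where K: "\<And>s. s \<ge> 0 \<Longrightarrow> hyp_dist e (c s) (c' s) \<le> K"
    by (auto simp: hyp.asymptotic_def)
  have pos: "lorentz e (c 0) v > 0" "lorentz e (c' 0) w > 0"
      "lorentz e (c 0) w > 0" "lorentz e (c' 0) v > 0" "lorentz e (c 0) (c' 0) \<ge> 1"
    using null_hyp_pos v w cx c'x lorentz_ge_1(1)[OF cx c'x] by auto
  define k where "k = lorentz e v w / (lorentz e (c 0) v * lorentz e (c' 0) w)"
  have k0: "k \<ge> 0" using null_null(1)[OF v w(1)] pos by (simp add: k_def)
  have "k = 0"
  proof (rule ccontr)
    assume "k \<noteq> 0"
    then have k: "k > 0" using k0 by simp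
    have lower: "k * (sinh s)\<^sup>2 \<le> cosh K" if s: "s \<ge> 0" for s
    proof -
      have "lorentz e (c s) (c' s) = k * (sinh s)\<^sup>2
          + exp (- s) * exp (- s) * lorentz e (c 0) (c' 0)
          + exp (- s) * sinh s * (lorentz e (c 0) w / lorentz e (c' 0) w)
          + exp (- s) * sinh s * (lorentz e (c' 0) v / lorentz e (c 0) v)"
        unfolding cD(3)[OF s] c'D(3)[OF s]
        by (simp add: hray_def lorentz_bilin lorentz_commute[of e v "c' 0"] k_def
            power2_eq_square algebra_simps)
      moreover have "exp (- s) * exp (- s) * lorentz e (c 0) (c' 0) \<ge> 0"
        "exp (- s) * sinh s * (lorentz e (c 0) w / lorentz e (c' 0) w) \<ge> 0"
        "exp (- s) * sinh s * (lorentz e (c' 0) v / lorentz e (c 0) v) \<ge> 0"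
        using pos s by auto
      ultimately have "k * (sinh s)\<^sup>2 \<le> lorentz e (c s) (c' s)" by linarith
      also have "\<dots> = cosh (hyp_dist e (c s) (c' s))"
        using hray_in[OF cx v] hray_in[OF c'x w(1)] unfolding cD(3)[OF s] c'D(3)[OF s]
        by (simp add: hyp_dist_cosh)
      also have "\<dots> \<le> cosh K" using cosh_real_nonneg_le_iff[OF hyp.nonneg[of e "c s" "c' s"] order_trans[OF hyp.nonneg K[OF s]]]
          K[OF s] by (simp only:)
      finally show ?thesis .
    qed
    \<comment> \<open>Chosen so that k * (sinh s)^2 = cosh K + 1, one more than the bound
      allows.\<close>
    define s where "s = arsinh (sqrt ((cosh K + 1) / k))"
    have q: "(cosh K + 1) / k \<ge> 0" using k cosh_real_nonneg[of K] by (intro divide_nonneg_pos) auto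
    then have "sinh 0 \<le> sinh s" by (simp add: s_def)
    then have s0: "s \<ge> 0" by (simp only: sinh_real_le_iff)
    have "sinh s = sqrt ((cosh K + 1) / k)" by (simp only: s_def sinh_arsinh_real)
    then have "(sinh s)\<^sup>2 = (cosh K + 1) / k" using real_sqrt_pow2[OF q] by (simp only:)
    then have "k * (sinh s)\<^sup>2 = cosh K + 1" using k by simp
    then show False using lower[OF s0] by linarith
  qed
  then have "lorentz e v w = 0" using pos by (simp add: k_def)
  then obtain a where "a > 0" "w = a *\<^sub>R v" using null_null(2)[OF v w(1)] by blast
  then show "c' \<in> endpoint e v" using w(2) by (simp add: endpoint_scale)
qed

lemma asymptotic_class:
  assumes v: "v \<in> null_cone e" and c: "c \<in> endpoint e v"
  shows "hyp.asymptotic e `` {c} = endpoint e v"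
  using asymptotic_iff[OF v c] by auto

lemma boundary_eq: "hyp.boundary e = endpoint e ` null_cone e"
proof (intro equalityI subsetI)
  fix \<xi> assume "\<xi> \<in> hyp.boundary e"
  then obtain c where c: "hyp.geodesic_on e {0..} c" "\<xi> = hyp.asymptotic e `` {c}"
    by (auto simp: hyp.boundary_def quotient_def)
  from c(1) obtain v where "v \<in> null_cone e" "c \<in> endpoint e v" by (rule geodesic_ray_endpoint)
  then show "\<xi> \<in> endpoint e ` null_cone e" using asymptotic_class c by blast
next
  fix \<xi> assume "\<xi> \<in> endpoint e ` null_cone e"
  then obtain v where v: "v \<in> null_cone e" "\<xi> = endpoint e v" by auto
  define c where "c = hray e ((1 / norm e) *\<^sub>R e) v"
  have c: "c \<in> endpoint e v"
    unfolding c_def by (rule hray_endpoint[OF base_point[OF null_coneD(3)[OF v(1)]] v(1)])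
  then have "\<xi> = hyp.asymptotic e `` {c}" using asymptotic_class[OF v(1) c] v(2) by simp
  then show "\<xi> \<in> hyp.boundary e"
    using endpointD(1)[OF c] unfolding hyp.boundary_def by (metis mem_Collect_eq quotientI)
qed

lemma endpoint_boundary: "v \<in> null_cone e \<Longrightarrow> endpoint e v \<in> hyp.boundary e"
  by (simp add: boundary_eq)

lemma endpoint_eqD:
  assumes v: "v \<in> null_cone e" and w: "w \<in> null_cone e"
    and c: "c \<in> endpoint e v" "c \<in> endpoint e w"
  shows "\<exists>a>0. w = a *\<^sub>R v"
proof -
  have x: "c 0 \<in> \<H> e" by (rule endpointD(2)[OF c(1)])
  have "hray e (c 0) v 1 = hray e (c 0) w 1"
    using endpointD(3)[OF c(1), of 1] endpointD(3)[OF c(2), of 1] by (metis zero_le_one)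
  then have eq: "(sinh 1 / lorentz e (c 0) v) *\<^sub>R v = (sinh 1 / lorentz e (c 0) w) *\<^sub>R w"
    by (simp add: hray_def)
  have pos: "lorentz e (c 0) v > 0" "lorentz e (c 0) w > 0"
    using null_hyp_pos(2)[OF v x] null_hyp_pos(2)[OF w x] by auto
  have s1: "sinh 1 > (0::real)" by simp
  have "w = (lorentz e (c 0) w / sinh 1) *\<^sub>R ((sinh 1 / lorentz e (c 0) w) *\<^sub>R w)"
    using pos s1 by simp
  also have "\<dots> = (lorentz e (c 0) w / lorentz e (c 0) v) *\<^sub>R v"
    unfolding eq[symmetric] using s1 by simp
  finally show ?thesis using pos by (meson divide_pos_pos)
qed

lemma endpoint_eq_iff:
  assumes v: "v \<in> null_cone e" and w: "w \<in> null_cone e"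
  shows "endpoint e v = endpoint e w \<longleftrightarrow> (\<exists>a>0. w = a *\<^sub>R v)"
proof
  assume "endpoint e v = endpoint e w"
  then show "\<exists>a>0. w = a *\<^sub>R v"
    using endpoint_eqD[OF v w] hray_endpoint[OF base_point[OF null_coneD(3)[OF v]] v] by blast
qed (auto simp: endpoint_scale)

lemma boundary_of_iff:
  assumes v: "v \<in> null_cone e" and S: "S \<subseteq> \<H> e"
  shows "endpoint e v \<in> hyp.boundary_of e S \<longleftrightarrow> (\<exists>x\<in>S. \<forall>s\<ge>0. hray e x v s \<in> S)"
proof
  assume "endpoint e v \<in> hyp.boundary_of e S"
  then obtain c where c: "c \<in> endpoint e v" "c ` {0..} \<subseteq> S"
    unfolding hyp.boundary_of_def by blast
  then show "\<exists>x\<in>S. \<forall>s\<ge>0. hray e x v s \<in> S"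
  proof (intro bexI[of _ "c 0"] allI impI)
    show "c 0 \<in> S" using c(2) by auto
    fix s :: real assume "s \<ge> 0"
    then show "hray e (c 0) v s \<in> S" using c(2) endpointD(3)[OF c(1), of s] by auto
  qed
next
  assume "\<exists>x\<in>S. \<forall>s\<ge>0. hray e x v s \<in> S"
  then obtain x where x: "x \<in> S" "\<forall>s\<ge>0. hray e x v s \<in> S" by blast
  then have "hray e x v \<in> endpoint e v" using hray_endpoint S v by blast
  moreover have "hray e x v ` {0..} \<subseteq> S" using x by auto
  ultimately show "endpoint e v \<in> hyp.boundary_of e S"
    unfolding hyp.boundary_of_def using endpoint_boundary[OF v] by blast
qed

section \<open>Convergence to the boundary, convex sets\<close>

text \<open>Convergence to a boundary point in linear terms: the rays spanned by \<open>y j\<close> converge weakly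
  to the one spanned by \<open>v\<close>. Weak convergence is all that the form detects and all that is needed.\<close>
definition tends_to :: "'v::real_inner \<Rightarrow> 'j filter \<Rightarrow> ('j \<Rightarrow> 'v) \<Rightarrow> 'v \<Rightarrow> bool" where
  "tends_to e G y v \<longleftrightarrow> v \<in> null_cone e \<and> (\<forall>\<^sub>F j in G. y j \<in> \<H> e) \<and>
     filterlim (\<lambda>j. lorentz e (y j) e) at_top G \<and>
     (\<forall>z. ((\<lambda>j. lorentz e (y j) z / lorentz e (y j) e) \<longlongrightarrow> lorentz e v z / lorentz e v e) G)"

text \<open>Dividing two convergent ratios replaces the reference vector \<open>a\<close> by any
  \<open>b\<close> on which the limit \<open>v\<close> is positive, so \<open>tends_to\<close> does
  not depend on its use of \<open>e\<close>.\<close>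

lemma ratio_change_base:
  fixes a b :: "'v::real_inner"
  assumes a: "filterlim (\<lambda>j. lorentz e (y j) a) at_top G"
    and lim: "\<And>z. ((\<lambda>j. lorentz e (y j) z / lorentz e (y j) a) \<longlongrightarrow> lorentz e v z / lorentz e v a) G"
    and pos: "lorentz e v a > 0" "lorentz e v b > 0"
  shows "filterlim (\<lambda>j. lorentz e (y j) b) at_top G"
    and "((\<lambda>j. lorentz e (y j) z / lorentz e (y j) b) \<longlongrightarrow> lorentz e v z / lorentz e v b) G"
proof -
  have ev: "\<forall>\<^sub>F j in G. lorentz e (y j) a > 0" using a by (simp add: filterlim_at_top_dense)
  have p: "lorentz e v b / lorentz e v a > 0" using pos by simp
  have "filterlim (\<lambda>j. lorentz e (y j) b / lorentz e (y j) a * lorentz e (y j) a) at_top G"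
    by (rule filterlim_tendsto_pos_mult_at_top[OF lim p a])
  then show "filterlim (\<lambda>j. lorentz e (y j) b) at_top G"
    by (rule filterlim_mono_eventually) (use ev in \<open>auto elim!: eventually_mono\<close>)
  have "((\<lambda>j. (lorentz e (y j) z / lorentz e (y j) a) / (lorentz e (y j) b / lorentz e (y j) a)) \<longlongrightarrow>
    (lorentz e v z / lorentz e v a) / (lorentz e v b / lorentz e v a)) G"
    using p by (intro tendsto_divide lim) auto
  then have "((\<lambda>j. lorentz e (y j) z / lorentz e (y j) b) \<longlongrightarrow>
    (lorentz e v z / lorentz e v a) / (lorentz e v b / lorentz e v a)) G"
    by (rule Lim_transform_eventually) (use ev in \<open>auto elim!: eventually_mono\<close>)
  then show "((\<lambda>j. lorentz e (y j) z / lorentz e (y j) b) \<longlongrightarrow> lorentz e v z / lorentz e v b) G"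
    using pos by simp
qed

lemma tends_toD:
  assumes "tends_to e G y v"
  shows "v \<in> null_cone e" "\<forall>\<^sub>F j in G. y j \<in> \<H> e"
  using assms by (auto simp: tends_to_def)

lemma tends_to_ratio:
  assumes t: "tends_to e G y v" and x: "x \<in> \<H> e"
  shows "filterlim (\<lambda>j. lorentz e (y j) x) at_top G"
    and "((\<lambda>j. lorentz e (y j) z / lorentz e (y j) x) \<longlongrightarrow> lorentz e v z / lorentz e v x) G"
proof -
  have a: "filterlim (\<lambda>j. lorentz e (y j) e) at_top G"
    and lim: "\<And>z. ((\<lambda>j. lorentz e (y j) z / lorentz e (y j) e) \<longlongrightarrow> lorentz e v z / lorentz e v e) G"
    using t by (auto simp: tends_to_def)
  note p = null_coneD(2)[OF tends_toD(1)[OF t]] null_hyp_pos(1)[OF tends_toD(1)[OF t] x]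
  show "filterlim (\<lambda>j. lorentz e (y j) x) at_top G"
    by (rule ratio_change_base(1)[OF a lim p])
  show "((\<lambda>j. lorentz e (y j) z / lorentz e (y j) x) \<longlongrightarrow> lorentz e v z / lorentz e v x) G"
    by (rule ratio_change_base(2)[OF a lim p])
qed

lemma tends_toI:
  assumes v: "v \<in> null_cone e" and ev: "\<forall>\<^sub>F j in G. y j \<in> \<H> e"
    and x: "x \<in> \<H> e"
    and a: "filterlim (\<lambda>j. lorentz e (y j) x) at_top G"
    and lim: "\<And>z. ((\<lambda>j. lorentz e (y j) z / lorentz e (y j) x) \<longlongrightarrow> lorentz e v z / lorentz e v x) G"
  shows "tends_to e G y v"
  unfolding tends_to_def
  using ratio_change_base[OF a lim null_hyp_pos(1)[OF v x] null_coneD(2)[OF v]] v ev by blast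

text \<open>Testing both limits against z = v gives 0 for the first, so \<open>w\<close> pairs to 0
  with \<open>v\<close>.\<close>

lemma tends_to_unique:
  assumes v: "tends_to e G y v" and w: "tends_to e G y w" and G: "G \<noteq> bot"
  shows "\<exists>a>0. w = a *\<^sub>R v"
proof -
  note vn = tends_toD(1)[OF v] and wn = tends_toD(1)[OF w]
  have "lorentz e v v / lorentz e v e = lorentz e w v / lorentz e w e"
  proof (rule tendsto_unique[OF G])
    show "((\<lambda>j. lorentz e (y j) v / lorentz e (y j) e) \<longlongrightarrow> lorentz e v v / lorentz e v e) G"
      using v by (simp add: tends_to_def)
    show "((\<lambda>j. lorentz e (y j) v / lorentz e (y j) e) \<longlongrightarrow> lorentz e w v / lorentz e w e) G"
      using w by (simp add: tends_to_def)
  qed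
  then have "lorentz e v w = 0"
    using null_coneD(1,2)[OF vn] null_coneD(2)[OF wn] by (simp add: lorentz_commute)
  then show ?thesis using null_null(2)[OF vn wn] by simp
qed

lemma tanh_real_at_top': "((\<lambda>s::real. sinh s / cosh s) \<longlongrightarrow> 1) at_top"
  using tanh_real_at_top by (simp add: tanh_def[abs_def])

lemma coth_real_at_top: "((\<lambda>s::real. cosh s / sinh s) \<longlongrightarrow> 1) at_top"
  using tendsto_inverse[OF tanh_real_at_top'] by simp

lemma hray_limit:
  assumes x: "x \<in> \<H> e" and v: "v \<in> null_cone e"
  shows "tends_to e at_top (hray e x v) v"
proof (rule tends_toI[OF v _ x])
  show "\<forall>\<^sub>F s in at_top. hray e x v s \<in> \<H> e" by (simp add: hray_in[OF x v])
  show "filterlim (\<lambda>s. lorentz e (hray e x v s) x) at_top at_top"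
    by (simp add: hray_lorentz[OF x v] cosh_real_at_top)
  have p: "lorentz e x v > 0" using null_hyp_pos(2)[OF v x] .
  fix z
  have "((\<lambda>s. (1 - sinh s / cosh s) * lorentz e x z + (sinh s / cosh s) * (lorentz e v z / lorentz e x v)) \<longlongrightarrow>
    (1 - 1) * lorentz e x z + 1 * (lorentz e v z / lorentz e x v)) at_top"
    by (intro tendsto_intros tanh_real_at_top')
  moreover have "(1 - sinh s / cosh s) * lorentz e x z + (sinh s / cosh s) * (lorentz e v z / lorentz e x v)
      = lorentz e (hray e x v s) z / lorentz e (hray e x v s) x" for s
    using p cosh_real_pos[of s]
    by (simp add: hray_lorentz[OF x v]) (simp add: hray_def lorentz_bilin exp_minus_cosh field_simps)
  ultimately show "((\<lambda>s. lorentz e (hray e x v s) z / lorentz e (hray e x v s) x) \<longlongrightarrow>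
      lorentz e v z / lorentz e v x) at_top"
    by (simp add: lorentz_commute[of e v x])
qed

lemma hyp_dist_at_top:
  assumes t: "tends_to e G y v" and x: "x \<in> \<H> e"
  shows "filterlim (\<lambda>j. hyp_dist e x (y j)) at_top G"
proof -
  have "filterlim (\<lambda>j. arcosh (lorentz e (y j) x)) at_top G"
    by (rule filterlim_compose[OF arcosh_real_at_top tends_to_ratio(1)[OF t x]])
  then show ?thesis
    by (rule filterlim_mono_eventually)
      (use tends_toD(2)[OF t] x in
        \<open>auto elim!: eventually_mono simp: hyp_dist_def lorentz_commute[of e x]\<close>)
qed

text \<open>Only ratios of pairings with \<open>y j\<close> are known to converge, but that is
  enough for metric convergence: the pairing of the segment point with the expected limit
  \<open>g\<close> is an expression in such a ratio and in coth (l j), and tends to 1.\<close>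

lemma segment_limit:
  assumes t: "tends_to e G y v" and x: "x \<in> \<H> e" and s: "s \<ge> 0"
  shows "limitin (hyp.mtopology e) (\<lambda>j. segment e x (y j) s) (hray e x v s) G"
proof -
  define l where "l j = hyp_dist e x (y j)" for j
  define g where "g = hray e x v s"
  note vn = tends_toD(1)[OF t]
  have l: "filterlim l at_top G" using hyp_dist_at_top[OF t x] by (simp add: l_def[abs_def])
  have ls: "\<forall>\<^sub>F j in G. l j > s" using l by (simp add: filterlim_at_top_dense)
  have lc: "\<forall>\<^sub>F j in G. lorentz e (y j) x = cosh (l j)"
    using tends_toD(2)[OF t]
    by eventually_elim (simp add: l_def hyp_dist_cosh x lorentz_commute[of e _ x])
  have xg: "lorentz e x g = cosh s" using hray_lorentz(3)[OF x vn] by (simp add: g_def lorentz_commute[of e x])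
  have p: "lorentz e v x > 0" using null_hyp_pos(1)[OF vn x] .
  have vg: "lorentz e v g / lorentz e v x = exp (- s)"
    using hray_lorentz(2)[OF x vn, of s] p by (simp add: g_def lorentz_commute[of e v] )
  have in_H: "\<forall>\<^sub>F j in G. segment e x (y j) s \<in> \<H> e"
    using tends_toD(2)[OF t] ls
  proof eventually_elim
    case (elim j)
    then have "x \<noteq> y j" using s hyp.zero[OF x elim(1)] by (auto simp: l_def)
    from geodesic_onD(1)[OF segment_geodesic(1)[OF x elim(1) this], of s s] elim(2) s
    show ?case by (simp add: l_def)
  qed
  have co: "((\<lambda>j. cosh (l j) / sinh (l j)) \<longlongrightarrow> 1) G"
    by (rule filterlim_compose[OF coth_real_at_top l])
  have "((\<lambda>j. cosh s * cosh s - sinh s * (cosh (l j) / sinh (l j)) * cosh s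
      + sinh s * (cosh (l j) / sinh (l j)) * (lorentz e (y j) g / lorentz e (y j) x)) \<longlongrightarrow>
      cosh s * cosh s - sinh s * 1 * cosh s + sinh s * 1 * (lorentz e v g / lorentz e v x)) G"
    by (intro tendsto_intros co tends_to_ratio(2)[OF t x])
  also have "cosh s * cosh s - sinh s * 1 * cosh s + sinh s * 1 * (lorentz e v g / lorentz e v x) = 1"
    using cosh_square_eq[of s] by (simp add: vg exp_minus_cosh power2_eq_square algebra_simps)
  finally have "((\<lambda>j. lorentz e (segment e x (y j) s) g) \<longlongrightarrow> 1) G"
  proof (rule Lim_transform_eventually)
    show "\<forall>\<^sub>F j in G. cosh s * cosh s - sinh s * (cosh (l j) / sinh (l j)) * cosh s
      + sinh s * (cosh (l j) / sinh (l j)) * (lorentz e (y j) g / lorentz e (y j) x)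
      = lorentz e (segment e x (y j) s) g"
      using ls lc
    proof eventually_elim
      case (elim j)
      have h: "sinh (l j) > 0" "cosh (l j) > 0" using elim s by (auto intro: le_less_trans)
      have "lorentz e (segment e x (y j) s) g
        = sinh (l j - s) / sinh (l j) * cosh s + sinh s / sinh (l j) * lorentz e (y j) g"
        by (simp add: segment_def l_def[symmetric] lorentz_bilin xg)
      also have "sinh (l j - s) / sinh (l j) = cosh s - sinh s * (cosh (l j) / sinh (l j))"
        using h by (simp add: sinh_diff field_simps)
      also have "(cosh s - sinh s * (cosh (l j) / sinh (l j))) * cosh s + sinh s / sinh (l j) * lorentz e (y j) g
        = cosh s * cosh s - sinh s * (cosh (l j) / sinh (l j)) * cosh s
          + sinh s * (cosh (l j) / sinh (l j)) * (lorentz e (y j) g / cosh (l j))"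
        using h by (simp add: left_diff_distrib)
      finally show ?case by (simp add: elim(2))
    qed
  qed
  then show ?thesis
    using in_H hray_in[OF x vn] by (simp add: limitin_hyp_iff g_def)
qed

text \<open>The cone topology is given by a subbasis only. Being eventually inside a set survives
  finite intersections and unions, so testing subbasic sets is enough.\<close>

lemma limitin_generated:
  assumes l: "l \<in> \<Union>S" and S: "\<And>U. U \<in> S \<Longrightarrow> l \<in> U \<Longrightarrow> \<forall>\<^sub>F j in G. y j \<in> U"
  shows "limitin (topology_generated_by S) y l G"
  unfolding limitin_def
proof (intro conjI allI impI)
  show "l \<in> topspace (topology_generated_by S)" using l by simp
  fix U assume U: "openin (topology_generated_by S) U \<and> l \<in> U"
  then have "generate_topology_on S U" by (simp add: openin_topology_generated_by_iff)
  then have "l \<in> U \<longrightarrow> (\<forall>\<^sub>F j in G. y j \<in> U)"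
  proof (induction rule: generate_topology_on.induct)
    case (Int a b)
    then show ?case by (auto intro: eventually_conj)
  next
    case (UN K)
    show ?case
    proof
      assume "l \<in> \<Union>K"
      then obtain k where k: "k \<in> K" "l \<in> k" by blast
      then have "\<forall>\<^sub>F j in G. y j \<in> k" using UN by blast
      then show "\<forall>\<^sub>F j in G. y j \<in> \<Union>K" by (rule eventually_mono) (use k in blast)
    qed
  qed (use S in auto)
  then show "\<forall>\<^sub>F j in G. y j \<in> U" using U by simp
qed

lemma endpoint_in_cone_nbhd:
  assumes v: "v \<in> null_cone e" and x: "x \<in> \<H> e" and "\<epsilon> > 0" "r > 0"
  shows "Inr (endpoint e v) \<in> hyp.cone_nbhd e (hray e x v) r \<epsilon>"
proof -
  have H: "hray e x v r \<in> \<H> e" by (rule hray_in[OF x v])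
  have "hyp_dist e (hray e x v r) (hray e x v r) < \<epsilon>" using assms(3) H by simp
  then have "\<exists>\<gamma>\<in>endpoint e v. \<gamma> 0 = hray e x v 0 \<and> hyp_dist e (\<gamma> r) (hray e x v r) < \<epsilon>"
    using hray_endpoint[OF x v] by blast
  then show ?thesis unfolding hyp.cone_nbhd_def using endpoint_boundary[OF v] by blast
qed

lemma cone_limit_of_tends_to:
  assumes t: "tends_to e G y v"
  shows "limitin (hyp.cone_topology e) (\<lambda>j. Inl (y j)) (Inr (endpoint e v)) G"
  unfolding hyp.cone_topology_def
proof (rule limitin_generated)
  let ?S = "{Inl ` hyp.mball e x r |x r. x \<in> \<H> e \<and> 0 < r}"
  let ?S' = "{hyp.cone_nbhd e c r \<epsilon> |c r \<epsilon>. hyp.geodesic_on e {0..} c \<and> 0 < r \<and> 0 < \<epsilon>}"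
  note v = tends_toD(1)[OF t]
  have x0: "(1 / norm e) *\<^sub>R e \<in> \<H> e" by (rule base_point[OF null_coneD(3)[OF v]])
  let ?c = "hray e ((1 / norm e) *\<^sub>R e) v"
  have "Inr (endpoint e v) \<in> hyp.cone_nbhd e ?c 1 1"
    by (rule endpoint_in_cone_nbhd[OF v x0]) auto
  moreover have "hyp.geodesic_on e {0..} ?c" by (rule hray_geodesic[OF x0 v])
  ultimately show "Inr (endpoint e v) \<in> \<Union> (?S \<union> ?S')"
    using zero_less_one by blast
  fix U assume "U \<in> ?S \<union> ?S'"
    and U: "Inr (endpoint e v) \<in> U"
  then obtain c r \<epsilon> where c: "U = hyp.cone_nbhd e c r \<epsilon>" "hyp.geodesic_on e {0..} c" "0 < r" "0 < \<epsilon>"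
    by blast
  define x where "x = c 0"
  have x: "x \<in> \<H> e" using geodesic_onD(1)[OF c(2), of 0 0] by (simp add: x_def)
  have cr: "c r \<in> \<H> e" using geodesic_onD(1)[OF c(2), of r r] c(3) by simp
  \<comment> \<open>The central ray \<open>c\<close> of a subbasic neighbourhood need not end at
    \<open>v\<close>. The segments are therefore compared with the ray \<open>\<gamma>\<close> from
    the same base point that does, and the gap between its distance to \<open>c r\<close> and
    \<epsilon> is the room left for convergence.\<close>
  obtain \<gamma> where g: "\<gamma> \<in> endpoint e v" "\<gamma> 0 = x" "hyp_dist e (\<gamma> r) (c r) < \<epsilon>"
    using U by (auto simp: c(1) hyp.cone_nbhd_def x_def)
  have gr: "\<gamma> r = hray e x v r" using endpointD(3)[OF g(1), of r] c(3) by (simp add: g(2))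
  have grH: "hray e x v r \<in> \<H> e" by (rule hray_in[OF x v])
  have lim: "limitin (hyp.mtopology e) (\<lambda>j. segment e x (y j) r) (hray e x v r) G"
    using segment_limit[OF t x] c(3) by simp
  have d0: "\<epsilon> - hyp_dist e (\<gamma> r) (c r) > 0" using g(3) by simp
  have ev1: "\<forall>\<^sub>F j in G. segment e x (y j) r \<in> \<H> e \<and>
      hyp_dist e (segment e x (y j) r) (hray e x v r) < \<epsilon> - hyp_dist e (\<gamma> r) (c r)"
    using lim d0 unfolding hyp.limit_metric_sequentially hyp.limitin_metric by blast
  have ev2: "\<forall>\<^sub>F j in G. hyp_dist e x (y j) > r"
    using hyp_dist_at_top[OF t x] by (simp add: filterlim_at_top_dense)
  show "\<forall>\<^sub>F j in G. Inl (y j) \<in> U"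
    using ev1 ev2 tends_toD(2)[OF t]
  proof eventually_elim
    case (elim j)
    have ne: "x \<noteq> y j" using elim(2) c(3) hyp.zero[OF x elim(3)] by auto
    note sg = segment_geodesic[OF x elim(3) ne]
    have "hyp_dist e (segment e x (y j) r) (c r) \<le>
        hyp_dist e (segment e x (y j) r) (hray e x v r) + hyp_dist e (hray e x v r) (c r)"
      using elim grH cr by (intro hyp.triangle) auto
    also have "\<dots> < \<epsilon>" using elim(1) gr by simp
    finally have "hyp_dist e (segment e x (y j) r) (c r) < \<epsilon>" .
    then show ?case
      unfolding c(1) hyp.cone_nbhd_def using elim sg x_def by blast
  qed
qed

text \<open>Neighbourhoods of large radius send the distance from the base point to infinity. Those
  of radius 1 with shrinking \<epsilon> make the segment points at time 1 converge, and from these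
  the direction of \<open>y j\<close> can be recovered.\<close>

lemma cone_limit_tends_to:
  assumes lim: "limitin (hyp.cone_topology e) (\<lambda>j. Inl (y j)) (Inr (endpoint e v)) G"
    and v: "v \<in> null_cone e"
  shows "tends_to e G y v"
proof -
  define p where "p = (1 / norm e) *\<^sub>R e"
  have p: "p \<in> \<H> e" unfolding p_def by (rule base_point[OF null_coneD(3)[OF v]])
  define c where "c = hray e p v"
  define l where "l j = hyp_dist e p (y j)" for j
  have nb: "\<forall>\<^sub>F j in G. Inl (y j) \<in> hyp.cone_nbhd e c r \<epsilon>" if "r > 0" "\<epsilon> > 0" for r \<epsilon>
  proof -
    have "hyp.cone_nbhd e c r \<epsilon> \<in> {hyp.cone_nbhd e c r \<epsilon> |c r \<epsilon>. hyp.geodesic_on e {0..} c \<and> 0 < r \<and> 0 < \<epsilon>}"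
      using hray_geodesic[OF p v] that unfolding c_def by blast
    then have "openin (hyp.cone_topology e) (hyp.cone_nbhd e c r \<epsilon>)"
      unfolding hyp.cone_topology_def by (intro topology_generated_by_Basis) blast
    moreover have "Inr (endpoint e v) \<in> hyp.cone_nbhd e c r \<epsilon>"
      unfolding c_def by (rule endpoint_in_cone_nbhd[OF v p that(2,1)])
    ultimately show ?thesis using lim by (simp add: limitin_def)
  qed
  have nbD: "y j \<in> \<H> e \<and> l j > r \<and> segment e p (y j) r \<in> \<H> e \<and>
      hyp_dist e (segment e p (y j) r) (c r) < \<epsilon>"
    if "Inl (y j) \<in> hyp.cone_nbhd e c r \<epsilon>" "r > 0" for j r \<epsilon>
  proof -
    have c0: "c 0 = p" by (simp add: c_def)
    from that obtain \<gamma> where g: "y j \<in> \<H> e" "l j > r" "hyp.geodesic_on e {0..l j} \<gamma>"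
        "\<gamma> 0 = p" "\<gamma> (l j) = y j" "hyp_dist e (\<gamma> r) (c r) < \<epsilon>"
      by (auto simp: hyp.cone_nbhd_def c0 l_def)
    have "\<gamma> r = segment e p (y j) r"
      using geodesic_segment_unique(2)[OF g(3), of r] g that by simp
    moreover have "\<gamma> r \<in> \<H> e" using geodesic_onD(1)[OF g(3), of r r] g that by simp
    ultimately show ?thesis using g by simp
  qed
  have inH: "\<forall>\<^sub>F j in G. y j \<in> \<H> e" "\<forall>\<^sub>F j in G. l j > 1"
      "\<forall>\<^sub>F j in G. segment e p (y j) 1 \<in> \<H> e"
    using nb[of 1 1] nbD[of _ 1 1] by (auto elim!: eventually_mono)
  have lt: "filterlim l at_top G"
    unfolding filterlim_at_top_dense
  proof
    fix Z :: real
    have "\<forall>\<^sub>F j in G. Inl (y j) \<in> hyp.cone_nbhd e c (max Z 1) 1" by (rule nb) auto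
    then show "\<forall>\<^sub>F j in G. Z < l j" by (rule eventually_mono) (use nbD[of _ "max Z 1" 1] in force)
  qed
  have c1: "c 1 \<in> \<H> e" unfolding c_def by (rule hray_in[OF p v])
  have "limitin (hyp.mtopology e) (\<lambda>j. segment e p (y j) 1) (c 1) G"
    unfolding hyp.limitin_metric
  proof (intro conjI allI impI c1)
    fix \<epsilon> :: real assume "\<epsilon> > 0"
    then have "\<forall>\<^sub>F j in G. Inl (y j) \<in> hyp.cone_nbhd e c 1 \<epsilon>" by (intro nb) auto
    then show "\<forall>\<^sub>F j in G. segment e p (y j) 1 \<in> \<H> e \<and>
        hyp_dist e (segment e p (y j) 1) (c 1) < \<epsilon>"
      by (rule eventually_mono) (use nbD[of _ 1 \<epsilon>] in auto)
  qed
  then have seg: "((\<lambda>j. lorentz e (segment e p (y j) 1) z) \<longlongrightarrow> lorentz e (c 1) z) G" for z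
    by (rule hyp_limit_lorentz)
  have yp: "\<forall>\<^sub>F j in G. lorentz e (y j) p = cosh (l j)"
    using inH(1) by eventually_elim (simp add: l_def hyp_dist_cosh p lorentz_commute[of e _ p])
  show ?thesis
  proof (rule tends_toI[OF v inH(1) p])
    have "filterlim (\<lambda>j. cosh (l j)) at_top G"
      by (rule filterlim_compose[OF cosh_real_at_top lt])
    then show "filterlim (\<lambda>j. lorentz e (y j) p) at_top G"
      by (rule filterlim_mono_eventually) (use yp in \<open>auto elim!: eventually_mono\<close>)
    fix z
    have pos: "lorentz e p v > 0" by (rule null_hyp_pos(2)[OF v p])
    have s1: "sinh 1 > (0::real)" by simp
    have co: "((\<lambda>j. cosh (l j) / sinh (l j)) \<longlongrightarrow> 1) G"
      by (rule filterlim_compose[OF coth_real_at_top lt])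
    have ta: "((\<lambda>j. sinh (l j) / cosh (l j)) \<longlongrightarrow> 1) G"
      by (rule filterlim_compose[OF tanh_real_at_top' lt])
    \<comment> \<open>The segment formula at time 1, solved for the pairing of \<open>y j\<close>
      with \<open>z\<close> and divided by the pairing cosh (l j) of \<open>y j\<close> with
      \<open>p\<close>.\<close>
    have "((\<lambda>j. (sinh (l j) / cosh (l j)) * ((lorentz e (segment e p (y j) 1) z
        - (cosh 1 - sinh 1 * (cosh (l j) / sinh (l j))) * lorentz e p z) / sinh 1)) \<longlongrightarrow>
        1 * ((lorentz e (c 1) z - (cosh 1 - sinh 1 * 1) * lorentz e p z) / sinh 1)) G"
      by (intro tendsto_intros co ta seg) simp
    also have "1 * ((lorentz e (c 1) z - (cosh 1 - sinh 1 * 1) * lorentz e p z) / sinh 1)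
        = lorentz e v z / lorentz e p v"
      using s1 by (simp add: c_def hray_def lorentz_bilin exp_minus_cosh)
    finally have "((\<lambda>j. lorentz e (y j) z / lorentz e (y j) p) \<longlongrightarrow> lorentz e v z / lorentz e p v) G"
    proof (rule Lim_transform_eventually)
      show "\<forall>\<^sub>F j in G. (sinh (l j) / cosh (l j)) * ((lorentz e (segment e p (y j) 1) z
        - (cosh 1 - sinh 1 * (cosh (l j) / sinh (l j))) * lorentz e p z) / sinh 1)
          = lorentz e (y j) z / lorentz e (y j) p"
        using yp inH(2)
      proof eventually_elim
        case (elim j)
        have h: "sinh (l j) > 0" "cosh (l j) > 0" using elim by auto
        have "sinh (l j - 1) / sinh (l j) = cosh 1 - sinh 1 * (cosh (l j) / sinh (l j))"
          using h by (simp add: sinh_diff field_simps)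
        then have "lorentz e (segment e p (y j) 1) z =
            (cosh 1 - sinh 1 * (cosh (l j) / sinh (l j))) * lorentz e p z + sinh 1 / sinh (l j) * lorentz e (y j) z"
          by (simp add: segment_def l_def[symmetric] lorentz_bilin)
        then show ?case using h s1 by (simp add: elim(1))
      qed
    qed
    then show "((\<lambda>j. lorentz e (y j) z / lorentz e (y j) p) \<longlongrightarrow> lorentz e v z / lorentz e v p) G"
      by (simp add: lorentz_commute[of e v p])
  qed
qed

section \<open>Closed convex sets and their boundaries\<close>

lemma closed_convexD:
  assumes "hyp.closed_convex e S"
  shows "S \<subseteq> \<H> e" "hyp.geodesically_convex e S" "closedin (hyp.mtopology e) S"
  using assms by (auto simp: hyp.closed_convex_def hyp.geodesically_convex_def)

lemma closed_convex_limit: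
  assumes "hyp.closed_convex e S" "limitin (hyp.mtopology e) y x G" "\<forall>\<^sub>F j in G. y j \<in> S" "G \<noteq> bot"
  shows "x \<in> S"
  using limitin_closedin[OF assms(2) closed_convexD(3)[OF assms(1)] assms(3)] assms(4) by simp

text \<open>The segments from \<open>x\<close> to \<open>y j\<close> lie in \<open>S\<close> and
  converge pointwise to the ray.\<close>

lemma closed_convex_ray:
  assumes S: "hyp.closed_convex e S" and x: "x \<in> S" and y: "\<forall>\<^sub>F j in G. y j \<in> S"
    and t: "tends_to e G y v" and G: "G \<noteq> bot" and s: "s \<ge> 0"
  shows "hray e x v s \<in> S"
proof (rule closed_convex_limit[OF S segment_limit[OF t _ s] _ G])
  show xH: "x \<in> \<H> e" using x closed_convexD(1)[OF S] by auto
  have "\<forall>\<^sub>F j in G. hyp_dist e x (y j) > s"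
    using hyp_dist_at_top[OF t xH] by (simp add: filterlim_at_top_dense)
  then show "\<forall>\<^sub>F j in G. segment e x (y j) s \<in> S"
    using y tends_toD(2)[OF t]
  proof eventually_elim
    case (elim j)
    have "x \<noteq> y j" using elim s hyp.zero[OF xH elim(3)] by auto
    then show ?case using convex_segment[OF closed_convexD(2)[OF S] x elim(2)] elim s by simp
  qed
qed

lemma closed_convex_boundary_ray:
  assumes S: "hyp.closed_convex e S" and v: "v \<in> null_cone e"
    and b: "endpoint e v \<in> hyp.boundary_of e S" and x: "x \<in> S" and s: "s \<ge> 0"
  shows "hray e x v s \<in> S"
proof -
  obtain y where y: "y \<in> S" "\<forall>s\<ge>0. hray e y v s \<in> S"
    using b boundary_of_iff[OF v closed_convexD(1)[OF S]] by blast
  have "y \<in> \<H> e" using y closed_convexD(1)[OF S] by blast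
  from hray_limit[OF this v] show ?thesis
    by (rule closed_convex_ray[OF S x _ _ _ s, rotated])
      (use y in \<open>auto intro: eventually_at_top_linorderI[of 0]\<close>)
qed

text \<open>v + w is a point of the geodesic line joining the two ends. It is a limit in norm of
  normalised combinations of points on the two rays from a common \<open>x\<close>, and these
  combinations stay in \<open>S\<close>.\<close>

lemma boundary_midpoint:
  assumes S: "hyp.closed_convex e S" and v: "v \<in> null_cone e" and w: "w \<in> null_cone e"
    and bv: "endpoint e v \<in> hyp.boundary_of e S" and bw: "endpoint e w \<in> hyp.boundary_of e S"
    and vw: "lorentz e v w = 1 / 2"
  shows "v + w \<in> S"
proof -
  obtain x where x: "x \<in> S" using bv boundary_of_iff[OF v closed_convexD(1)[OF S]] by blast
  have xH: "x \<in> \<H> e" using x closed_convexD(1)[OF S] by blast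
  have p: "lorentz e x v > 0" "lorentz e x w > 0" using null_hyp_pos(2)[OF v xH] null_hyp_pos(2)[OF w xH] by auto
  have rays: "hray e x v s \<in> S" "hray e x w s \<in> S" if "s \<ge> 0" for s
    using closed_convex_boundary_ray[OF S _ _ x that] v w bv bw by auto
  \<comment> \<open>Since sinh s grows like exp s / 2, this rescaling makes the ray point tend to
    \<open>v\<close> itself, in norm.\<close>
  define q where "q v s = (2 * exp (- s) * lorentz e x v) *\<^sub>R hray e x v s" for v s
  have q: "(q v \<longlongrightarrow> v) at_top" if pv: "lorentz e x v > 0" for v
  proof -
    have e0: "((\<lambda>s::real. exp (- s)) \<longlongrightarrow> 0) at_top"
      by (rule filterlim_compose[OF exp_at_bot filterlim_uminus_at_bot_at_top])
    have "((\<lambda>s. (2 * (exp (- s) * exp (- s)) * lorentz e x v) *\<^sub>R x + (1 - exp (- s) * exp (- s)) *\<^sub>R v) \<longlongrightarrow>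
      (2 * (0 * 0) * lorentz e x v) *\<^sub>R x + (1 - 0 * 0) *\<^sub>R v) at_top"
      by (intro tendsto_intros e0)
    moreover have "(2 * (exp (- s) * exp (- s)) * lorentz e x v) *\<^sub>R x + (1 - exp (- s) * exp (- s)) *\<^sub>R v = q v s" for s
    proof -
      have "2 * exp (- s) * sinh s = 1 - exp (- s) * exp (- s)"
        by (simp add: sinh_field_def exp_minus field_simps)
      then show ?thesis using pv
        by (simp add: q_def hray_def scaleR_add_right mult.assoc[symmetric])
    qed
    ultimately show ?thesis by simp
  qed
  define m where "m s = q v s + q w s" for s
  have m: "(m \<longlongrightarrow> v + w) at_top"
    unfolding m_def by (intro tendsto_intros q p)
  have N: "lorentz e (v + w) (v + w) = 1"
    using null_coneD(1)[OF v] null_coneD(1)[OF w]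
    by (simp add: lorentz_bilin vw lorentz_commute[of e w v])
  have lm: "((\<lambda>s. lorentz e (m s) (m s)) \<longlongrightarrow> 1) at_top"
    using tendsto_lorentz[OF m m, of e] by (simp add: N)
  have pos: "\<forall>\<^sub>F s in at_top. lorentz e (m s) (m s) > 0"
    using order_tendstoD(1)[OF lm, of 0] by simp
  define n where "n s = (1 / sqrt (lorentz e (m s) (m s))) *\<^sub>R m s" for s
  have n: "(n \<longlongrightarrow> v + w) at_top"
  proof -
    have "(n \<longlongrightarrow> (1 / sqrt 1) *\<^sub>R (v + w)) at_top"
      unfolding n_def by (intro tendsto_intros lm m) auto
    then show ?thesis by simp
  qed
  have nS: "\<forall>\<^sub>F s in at_top. n s \<in> S"
    using pos eventually_ge_at_top[of 0]
  proof eventually_elim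
    case (elim s)
    define k where "k = 1 / sqrt (lorentz e (m s) (m s))"
    have k: "k > 0" "k * k * lorentz e (m s) (m s) = 1" using elim by (auto simp: k_def)
    have "lorentz e (n s) (n s) = 1" using k by (simp add: n_def k_def[symmetric] lorentz_bilin algebra_simps)
    moreover have "n s = (k * (2 * exp (- s) * lorentz e x v)) *\<^sub>R hray e x v s
        + (k * (2 * exp (- s) * lorentz e x w)) *\<^sub>R hray e x w s"
      by (simp add: n_def m_def q_def k_def scaleR_add_right)
    ultimately show "n s \<in> S"
      using convex_combination[OF closed_convexD(2)[OF S] rays[OF elim(2)],
          of "k * (2 * exp (- s) * lorentz e x v)" "k * (2 * exp (- s) * lorentz e x w)"] k p by simp
  qed
  have vwH: "v + w \<in> \<H> e"
    using null_hyp_pos(1)[OF v xH] null_hyp_pos(1)[OF w xH]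
    by (intro hyperbolic_spaceI[OF xH N]) (simp add: lorentz_add)
  have "limitin (hyp.mtopology e) n (v + w) at_top"
    unfolding limitin_hyp_iff
  proof (intro conjI vwH)
    show "\<forall>\<^sub>F s in at_top. n s \<in> \<H> e"
      using nS closed_convexD(1)[OF S] by (auto elim: eventually_mono)
    show "((\<lambda>j. lorentz e (n j) (v + w)) \<longlongrightarrow> 1) at_top"
      using tendsto_lorentz[OF n tendsto_const, of e "v + w"] by (simp add: N)
  qed
  then show ?thesis by (rule closed_convex_limit[OF S _ nS]) simp
qed

lemma halfspace_closed_convex:
  assumes "e \<noteq> 0"
  shows "hyp.closed_convex e {x \<in> \<H> e. lorentz e x a \<ge> 0}" (is "hyp.closed_convex e ?K")
  unfolding hyp.closed_convex_def hyp.metric_closedin_iff_sequentially_closed hyp.geodesically_convex_def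
proof (intro conjI allI impI)
  fix y l assume yl: "range y \<subseteq> ?K \<and> limitin (hyp.mtopology e) y l sequentially"
  have "(\<lambda>j. lorentz e (y j) a) \<longlonglongrightarrow> lorentz e l a"
    using yl by (intro hyp_limit_lorentz) auto
  then have "lorentz e l a \<ge> 0"
    by (rule tendsto_lowerbound) (use yl in \<open>auto simp: image_subset_iff\<close>)
  then show "l \<in> ?K" using yl by (auto simp: limitin_hyp_iff)
next
  fix l c assume l: "0 \<le> l" and c: "hyp.geodesic_on e {0..l} c \<and> c 0 \<in> ?K \<and> c l \<in> ?K"
  show "c ` {0..l} \<subseteq> ?K"
  proof (intro image_subsetI)
    fix s assume s: "s \<in> {0..l}"
    show "c s \<in> ?K"
    proof (cases "l = 0")
      case True
      then show ?thesis using s c by simp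
    next
      case False
      then have l: "l > 0" using l by simp
      have g: "hyp.geodesic_on e {0..l} c" using c by simp
      have s': "0 \<le> s" "s \<le> l" using s by auto
      note cs = geodesic_segment_unique[OF g s' l]
      have "lorentz e (c s) a = sinh (l - s) / sinh l * lorentz e (c 0) a + sinh s / sinh l * lorentz e (c l) a"
        unfolding cs(2) by (simp add: segment_def lorentz_bilin cs(1))
      moreover have "\<dots> \<ge> 0" using c s l by (intro add_nonneg_nonneg mult_nonneg_nonneg) auto
      ultimately show ?thesis using geodesic_onD(1)[OF g s s] by simp
    qed
  qed
qed auto

lemma closed_convex_Inter:
  assumes "\<K> \<noteq> {}" "\<And>K. K \<in> \<K> \<Longrightarrow> hyp.closed_convex e K"
  shows "hyp.closed_convex e (\<Inter>\<K>)"
  unfolding hyp.closed_convex_def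
proof
  show "closedin (hyp.mtopology e) (\<Inter>\<K>)"
    using assms by (intro closedin_Inter) (auto simp: hyp.closed_convex_def)
  obtain K where "K \<in> \<K>" using assms by blast
  then have sub: "\<Inter>\<K> \<subseteq> \<H> e" using closed_convexD(1) assms(2) by blast
  show "hyp.geodesically_convex e (\<Inter>\<K>)"
    unfolding hyp.geodesically_convex_def
  proof (intro conjI allI impI sub)
    fix l c assume "0 \<le> l" "hyp.geodesic_on e {0..l} c \<and> c 0 \<in> \<Inter>\<K> \<and> c l \<in> \<Inter>\<K>"
    then have "c ` {0..l} \<subseteq> K" if "K \<in> \<K>" for K
      using closed_convexD(2)[OF assms(2)[OF that]] that unfolding hyp.geodesically_convex_def by blast
    then show "c ` {0..l} \<subseteq> \<Inter>\<K>" by blast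
  qed
qed

lemma closed_convex_whole: "hyp.closed_convex e (\<H> e)"
  unfolding hyp.closed_convex_def hyp.geodesically_convex_def
  using closedin_topspace[of "hyp.mtopology e"] by (auto simp: hyp.geodesic_on_def)

section \<open>Isometries\<close>

lemma lorentz_nondegenerate:
  assumes "e \<noteq> 0" "\<And>y. lorentz e x y = 0"
  shows "x = 0"
proof -
  have "x \<bullet> e = 0" using assms(2)[of e] by (simp add: lorentz_base)
  then have "lorentz e x x = - (x \<bullet> x)" by (simp add: lorentz_alt)
  then show ?thesis using assms(2)[of x] by simp
qed

text \<open>Two points always suffice, so identities between linear or bilinear expressions can be
  transferred from the hyperboloid to the whole space without a basis.\<close>

lemma hyperbolic_space_spans:
  assumes e: "e \<noteq> 0"
  obtains a b \<alpha> \<beta> where "a \<in> \<H> e" "b \<in> \<H> e" "y = \<alpha> *\<^sub>R a + \<beta> *\<^sub>R b"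
proof -
  define E where "E = (1 / norm e) *\<^sub>R e"
  have E: "E \<in> \<H> e" using base_point[OF e] by (simp add: E_def)
  \<comment> \<open>Large enough that c (c + 2 B y E) exceeds \<bar>B y y\<bar> and that y + c E
    pairs positively with E, so y + c E can be scaled into the hyperboloid.\<close>
  define c where "c = 1 + \<bar>lorentz e y y\<bar> + 2 * \<bar>lorentz e y E\<bar>"
  define u where "u = y + c *\<^sub>R E"
  have EE: "lorentz e E E = 1" using hyp_unit[OF E] .
  have c1: "c \<ge> 1" by (simp add: c_def)
  have "lorentz e u u = lorentz e y y + c * (c + 2 * lorentz e y E)"
    by (simp add: u_def lorentz_bilin EE lorentz_commute[of e E y] algebra_simps)
  moreover have "c * (c + 2 * lorentz e y E) \<ge> 1 * (1 + \<bar>lorentz e y y\<bar>)"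
    using c1 by (intro mult_mono) (auto simp: c_def)
  moreover have "a + m > 0" if "m \<ge> 1 * (1 + \<bar>a\<bar>)" for a m :: real using that by (cases "a \<ge> 0") auto
  ultimately have uu: "lorentz e u u > 0" by presburger
  have uE: "lorentz e u E > 0" using c1 by (simp add: u_def lorentz_bilin EE c_def)
  define k where "k = sqrt (lorentz e u u)"
  have k: "k > 0" "k * k = lorentz e u u" using uu by (auto simp: k_def)
  have "(1 / k) *\<^sub>R u \<in> \<H> e"
    using k uE uu by (intro hyperbolic_spaceI[OF E]) (simp_all add: lorentz_bilin)
  moreover have "y = k *\<^sub>R ((1 / k) *\<^sub>R u) + (- c) *\<^sub>R E" using k by (simp add: u_def)
  ultimately show thesis using that E by blast
qed

text \<open>The equality of images, rather than an inclusion, makes \<open>A\<close> surjective on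
  the ambient space also in infinite dimension; see \<open>isom_surj\<close>.\<close>

definition lorentz_isom :: "'v::real_inner \<Rightarrow> ('v \<Rightarrow> 'v) \<Rightarrow> bool" where
  "lorentz_isom e A \<longleftrightarrow> linear A \<and> (\<forall>x y. lorentz e (A x) (A y) = lorentz e x y) \<and>
     A ` \<H> e = \<H> e"

lemma lorentz_isomD:
  assumes "lorentz_isom e A"
  shows "linear A" "lorentz e (A x) (A y) = lorentz e x y"
    "x \<in> \<H> e \<Longrightarrow> A x \<in> \<H> e"
  using assms by (auto simp: lorentz_isom_def)

lemma lorentz_isom_null:
  assumes A: "lorentz_isom e A" and v: "v \<in> null_cone e"
  shows "A v \<in> null_cone e"
proof -
  have x: "(1 / norm e) *\<^sub>R e \<in> \<H> e" (is "?x \<in> _")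
    by (rule base_point[OF null_coneD(3)[OF v]])
  show ?thesis
    by (rule null_coneI[OF lorentz_isomD(3)[OF A x]])
      (use null_hyp_pos(1)[OF v x] null_coneD(1)[OF v] in \<open>simp_all add: lorentz_isomD(2)[OF A]\<close>)
qed

lemma lorentz_isom_compose:
  assumes "lorentz_isom e A" "lorentz_isom e A'"
  shows "lorentz_isom e (A \<circ> A')"
  using assms image_comp[of A A' "\<H> e"]
  unfolding lorentz_isom_def by (simp add: linear_compose)

lemma isom_group_carrier_iff:
  "g \<in> carrier (isom_group M d) \<longleftrightarrow> g \<in> Bij M \<and> (\<forall>x\<in>M. \<forall>y\<in>M. d (g x) (g y) = d x y)"
  by (simp add: isom_group_def)

lemma isom_hyp_lorentz:
  assumes g: "g \<in> carrier (Isom_hyp e)" and x: "x \<in> \<H> e"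
  shows "g x \<in> \<H> e"
    and "y \<in> \<H> e \<Longrightarrow> lorentz e (g x) (g y) = lorentz e x y"
proof -
  have im: "g z \<in> \<H> e" if "z \<in> \<H> e" for z
    using g that by (auto simp: isom_group_carrier_iff Bij_def bij_betw_def)
  show "g x \<in> \<H> e" by (rule im[OF x])
  assume y: "y \<in> \<H> e"
  have "hyp_dist e (g x) (g y) = hyp_dist e x y"
    using g x y by (simp add: isom_group_carrier_iff)
  then show "lorentz e (g x) (g y) = lorentz e x y"
    using hyp_dist_cosh[OF x y] hyp_dist_cosh[OF im[OF x] im[OF y]] by simp
qed

lemma isom_hyp_image:
  assumes "g \<in> carrier (isom_group M d)"
  shows "g ` M = M"
  using assms by (auto simp: isom_group_carrier_iff Bij_def bij_betw_def)

lemma isom_carrier: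
  assumes A: "lorentz_isom e A"
  shows "restrict A (\<H> e) \<in> carrier (Isom_hyp e)"
proof -
  note D = lorentz_isomD[OF A]
  have "inj_on A (\<H> e)"
  proof (rule inj_onI)
    fix x y assume xy: "x \<in> \<H> e" "y \<in> \<H> e" "A x = A y"
    then have "lorentz e x y = lorentz e (A y) (A y)" using D(2)[of x y] by simp
    then have "lorentz e x y = 1" using hyp_unit[OF D(3)[OF xy(2)]] by simp
    then show "x = y" using lorentz_ge_1(2) xy by blast
  qed
  then have "bij_betw A (\<H> e) (\<H> e)"
    using A by (simp add: bij_betw_def lorentz_isom_def)
  then show ?thesis
    using D by (auto simp: isom_group_carrier_iff Bij_def hyp_dist_def bij_betw_def inj_on_def)
qed

lemma isom_hyp_ray:
  assumes g: "g \<in> carrier (Isom_hyp e)" and c: "hyp.geodesic_on e I c"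
  shows "hyp.geodesic_on e I (\<lambda>s. g (c s))"
  using isom_hyp_lorentz[OF g] geodesic_onD[OF c] by (intro geodesic_onI) auto

section \<open>Reflections, boosts and translation lengths\<close>

definition reflection :: "'v::real_inner \<Rightarrow> 'v \<Rightarrow> 'v \<Rightarrow> 'v" where
  "reflection e z x = x - (2 * lorentz e x z / lorentz e z z) *\<^sub>R z"

lemma reflection_isometry:
  assumes z: "lorentz e z z < 0"
  shows "lorentz_isom e (reflection e z)"
proof -
  have lin: "linear (reflection e z)"
    by (rule linearI)
      (simp_all add: reflection_def lorentz_add lorentz_linear distrib_left add_divide_distrib
        scaleR_add_left scaleR_diff_right)
  have B: "lorentz e (reflection e z x) (reflection e z y) = lorentz e x y" for x y
    using z by (simp add: reflection_def lorentz_bilin lorentz_commute[of e z y] field_simps)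
  have inv: "reflection e z (reflection e z x) = x" for x
  proof -
    have "lorentz e (reflection e z x) z = - lorentz e x z"
      using z by (simp add: reflection_def lorentz_bilin)
    then show ?thesis by (subst reflection_def) (simp add: reflection_def)
  qed
  have "reflection e z x \<in> \<H> e" if x: "x \<in> \<H> e" for x
  proof (rule hyperbolic_spaceI[OF x])
    show "lorentz e (reflection e z x) (reflection e z x) = 1" using B hyp_unit[OF x] by simp
    have "lorentz e (reflection e z x) x = 1 - 2 * (lorentz e x z)\<^sup>2 / lorentz e z z"
      using hyp_unit[OF x]
      by (simp add: reflection_def lorentz_bilin lorentz_commute[of e z x] power2_eq_square)
    moreover have "(lorentz e x z)\<^sup>2 / lorentz e z z \<le> 0" using z by (simp add: divide_nonneg_neg)
    ultimately show "lorentz e (reflection e z x) x > 0" by linarith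
  qed
  then have "reflection e z ` \<H> e = \<H> e"
    using inv by (metis image_subset_iff image_eqI subsetI subset_antisym)
  then show ?thesis using lin B by (simp add: lorentz_isom_def)
qed

lemma reflection_fix: "lorentz e x z = 0 \<Longrightarrow> reflection e z x = x"
  by (simp add: reflection_def)

text \<open>Equal norms give B (a - b) (a - b) = 2 B a (a - b) = - 2 B b (a - b). All transitivity
  statements below come from such reflections.\<close>

lemma reflection_swap:
  assumes "lorentz e a a = lorentz e b b" "lorentz e (a - b) (a - b) \<noteq> 0"
  shows "reflection e (a - b) a = b" "reflection e (a - b) b = a"
proof -
  define q where "q = lorentz e (a - b) (a - b)"
  have q: "q = 2 * lorentz e a (a - b)" "q = - 2 * lorentz e b (a - b)"
    using assms(1) by (simp_all add: q_def lorentz_bilin lorentz_commute[of e b a])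
  have "2 * lorentz e a (a - b) / q = 1" "2 * lorentz e b (a - b) / q = - 1"
    using assms(2) q by (auto simp: q_def[symmetric] field_simps)
  then show "reflection e (a - b) a = b" "reflection e (a - b) b = a"
    by (simp_all add: reflection_def q_def)
qed

text \<open>The last property keeps a third point fixed when it is equidistant from the two that are
  swapped; this makes pairs of points at equal distance congruent.\<close>

lemma transitive_on_points:
  assumes x: "x \<in> \<H> e" and y: "y \<in> \<H> e"
  obtains A where "lorentz_isom e A" "A x = y" "A y = x"
    "\<And>z. lorentz e z x = lorentz e z y \<Longrightarrow> A z = z"
proof (cases "x = y")
  case True
  have "lorentz_isom e id" by (simp add: lorentz_isom_def linear_id[unfolded id_def] id_def)
  then show thesis using that True by auto
next
  case False
  have "lorentz e x y > 1" using lorentz_ge_1[OF x y] False by fastforce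
  then have n: "lorentz e (x - y) (x - y) < 0"
    using hyp_unit[OF x] hyp_unit[OF y]
    by (simp add: lorentz_bilin lorentz_commute[of e y x])
  have "reflection e (x - y) x = y" "reflection e (x - y) y = x"
    using reflection_swap[of e x y] n hyp_unit[OF x] hyp_unit[OF y] by auto
  then show thesis
    using that[OF reflection_isometry[OF n]] by (simp add: reflection_fix lorentz_bilin)
qed

text \<open>The last property serves twice: it keeps \<open>x0\<close> fixed when both null vectors
  are normalised against it, and it keeps a third boundary point fixed after rescaling.\<close>

lemma swap_null:
  assumes v: "v \<in> null_cone e" and w: "w \<in> null_cone e" and vw: "lorentz e v w > 0"
  obtains A where "lorentz_isom e A" "A v = w" "A w = v"
    "\<And>z. lorentz e z v = lorentz e z w \<Longrightarrow> A z = z"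
proof -
  have n: "lorentz e (v - w) (v - w) < 0"
    using vw null_coneD(1)[OF v] null_coneD(1)[OF w]
    by (simp add: lorentz_bilin lorentz_commute[of e w v])
  have "reflection e (v - w) v = w" "reflection e (v - w) w = v"
    using reflection_swap[of e v w] n null_coneD(1)[OF v] null_coneD(1)[OF w] by auto
  then show thesis
    using that[OF reflection_isometry[OF n]] by (simp add: reflection_fix lorentz_bilin)
qed

text \<open>A product of two reflections: the first swaps \<open>v\<close> and \<open>w\<close>, the
  second swaps \<mu> v and \<open>w\<close>.\<close>

lemma boost_exists:
  assumes v: "v \<in> null_cone e" and w: "w \<in> null_cone e" and vw: "lorentz e v w > 0" and \<mu>: "\<mu> > 0"
  obtains A where "lorentz_isom e A" "A v = \<mu> *\<^sub>R v" "A w = (1 / \<mu>) *\<^sub>R w"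
proof -
  obtain A where A: "lorentz_isom e A" "A v = w" "A w = v"
    by (rule swap_null[OF v w vw]) blast
  have "lorentz e (\<mu> *\<^sub>R v) w > 0" using vw \<mu> by (simp add: lorentz_linear)
  then obtain A' where A': "lorentz_isom e A'" "A' (\<mu> *\<^sub>R v) = w" "A' w = \<mu> *\<^sub>R v"
    using swap_null[OF null_cone_scale[OF v \<mu>] w] by metis
  have "A' v = (1 / \<mu>) *\<^sub>R w"
    using A'(2) \<mu> linear_scale[OF lorentz_isomD(1)[OF A'(1)], of \<mu> v] by auto
  then show thesis
    using that[OF lorentz_isom_compose[OF A'(1) A(1)]] A A' by simp
qed

lemma null_sum_hyp:
  assumes v: "v \<in> null_cone e" and w: "w \<in> null_cone e" and vw: "lorentz e v w > 0"
  shows "(1 / sqrt (2 * lorentz e v w)) *\<^sub>R (v + w) \<in> \<H> e"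
proof -
  have x: "(1 / norm e) *\<^sub>R e \<in> \<H> e" (is "?x \<in> _")
    by (rule base_point[OF null_coneD(3)[OF v]])
  show ?thesis
  proof (rule hyperbolic_spaceI[OF x])
    show "lorentz e ((1 / sqrt (2 * lorentz e v w)) *\<^sub>R (v + w)) ((1 / sqrt (2 * lorentz e v w)) *\<^sub>R (v + w)) = 1"
      using vw null_coneD(1)[OF v] null_coneD(1)[OF w]
      by (simp add: lorentz_bilin lorentz_commute[of e w v])
    have "lorentz e v ?x + lorentz e w ?x > 0" using null_hyp_pos(1)[OF v x] null_hyp_pos(1)[OF w x] by simp
    then show "lorentz e ((1 / sqrt (2 * lorentz e v w)) *\<^sub>R (v + w)) ?x > 0"
      using vw unfolding lorentz_linear(3) lorentz_add(1) by (intro mult_pos_pos) auto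
  qed
qed

text \<open>Split \<open>x\<close> into its part in the plane of \<open>v\<close> and
  \<open>w\<close> and a part \<open>z\<close> orthogonal to it. The plane contributes exactly N
  (\<mu> + 1 / \<mu>). Whatever \<open>A\<close> does on the complement, Cauchy-Schwarz bounds the
  contribution of \<open>z\<close> by - B z z = 2 N - 1.\<close>

lemma boost_displacement:
  assumes A: "lorentz_isom e A" and v: "v \<in> null_cone e" and w: "w \<in> null_cone e"
    and vw: "lorentz e v w > 0" and \<mu>: "\<mu> > 0" and Av: "A v = \<mu> *\<^sub>R v" and Aw: "A w = (1 / \<mu>) *\<^sub>R w"
    and x: "x \<in> \<H> e"
  defines "N \<equiv> lorentz e x v * lorentz e x w / lorentz e v w"
  shows "\<bar>lorentz e (A x) x - N * (\<mu> + 1 / \<mu>)\<bar> \<le> 2 * N - 1"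
proof -
  note D = lorentz_isomD[OF A]
  define k where "k = lorentz e v w"
  have k: "k > 0" "lorentz e w v = k" using vw by (auto simp: k_def lorentz_commute)
  define \<alpha> where "\<alpha> = lorentz e x w / k"
  define \<beta> where "\<beta> = lorentz e x v / k"
  have xv: "lorentz e x v = \<beta> * k" and xw: "lorentz e x w = \<alpha> * k" using k by (auto simp: \<alpha>_def \<beta>_def)
  have N: "N = \<alpha> * \<beta> * k" using k by (simp add: N_def xv xw k_def[symmetric])
  define z where "z = x - \<alpha> *\<^sub>R v - \<beta> *\<^sub>R w"
  have nn: "lorentz e v v = 0" "lorentz e w w = 0" using null_coneD(1) v w by auto
  have zv: "lorentz e z v = 0" and zw: "lorentz e z w = 0"
    by (simp_all add: z_def lorentz_bilin nn xv xw k k_def[symmetric])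
  have xz: "x = \<alpha> *\<^sub>R v + \<beta> *\<^sub>R w + z" by (simp add: z_def)
  have "1 = lorentz e x x" using hyp_unit[OF x] by simp
  also have "\<dots> = 2 * N + lorentz e z z"
    by (simp add: xz lorentz_bilin nn zv zw k k_def[symmetric]
        lorentz_commute[of e v z] lorentz_commute[of e w z] N)
  finally have zz: "lorentz e z z = 1 - 2 * N" by simp
  have "\<mu> * lorentz e (A z) v = lorentz e (A z) (A v)" by (simp add: Av lorentz_linear)
  then have Azv: "lorentz e (A z) v = 0" using \<mu> by (simp add: D(2) zv)
  have "(1 / \<mu>) * lorentz e (A z) w = lorentz e (A z) (A w)" by (simp add: Aw lorentz_linear)
  then have Azw: "lorentz e (A z) w = 0" using \<mu> by (simp add: D(2) zw)
  have Ax: "A x = (\<alpha> * \<mu>) *\<^sub>R v + (\<beta> / \<mu>) *\<^sub>R w + A z"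
    by (simp add: xz linear_add[OF D(1)] linear_scale[OF D(1)] Av Aw)
  have "lorentz e (A x) x = N * (\<mu> + 1 / \<mu>) + lorentz e (A z) z"
    unfolding Ax by (subst xz) (simp add: lorentz_bilin nn zv zw Azv Azw k k_def[symmetric]
        lorentz_commute[of e v z] lorentz_commute[of e w z] N algebra_simps)
  moreover have "\<bar>lorentz e (A z) z\<bar> \<le> 2 * N - 1"
  proof -
    note h = null_sum_hyp[OF v w vw]
    have "lorentz e (A z) ((1 / sqrt (2 * lorentz e v w)) *\<^sub>R (v + w)) = 0"
      "lorentz e z ((1 / sqrt (2 * lorentz e v w)) *\<^sub>R (v + w)) = 0"
      by (simp_all add: lorentz_bilin zv zw Azv Azw)
    note * = lorentz_Cauchy_Schwarz[OF h this] lorentz_neg_def(1)[OF h this(2)]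
    then have "(lorentz e (A z) z)\<^sup>2 \<le> (lorentz e z z)\<^sup>2" by (simp add: D(2) power2_eq_square)
    then have "\<bar>lorentz e (A z) z\<bar> \<le> \<bar>lorentz e z z\<bar>" by (simp add: abs_le_square_iff)
    then show ?thesis using *(2) zz by simp
  qed
  ultimately show ?thesis by simp
qed

text \<open>By the preceding estimate the displacement is at least N (\<mu> + 1 / \<mu> - 2) + 1,
  which is smallest for N = 1 / 2. This value of N occurs at the point \<open>h\<close> of the axis,
  where the estimate is exact.\<close>

lemma boost_translation_length:
  assumes A: "lorentz_isom e A" and v: "v \<in> null_cone e" and w: "w \<in> null_cone e"
    and vw: "lorentz e v w > 0" and \<mu>: "\<mu> > 0" and Av: "A v = \<mu> *\<^sub>R v" and Aw: "A w = (1 / \<mu>) *\<^sub>R w"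
    and g: "\<And>x. x \<in> \<H> e \<Longrightarrow> g x = A x"
  shows "translation_length (\<H> e) (hyp_dist e) g = \<bar>ln \<mu>\<bar>"
  unfolding translation_length_def
proof (rule cInf_eq_minimum)
  have ch: "cosh \<bar>ln \<mu>\<bar> = (\<mu> + 1 / \<mu>) / 2"
    using \<mu> by (simp add: abs_if cosh_field_def exp_minus inverse_eq_divide)
  have two: "\<mu> + 1 / \<mu> \<ge> 2"
  proof -
    have "0 \<le> (\<mu> - 1)\<^sup>2 / \<mu>" using \<mu> by simp
    also have "\<dots> = \<mu> + 1 / \<mu> - 2" using \<mu> by (simp add: power2_eq_square field_simps)
    finally show ?thesis by simp
  qed
  note D = lorentz_isomD[OF A]
  define h where "h = (1 / sqrt (2 * lorentz e v w)) *\<^sub>R (v + w)"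
  have h: "h \<in> \<H> e" using null_sum_hyp[OF v w vw] by (simp add: h_def)
  have nn: "lorentz e v v = 0" "lorentz e w w = 0" using null_coneD(1) v w by auto
  have "lorentz e h v * lorentz e h w / lorentz e v w = 1 / 2"
    using vw by (simp add: h_def lorentz_bilin nn lorentz_commute[of e w v])
  from boost_displacement[OF A v w vw \<mu> Av Aw h] this
  have "lorentz e (A h) h = cosh \<bar>ln \<mu>\<bar>" unfolding ch by simp
  then have "hyp_dist e (g h) h = \<bar>ln \<mu>\<bar>"
    using h D(3)[OF h] by (subst hyp_dist_eq_iff) (simp_all add: g)
  then show "\<bar>ln \<mu>\<bar> \<in> (\<lambda>x. hyp_dist e (g x) x) ` \<H> e" using h by force
  fix d assume "d \<in> (\<lambda>x. hyp_dist e (g x) x) ` \<H> e"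
  then obtain x where x: "x \<in> \<H> e" "d = hyp_dist e (A x) x" using g by auto
  define N where "N = lorentz e x v * lorentz e x w / lorentz e v w"
  have b: "\<bar>lorentz e (A x) x - N * (\<mu> + 1 / \<mu>)\<bar> \<le> 2 * N - 1"
    using boost_displacement[OF A v w vw \<mu> Av Aw x(1)] by (simp add: N_def)
  then have N: "N \<ge> 1 / 2" by linarith
  have "(1 / 2) * (\<mu> + 1 / \<mu> - 2) \<le> N * (\<mu> + 1 / \<mu> - 2)"
    using N two by (intro mult_right_mono) auto
  then have "cosh \<bar>ln \<mu>\<bar> \<le> lorentz e (A x) x"
    using conjunct2[OF b[unfolded abs_le_iff]] unfolding ch right_diff_distrib minus_diff_eq
    by (simp add: distrib_left)
  then have "cosh \<bar>ln \<mu>\<bar> \<le> cosh d"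
    using hyp_dist_cosh[OF D(3)[OF x(1)] x(1)] by (simp add: x(2))
  then show "\<bar>ln \<mu>\<bar> \<le> d"
    using hyp.nonneg[of e "A x" x] by (subst (asm) cosh_real_nonneg_le_iff) (auto simp: x(2))
qed

lemma linear_eq_on_hyp:
  assumes "e \<noteq> 0" "linear P" "linear Q" "\<And>x. x \<in> \<H> e \<Longrightarrow> P x = Q x"
  shows "P y = Q y"
proof -
  obtain a b \<alpha> \<beta> where "a \<in> \<H> e" "b \<in> \<H> e" "y = \<alpha> *\<^sub>R a + \<beta> *\<^sub>R b"
    using hyperbolic_space_spans[OF assms(1)] by blast
  then show ?thesis using assms by (simp add: linear_add linear_scale)
qed

lemma linear_extension_isometry:
  assumes e: "e \<noteq> 0" and P: "linear P" and g: "g \<in> carrier (Isom_hyp e)"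
    and Pg: "\<And>x. x \<in> \<H> e \<Longrightarrow> P x = g x"
  shows "lorentz_isom e P"
proof -
  have "lorentz e (P x) (P y) = lorentz e x y" for x y
  proof -
    obtain a b \<alpha> \<beta> where 1: "a \<in> \<H> e" "b \<in> \<H> e" "x = \<alpha> *\<^sub>R a + \<beta> *\<^sub>R b"
      using hyperbolic_space_spans[OF e] by blast
    obtain a' b' \<alpha>' \<beta>' where 2: "a' \<in> \<H> e" "b' \<in> \<H> e"
        "y = \<alpha>' *\<^sub>R a' + \<beta>' *\<^sub>R b'"
      using hyperbolic_space_spans[OF e] by blast
    show ?thesis
      using 1(1,2) 2(1,2)
      by (simp add: 1(3) 2(3) linear_add[OF P] linear_scale[OF P] Pg lorentz_bilin isom_hyp_lorentz(2)[OF g])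
  qed
  moreover have "P ` \<H> e = \<H> e"
    using isom_hyp_image[OF g] Pg by (metis image_cong)
  ultimately show ?thesis using P by (simp add: lorentz_isom_def)
qed

section \<open>Nearest points in closed convex sets\<close>

lemma closed_convex_midpoint:
  assumes S: "hyp.closed_convex e S" and x: "x \<in> S" and y: "y \<in> S"
  shows "(1 / sqrt (2 + 2 * lorentz e x y)) *\<^sub>R (x + y) \<in> S"
proof -
  have H: "x \<in> \<H> e" "y \<in> \<H> e" using x y closed_convexD(1)[OF S] by auto
  have p: "2 + 2 * lorentz e x y > 0" using lorentz_ge_1(1)[OF H] by simp
  define k where "k = 1 / sqrt (2 + 2 * lorentz e x y)"
  have k: "k > 0" "k * k * (2 + 2 * lorentz e x y) = 1" using p by (auto simp: k_def)
  have "k *\<^sub>R x + k *\<^sub>R y \<in> S"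
    by (rule convex_combination[OF closed_convexD(2)[OF S] x y])
      (use k hyp_unit[OF H(1)] hyp_unit[OF H(2)] in
        \<open>auto simp: lorentz_bilin lorentz_commute[of e y x] algebra_simps\<close>)
  then show ?thesis by (simp add: k_def scaleR_add_right)
qed

text \<open>The squared norm is 2 (z \<bullet> e)^2 / (e \<bullet> e) - B z z, so a vanishing form
  together with a vanishing timelike component gives convergence in norm. This makes the
  completeness of the ambient space applicable.\<close>

lemma lorentz_small_imp_small:
  assumes p: "p \<in> \<H> e"
    and 1: "((\<lambda>j. lorentz e (z j) p) \<longlongrightarrow> 0) G" and 2: "((\<lambda>j. lorentz e (z j) (z j)) \<longlongrightarrow> 0) G"
  shows "(z \<longlongrightarrow> 0) G"
proof -
  have e: "e \<noteq> 0" by (rule hyperbolic_space_nonzero[OF p])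
  have pp: "lorentz e p p = 1" by (rule hyp_unit[OF p])
  define u where "u j = z j - lorentz e (z j) p *\<^sub>R p" for j
  have "((\<lambda>j. lorentz e (z j) (z j) - (lorentz e (z j) p)\<^sup>2) \<longlongrightarrow> 0 - 0\<^sup>2) G"
    by (intro tendsto_intros 1 2)
  moreover have "lorentz e (u j) (u j) = lorentz e (z j) (z j) - (lorentz e (z j) p)\<^sup>2" for j
    by (simp add: u_def lorentz_bilin pp lorentz_commute[of e p "z j"] power2_eq_square)
  ultimately have "((\<lambda>j. lorentz e (u j) (u j)) \<longlongrightarrow> 0) G" by simp
  then have "((\<lambda>j. lorentz e (u j) e) \<longlongrightarrow> 0) G"
    by (intro lorentz_orth_tendsto[OF p]) (simp_all add: u_def lorentz_bilin pp)
  then have "((\<lambda>j. lorentz e (u j) e + lorentz e (z j) p * lorentz e p e) \<longlongrightarrow> 0 + 0 * lorentz e p e) G"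
    by (intro tendsto_intros 1)
  then have ze: "((\<lambda>j. z j \<bullet> e) \<longlongrightarrow> 0) G" by (simp add: u_def lorentz_bilin lorentz_base[symmetric])
  have "((\<lambda>j. 2 * (z j \<bullet> e) * (z j \<bullet> e) / (e \<bullet> e) - lorentz e (z j) (z j)) \<longlongrightarrow> 2 * 0 * 0 / (e \<bullet> e) - 0) G"
    using e by (intro tendsto_intros ze 2) auto
  then have "((\<lambda>j. (norm (z j))\<^sup>2) \<longlongrightarrow> 0) G" by (simp add: lorentz_alt power2_norm_eq_inner)
  then have "((\<lambda>j. norm (z j)) \<longlongrightarrow> 0) G" by simp
  then show ?thesis by (simp add: tendsto_norm_zero_iff)
qed

lemma closed_convex_projection:
  fixes e :: "'v::{real_inner, complete_space}"
  assumes S: "hyp.closed_convex e S" and ne: "S \<noteq> {}" and p: "p \<in> \<H> e"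
  obtains x where "x \<in> S" "\<And>y. y \<in> S \<Longrightarrow> lorentz e p x \<le> lorentz e p y"
    "\<And>y. y \<in> S \<Longrightarrow> lorentz e p y \<le> lorentz e p x \<Longrightarrow> y = x"
proof -
  have SH: "y \<in> \<H> e" if "y \<in> S" for y using that closed_convexD(1)[OF S] by blast
  define I where "I = (INF y\<in>S. lorentz e p y)"
  have ge1: "lorentz e p y \<ge> 1" if "y \<in> S" for y using lorentz_ge_1(1)[OF p SH[OF that]] .
  have bdd: "bdd_below (lorentz e p ` S)" using ge1 by (auto intro!: bdd_belowI)
  have I: "I \<le> lorentz e p y" if "y \<in> S" for y unfolding I_def by (rule cINF_lower[OF bdd that])
  have I1: "I \<ge> 1" unfolding I_def by (rule cINF_greatest[OF ne ge1])
  \<comment> \<open>Parallelogram argument: the midpoint (y + z) / q lies in \<open>S\<close> and so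
    pairs with \<open>p\<close> to at least I. This bounds q from above, and with it the distance
    from \<open>y\<close> to \<open>z\<close>.\<close>
  have mid: "lorentz e y z \<le> ((lorentz e p y + lorentz e p z) / I)\<^sup>2 / 2 - 1" if yz: "y \<in> S" "z \<in> S" for y z
  proof -
    define q where "q = sqrt (2 + 2 * lorentz e y z)"
    have q: "q > 0" "q\<^sup>2 = 2 + 2 * lorentz e y z"
      using lorentz_ge_1(1)[OF SH[OF yz(1)] SH[OF yz(2)]] by (auto simp: q_def)
    have "I \<le> lorentz e p ((1 / q) *\<^sub>R (y + z))"
      using I[OF closed_convex_midpoint[OF S yz]] by (simp add: q_def)
    then have "I * q \<le> lorentz e p y + lorentz e p z" using q by (simp add: lorentz_bilin field_simps)
    then have "q \<le> (lorentz e p y + lorentz e p z) / I" using I1 by (simp add: field_simps)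
    then have "q\<^sup>2 \<le> ((lorentz e p y + lorentz e p z) / I)\<^sup>2" using q by (intro power_mono) auto
    then show ?thesis using q by simp
  qed
  have "\<exists>y\<in>S. lorentz e p y < I + 1 / Suc j" for j
  proof -
    have "I < I + 1 / Suc j" by simp
    then show ?thesis unfolding I_def using cINF_less_iff[OF ne bdd] by metis
  qed
  then obtain y where y: "\<And>j. y j \<in> S" "\<And>j. lorentz e p (y j) < I + 1 / Suc j" by metis
  have lim: "(\<lambda>j. lorentz e p (y j)) \<longlonglongrightarrow> I"
  proof (rule tendsto_sandwich)
    show "\<forall>\<^sub>F j in sequentially. I \<le> lorentz e p (y j)" using I y by auto
    show "\<forall>\<^sub>F j in sequentially. lorentz e p (y j) \<le> I + 1 / Suc j" using less_imp_le[OF y(2)] by (intro always_eventually allI)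
    have "(\<lambda>j. I + 1 / Suc j) \<longlonglongrightarrow> I + 0"
      by (intro tendsto_intros LIMSEQ_Suc[OF lim_1_over_n])
    then show "(\<lambda>j. I + 1 / Suc j) \<longlonglongrightarrow> I" by simp
  qed simp
  \<comment> \<open>\<open>y\<close> is Cauchy once y i - y j tends to 0 along the product filter,
    which allows the estimates to be treated as ordinary limits.\<close>
  let ?G = "sequentially \<times>\<^sub>F sequentially"
  have l1: "((\<lambda>ij. lorentz e p (y (fst ij))) \<longlongrightarrow> I) ?G"
    "((\<lambda>ij. lorentz e p (y (snd ij))) \<longlongrightarrow> I) ?G"
    by (rule filterlim_compose[OF lim filterlim_fst] filterlim_compose[OF lim filterlim_snd])+
  have l2: "((\<lambda>ij. lorentz e (y (fst ij)) (y (snd ij))) \<longlongrightarrow> 1) ?G"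
  proof (rule tendsto_sandwich[OF _ _ tendsto_const])
    show "\<forall>\<^sub>F ij in ?G. 1 \<le> lorentz e (y (fst ij)) (y (snd ij))"
      using lorentz_ge_1(1)[OF SH[OF y(1)] SH[OF y(1)]] by simp
    let ?u = "\<lambda>ij. ((lorentz e p (y (fst ij)) + lorentz e p (y (snd ij))) / I)\<^sup>2 / 2 - 1"
    show "\<forall>\<^sub>F ij in ?G. lorentz e (y (fst ij)) (y (snd ij)) \<le> ?u ij"
      using mid[OF y(1) y(1)] by simp
    have "(?u \<longlongrightarrow> ((I + I) / I)\<^sup>2 / 2 - 1) ?G"
      using I1 by (intro tendsto_intros l1) auto
    then show "(?u \<longlongrightarrow> 1) ?G" using I1 by (simp add: field_simps power2_eq_square)
  qed
  have "((\<lambda>ij. y (fst ij) - y (snd ij)) \<longlongrightarrow> 0) ?G"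
  proof (rule lorentz_small_imp_small[OF p])
    have "((\<lambda>ij. lorentz e p (y (fst ij)) - lorentz e p (y (snd ij))) \<longlongrightarrow> I - I) ?G"
      by (intro tendsto_intros l1)
    then show "((\<lambda>ij. lorentz e (y (fst ij) - y (snd ij)) p) \<longlongrightarrow> 0) ?G"
      by (simp add: lorentz_bilin lorentz_commute[of e _ p])
    have "((\<lambda>ij. 2 - 2 * lorentz e (y (fst ij)) (y (snd ij))) \<longlongrightarrow> 2 - 2 * 1) ?G"
      by (intro tendsto_intros l2)
    moreover have "lorentz e (y i - y j) (y i - y j) = 2 - 2 * lorentz e (y i) (y j)" for i j
      using hyp_unit[OF SH[OF y(1)]]
      by (simp add: lorentz_bilin lorentz_commute[of e "y j" "y i"])
    ultimately show "((\<lambda>ij. lorentz e (y (fst ij) - y (snd ij)) (y (fst ij) - y (snd ij))) \<longlongrightarrow> 0) ?G"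
      by simp
  qed
  then have "Cauchy y"
    unfolding Cauchy_def tendsto_iff eventually_prod_sequentially
    by (force simp: dist_norm)
  then obtain x where x: "y \<longlonglongrightarrow> x" using Cauchy_convergent convergent_def by blast
  have px: "lorentz e p x = I"
    using tendsto_lorentz[OF tendsto_const x] lim LIMSEQ_unique by blast
  have "(\<lambda>j. lorentz e (y j) (y j)) \<longlonglongrightarrow> lorentz e x x" by (rule tendsto_lorentz[OF x x])
  then have xx: "lorentz e x x = 1"
    using hyp_unit[OF SH[OF y(1)]] by (simp add: tendsto_const_iff)
  have xH: "x \<in> \<H> e"
    using I1 px by (intro hyperbolic_spaceI[OF p xx]) (simp add: lorentz_commute[of e x p])
  have "limitin (hyp.mtopology e) y x sequentially"
    using tendsto_lorentz[OF x tendsto_const, of e x] xH SH[OF y(1)] by (simp add: limitin_hyp_iff xx)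
  then have xS: "x \<in> S" by (rule closed_convex_limit[OF S]) (use y in auto)
  show thesis
  proof (rule that[OF xS])
    show "lorentz e p x \<le> lorentz e p y" if "y \<in> S" for y using I[OF that] px by simp
    fix z assume z: "z \<in> S" "lorentz e p z \<le> lorentz e p x"
    then have "lorentz e p z = I" using I[OF z(1)] px by simp
    then have "lorentz e z x \<le> ((I + I) / I)\<^sup>2 / 2 - 1" using mid[OF z(1) xS] px by simp
    also have "\<dots> = 1" using I1 by (simp add: field_simps power2_eq_square)
    finally show "z = x" using lorentz_ge_1[OF SH[OF z(1)] xH] by force
  qed
qed

section \<open>Boundary values of the equivariant map\<close>

lemma tends_to_cong:
  assumes "tends_to e G y v" "\<forall>\<^sub>F j in G. y j = y' j"
  shows "tends_to e G y' v"
  unfolding tends_to_def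
proof (intro conjI allI)
  show "v \<in> null_cone e" using assms by (simp add: tends_to_def)
  have "\<forall>\<^sub>F j in G. y j \<in> \<H> e" using assms by (simp add: tends_to_def)
  then show "\<forall>\<^sub>F j in G. y' j \<in> \<H> e"
    using assms(2) by eventually_elim simp
  have "filterlim (\<lambda>j. lorentz e (y j) e) at_top G" using assms by (simp add: tends_to_def)
  then show "filterlim (\<lambda>j. lorentz e (y' j) e) at_top G"
    by (rule filterlim_mono_eventually) (use assms(2) in \<open>auto elim!: eventually_mono\<close>)
  fix z
  have "((\<lambda>j. lorentz e (y j) z / lorentz e (y j) e) \<longlongrightarrow> lorentz e v z / lorentz e v e) G"
    using assms by (simp add: tends_to_def)
  then show "((\<lambda>j. lorentz e (y' j) z / lorentz e (y' j) e) \<longlongrightarrow> lorentz e v z / lorentz e v e) G"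
    by (rule Lim_transform_eventually) (use assms(2) in \<open>auto elim!: eventually_mono\<close>)
qed

lemma isom_surj:
  assumes e: "e \<noteq> 0" and A: "lorentz_isom e A"
  shows "\<exists>x. A x = y"
proof -
  obtain a b \<alpha> \<beta> where ab: "a \<in> \<H> e" "b \<in> \<H> e" "y = \<alpha> *\<^sub>R a + \<beta> *\<^sub>R b"
    using hyperbolic_space_spans[OF e] by blast
  have "A ` \<H> e = \<H> e" using A by (simp add: lorentz_isom_def)
  then obtain a' b' where "a = A a'" "b = A b'" using ab by blast
  then have "y = A (\<alpha> *\<^sub>R a' + \<beta> *\<^sub>R b')"
    using ab(3) lorentz_isomD(1)[OF A] by (simp add: linear_add linear_scale)
  then show ?thesis by blast
qed

lemma isom_limit:
  assumes A: "lorentz_isom e A" and t: "tends_to e G y v"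
  shows "tends_to e G (\<lambda>j. A (y j)) (A v)"
proof -
  note D = lorentz_isomD[OF A]
  note v = tends_toD(1)[OF t]
  have x: "(1 / norm e) *\<^sub>R e \<in> \<H> e" (is "?x \<in> _")
    by (rule base_point[OF null_coneD(3)[OF v]])
  show ?thesis
  proof (rule tends_toI[OF lorentz_isom_null[OF A v] _ D(3)[OF x]])
    show "\<forall>\<^sub>F j in G. A (y j) \<in> \<H> e"
      using tends_toD(2)[OF t] by eventually_elim (rule D(3))
    show "filterlim (\<lambda>j. lorentz e (A (y j)) (A ?x)) at_top G"
      using tends_to_ratio(1)[OF t x] by (simp only: D(2))
    fix z
    obtain z' where z': "z = A z'" using isom_surj[OF null_coneD(3)[OF v] A] by metis
    show "((\<lambda>j. lorentz e (A (y j)) z / lorentz e (A (y j)) (A ?x)) \<longlongrightarrow>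
        lorentz e (A v) z / lorentz e (A v) (A ?x)) G"
      using tends_to_ratio(2)[OF t x, of z'] by (simp only: D(2) z')
  qed
qed

lemma lorentz_isom_hray:
  assumes A: "lorentz_isom e A"
  shows "A (hray e x v s) = hray e (A x) (A v) s"
  using lorentz_isomD[OF A] by (simp add: hray_def linear_add linear_scale)

lemma isom_group_mult:
  assumes "g \<in> carrier (isom_group M d)" "h \<in> carrier (isom_group M d)" "x \<in> M"
  shows "(g \<otimes>\<^bsub>isom_group M d\<^esub> h) x = g (h x)"
  using assms by (simp add: isom_group_def BijGroup_def compose_eq)

lemma isom_group_one: "x \<in> M \<Longrightarrow> \<one>\<^bsub>isom_group M d\<^esub> x = x"
  by (simp add: isom_group_def BijGroup_def)

text \<open>Both hulls are intersections of families of closed convex sets. Their invariance is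
  obtained by pulling each member back by a group element and observing that the preimage is again a
  member.\<close>

lemma preimage_closed_convex:
  assumes g: "g \<in> carrier (Isom_hyp e)" and K: "hyp.closed_convex e K"
  shows "hyp.closed_convex e {y \<in> \<H> e. g y \<in> K}" (is "hyp.closed_convex e ?K")
  unfolding hyp.closed_convex_def hyp.metric_closedin_iff_sequentially_closed hyp.geodesically_convex_def
proof (intro conjI allI impI)
  fix y l assume yl: "range y \<subseteq> ?K \<and> limitin (hyp.mtopology e) y l sequentially"
  then have l: "l \<in> \<H> e" "(\<lambda>j. lorentz e (y j) l) \<longlonglongrightarrow> 1" by (auto simp: limitin_hyp_iff)
  have y: "y j \<in> \<H> e" "g (y j) \<in> K" for j using yl by auto
  have "limitin (hyp.mtopology e) (\<lambda>j. g (y j)) (g l) sequentially"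
    using l y isom_hyp_lorentz[OF g] by (simp add: limitin_hyp_iff)
  then have "g l \<in> K" by (rule closed_convex_limit[OF K]) (use y in auto)
  then show "l \<in> ?K" using l by simp
next
  fix l c assume l: "0 \<le> l" and c: "hyp.geodesic_on e {0..l} c \<and> c 0 \<in> ?K \<and> c l \<in> ?K"
  have "(\<lambda>s. g (c s)) ` {0..l} \<subseteq> K"
    using closed_convexD(2)[OF K] isom_hyp_ray[OF g] c l unfolding hyp.geodesically_convex_def by blast
  moreover have "c ` {0..l} \<subseteq> \<H> e" using c by (simp add: hyp.geodesic_on_def)
  ultimately show "c ` {0..l} \<subseteq> ?K" by auto
qed auto

text \<open>\<open>\<pi>\<close> is the linear extension that witnesses irreducibility, fixed once
  and for all; that it preserves the form is derived in \<open>pi_isometry\<close>.\<close>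

locale exotic_setting =
  fixes e :: "'a::euclidean_space" and \<omega> :: "'h::{real_inner, polish_space}" and t :: real
    and \<rho> \<pi> :: "('a \<Rightarrow> 'a) \<Rightarrow> 'h \<Rightarrow> 'h" and C :: "'h set" and f :: "'a \<Rightarrow> 'h"
    and F :: "'a + (real \<Rightarrow> 'a) set \<Rightarrow> 'h + (real \<Rightarrow> 'h) set"
  assumes dim: "DIM('a) \<ge> 3" and e: "e \<noteq> 0" and \<omega>: "\<omega> \<noteq> 0" and t: "0 < t"
    and hom: "\<rho> \<in> hom (Isom_hyp e) (Isom_hyp \<omega>)"
    and lin: "\<And>g. g \<in> carrier (Isom_hyp e) \<Longrightarrow> linear (\<pi> g)"
    and ext: "\<And>g x. g \<in> carrier (Isom_hyp e) \<Longrightarrow> x \<in> \<H> \<omega> \<Longrightarrow> \<pi> g x = \<rho> g x"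
    and irr: "\<And>V. subspace V \<Longrightarrow> closed V \<Longrightarrow>
        (\<And>g. g \<in> carrier (Isom_hyp e) \<Longrightarrow> \<pi> g ` V \<subseteq> V) \<Longrightarrow> V = {0} \<or> V = UNIV"
    and tl: "\<And>g. g \<in> carrier (Isom_hyp e) \<Longrightarrow>
        translation_length (\<H> \<omega>) (hyp_dist \<omega>) (\<rho> g) =
        t * translation_length (\<H> e) (hyp_dist e) g"
    and minC: "minimal_invariant (Isom_hyp e) \<omega> \<rho> C"
    and equi: "equivariant_map e \<omega> \<rho> f"
    and cont: "continuous_extension e \<omega> f F"
begin

abbreviation "G \<equiv> carrier (Isom_hyp e)"
abbreviation "H \<equiv> \<H> e"
abbreviation "H' \<equiv> \<H> \<omega>"
abbreviation "B \<equiv> lorentz e"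
abbreviation "B' \<equiv> lorentz \<omega>"

definition "x0 = (1 / norm e) *\<^sub>R e"
definition "p = f x0"

text \<open>For a null vector with B x0 w = 1 this is the other end of the geodesic line through
  \<open>x0\<close> towards \<open>w\<close>, in the same normalisation.\<close>

abbreviation "opp w \<equiv> 2 *\<^sub>R x0 - w"

lemma x0: "x0 \<in> H"
  unfolding x0_def by (rule base_point[OF e])

lemma f_in: "x \<in> H \<Longrightarrow> f x \<in> H'"
  using equi by (auto simp: equivariant_map_def)

lemma p: "p \<in> H'"
  unfolding p_def by (rule f_in[OF x0])

lemma rho_in: "g \<in> G \<Longrightarrow> \<rho> g \<in> carrier (Isom_hyp \<omega>)"
  using hom by (auto simp: hom_def)

lemma f_equi: "g \<in> G \<Longrightarrow> x \<in> H \<Longrightarrow> f (g x) = \<pi> g (f x)"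
  using equi f_in by (simp add: equivariant_map_def ext)

lemma pi_isometry: "g \<in> G \<Longrightarrow> lorentz_isom \<omega> (\<pi> g)"
  by (rule linear_extension_isometry[OF \<omega> lin rho_in]) (auto simp: ext)

text \<open>Group elements are extensional functions on \<open>H\<close>, so a linear map has to be
  restricted before the representation can be applied to it.\<close>

definition act :: "('a \<Rightarrow> 'a) \<Rightarrow> 'h \<Rightarrow> 'h" where
  "act A = \<pi> (restrict A H)"

lemma act_isometry: "lorentz_isom e A \<Longrightarrow> lorentz_isom \<omega> (act A)"
  unfolding act_def by (rule pi_isometry[OF isom_carrier])

lemma act_f:
  assumes "lorentz_isom e A" "x \<in> H"
  shows "f (A x) = act A (f x)"
  using f_equi[OF isom_carrier[OF assms(1)] assms(2)] assms(2) by (simp add: act_def)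

text \<open>Multiplicativity is assumed for \<open>\<rho>\<close> only. For \<open>\<pi>\<close> the
  inverse relation is inherited from the hyperboloid, where the two agree and which spans the
  space.\<close>

lemma group_inverse:
  assumes g: "g \<in> G"
  obtains h where "h \<in> G" "\<And>x. x \<in> H \<Longrightarrow> g (h x) = x" "\<And>x. x \<in> H \<Longrightarrow> h (g x) = x"
    "\<And>y. \<pi> g (\<pi> h y) = y" "\<And>y. \<pi> h (\<pi> g y) = y"
proof -
  interpret group_hom "Isom_hyp e" "Isom_hyp \<omega>" \<rho>
    unfolding group_hom_def group_hom_axioms_def by (intro conjI group_isom_group hom)
  define h where "h = inv\<^bsub>Isom_hyp e\<^esub> g"
  have h: "h \<in> G" using g by (simp add: h_def)
  have gh: "g \<otimes>\<^bsub>Isom_hyp e\<^esub> h = \<one>\<^bsub>Isom_hyp e\<^esub>" "h \<otimes>\<^bsub>Isom_hyp e\<^esub> g = \<one>\<^bsub>Isom_hyp e\<^esub>"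
    using g by (simp_all add: h_def)
  have on_H: "a (b x) = x" if "a \<in> G" "b \<in> G" "a \<otimes>\<^bsub>Isom_hyp e\<^esub> b = \<one>\<^bsub>Isom_hyp e\<^esub>" "x \<in> H" for a b x
    using isom_group_mult[OF that(1,2,4)] isom_group_one[OF that(4)] that(3) by simp
  have on_lin: "\<pi> a (\<pi> b y) = y" if ab: "a \<in> G" "b \<in> G" "a \<otimes>\<^bsub>Isom_hyp e\<^esub> b = \<one>\<^bsub>Isom_hyp e\<^esub>" for a b y
  proof -
    have "(\<pi> a \<circ> \<pi> b) y = id y"
    proof (rule linear_eq_on_hyp[OF \<omega>, where P = "\<pi> a \<circ> \<pi> b" and Q = id])
      show "linear (\<pi> a \<circ> \<pi> b)" using lin ab by (intro linear_compose)
      show "linear (id :: 'h \<Rightarrow> 'h)" by (simp add: linear_id[unfolded id_def] id_def)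
      fix x assume x: "x \<in> H'"
      have "\<rho> a \<otimes>\<^bsub>Isom_hyp \<omega>\<^esub> \<rho> b = \<one>\<^bsub>Isom_hyp \<omega>\<^esub>" using ab by (metis hom_mult hom_one)
      then have "\<rho> a (\<rho> b x) = x"
        using isom_group_mult[OF rho_in[OF ab(1)] rho_in[OF ab(2)] x] isom_group_one[OF x] by simp
      then show "(\<pi> a \<circ> \<pi> b) x = id x"
        using x ab ext isom_hyp_lorentz(1)[OF rho_in[OF ab(2)] x] by simp
    qed
    then show ?thesis by simp
  qed
  show thesis using that[OF h] on_H on_lin g h gh by blast
qed

lemma norm_null_opposite:
  assumes w: "w \<in> null_cone e" and n: "B x0 w = 1"
  shows "opp w \<in> null_cone e" "B x0 (opp w) = 1" "B w (opp w) = 2"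
proof -
  note D = hyp_unit[OF x0] null_coneD(1)[OF w] n lorentz_commute[of e w x0]
  show 1: "B x0 (opp w) = 1" "B w (opp w) = 2" by (simp_all add: lorentz_bilin D)
  show "2 *\<^sub>R x0 - w \<in> null_cone e"
    by (rule null_coneI[OF x0]) (simp_all add: lorentz_bilin D)
qed

lemma boost_along_ray:
  assumes w: "w \<in> null_cone e" and n: "B x0 w = 1"
  obtains A where "lorentz_isom e A" "A w = exp s *\<^sub>R w"
    "A (opp w) = exp (- s) *\<^sub>R (opp w)" "A x0 = hray e x0 w s"
    "translation_length H (hyp_dist e) (restrict A H) = \<bar>s\<bar>"
proof -
  note o = norm_null_opposite[OF w n]
  obtain A where A: "lorentz_isom e A" "A w = exp s *\<^sub>R w"
      "A (opp w) = (1 / exp s) *\<^sub>R (opp w)"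
    using boost_exists[OF w o(1), of "exp s"] o(3) by auto
  note lA = lorentz_isomD(1)[OF A(1)]
  have x: "x0 = (1/2) *\<^sub>R (w + (opp w))" by simp
  have "A x0 = (1/2) *\<^sub>R (A w + A (opp w))"
    by (subst x) (simp only: linear_add[OF lA] linear_scale[OF lA])
  also have "\<dots> = hray e x0 w s"
    unfolding A(2,3)
    by (simp add: hray_def n exp_minus inverse_eq_divide sinh_field_def algebra_simps
        scaleR_add_left[symmetric] diff_divide_distrib)
  finally have "A x0 = hray e x0 w s" .
  moreover have "translation_length H (hyp_dist e) (restrict A H) = \<bar>ln (exp s)\<bar>"
    by (rule boost_translation_length[OF A(1) w o(1) _ _ A(2,3)]) (use o in auto)
  ultimately show thesis using that[OF A(1,2)] A(3) by (simp add: exp_minus inverse_eq_divide)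
qed

text \<open>The boost along the ray carries \<open>x0\<close> to the ray point, so its image under
  \<open>\<rho>\<close> carries \<open>p\<close> to the image of that point; and it moves
  \<open>p\<close> by at least its translation length t s.\<close>

lemma f_ray_dist:
  assumes w: "w \<in> null_cone e" and n: "B x0 w = 1" and s: "s \<ge> 0"
  shows "hyp_dist \<omega> (f (hray e x0 w s)) p \<ge> t * s"
proof -
  obtain A where A: "lorentz_isom e A" "A x0 = hray e x0 w s"
    "translation_length H (hyp_dist e) (restrict A H) = \<bar>s\<bar>"
    using boost_along_ray[OF w n] by metis
  note g = isom_carrier[OF A(1)]
  have "translation_length H' (hyp_dist \<omega>) (\<rho> (restrict A H)) = t * s"
    using tl[OF g] A(3) s by simp
  moreover have "translation_length H' (hyp_dist \<omega>) (\<rho> (restrict A H)) \<le>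
      hyp_dist \<omega> (\<rho> (restrict A H) p) p"
    unfolding translation_length_def
    by (rule cINF_lower[OF _ p]) (auto intro!: bdd_belowI[of _ 0])
  moreover have "\<rho> (restrict A H) p = f (hray e x0 w s)"
    using act_f[OF A(1) x0] ext[OF g p] by (simp add: A(2) p_def act_def)
  ultimately show ?thesis by simp
qed

text \<open>A priori \<open>F\<close> might send a boundary point to an interior point
  \<open>y\<close>. By continuity a ray would then be mapped eventually into a ball around
  \<open>y\<close>, but the image of a ray is unbounded.\<close>

lemma boundary_value_exists:
  assumes w: "w \<in> null_cone e"
  shows "\<exists>v. v \<in> null_cone \<omega> \<and> B' p v = 1 \<and> F (Inr (endpoint e w)) = Inr (endpoint \<omega> v)"
proof -
  define u where "u = (1 / B x0 w) *\<^sub>R w"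
  have p0: "B x0 w > 0" by (rule null_hyp_pos(2)[OF w x0])
  have u: "u \<in> null_cone e" "B x0 u = 1" "endpoint e u = endpoint e w"
    using p0 null_cone_scale[OF w] by (simp_all add: u_def lorentz_linear endpoint_scale)
  let ?c = "hray e x0 u"
  have "limitin (hyp.cone_topology e) (\<lambda>s. Inl (?c s)) (Inr (endpoint e u)) at_top"
    by (rule cone_limit_of_tends_to[OF hray_limit[OF x0 u(1)]])
  then have "limitin (hyp.cone_topology \<omega>) (F \<circ> (\<lambda>s. Inl (?c s))) (F (Inr (endpoint e u))) at_top"
    using cont by (intro continuous_map_limit) (auto simp: continuous_extension_def)
  moreover have "F \<circ> (\<lambda>s. Inl (?c s)) = (\<lambda>s. Inl (f (?c s)))"
    using cont hray_in[OF x0 u(1)] by (auto simp: continuous_extension_def)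
  ultimately have lim: "limitin (hyp.cone_topology \<omega>) (\<lambda>s. Inl (f (?c s))) (F (Inr (endpoint e u))) at_top"
    by simp
  have "F (Inr (endpoint e u)) \<in> topspace (hyp.cone_topology \<omega>)" using lim by (rule limitin_topspace)
  then consider y where "F (Inr (endpoint e u)) = Inl y" "y \<in> H'"
    | v where "F (Inr (endpoint e u)) = Inr (endpoint \<omega> v)" "v \<in> null_cone \<omega>"
    unfolding hyp.cone_topology_def
    by (auto simp: hyp.cone_nbhd_def boundary_eq)
  then show ?thesis
  proof cases
    case (1 y)
    have "openin (hyp.cone_topology \<omega>) (Inl ` hyp.mball \<omega> y 1)"
      unfolding hyp.cone_topology_def using 1(2) zero_less_one by (intro topology_generated_by_Basis) blast
    moreover have "F (Inr (endpoint e u)) \<in> Inl ` hyp.mball \<omega> y 1" using 1 by simp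
    ultimately have "\<forall>\<^sub>F s in at_top. (Inl (f (?c s)) :: 'h + (real \<Rightarrow> 'h) set) \<in> Inl ` hyp.mball \<omega> y 1"
      using lim by (simp add: limitin_def)
    then have "\<forall>\<^sub>F s in at_top. hyp_dist \<omega> y (f (?c s)) < 1" by (rule eventually_mono) auto
    \<comment> \<open>Beyond this time t s exceeds the distance to \<open>p\<close> of every point
      of the unit ball around \<open>y\<close>.\<close>
    moreover have "\<forall>\<^sub>F s in at_top. s > max 0 ((hyp_dist \<omega> y p + 1) / t)" by (rule eventually_gt_at_top)
    ultimately have "\<forall>\<^sub>F s in at_top. hyp_dist \<omega> y (f (?c s)) < 1 \<and> s > max 0 ((hyp_dist \<omega> y p + 1) / t)"
      by (rule eventually_conj)
    then obtain s where s: "hyp_dist \<omega> y (f (?c s)) < 1" "s > max 0 ((hyp_dist \<omega> y p + 1) / t)"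
      using eventually_happens'[OF trivial_limit_at_top_linorder] by blast
    have "t * s \<le> hyp_dist \<omega> (f (?c s)) p" using f_ray_dist[OF u(1,2), of s] s by simp
    also have "\<dots> \<le> hyp_dist \<omega> (f (?c s)) y + hyp_dist \<omega> y p"
      using 1(2) p f_in[OF hray_in[OF x0 u(1)]] by (intro hyp.triangle) auto
    also have "\<dots> < 1 + hyp_dist \<omega> y p" using s by (simp add: hyp.commute)
    finally have "t * s < 1 + hyp_dist \<omega> y p" .
    moreover have "1 + hyp_dist \<omega> y p < t * s" using s t by (simp add: field_simps)
    ultimately have False by simp
    then show ?thesis by simp
  next
    case (2 v)
    have "B' p v > 0" by (rule null_hyp_pos(2)[OF 2(2) p])
    then show ?thesis
      using 2 u(3) null_cone_scale[OF 2(2), of "1 / B' p v"]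
      by (intro exI[of _ "(1 / B' p v) *\<^sub>R v"]) (simp add: lorentz_linear endpoint_scale)
  qed
qed

text \<open>\<open>bv w\<close> is the null vector representing the \<open>F\<close>-image of the boundary point \<open>[w]\<close>. Scaling it by
  \<open>B' p (bv w) = 1\<close> makes \<open>w \<mapsto> bv w\<close> equivariant under the stabiliser of \<open>x0\<close> without any cocycle.\<close>
definition bv :: "'a \<Rightarrow> 'h" where
  "bv w = (SOME v. v \<in> null_cone \<omega> \<and> B' p v = 1 \<and> F (Inr (endpoint e w)) = Inr (endpoint \<omega> v))"

lemma bv:
  assumes "w \<in> null_cone e"
  shows "bv w \<in> null_cone \<omega>" "B' p (bv w) = 1" "F (Inr (endpoint e w)) = Inr (endpoint \<omega> (bv w))"
  using someI_ex[OF boundary_value_exists[OF assms]] unfolding bv_def by auto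

lemma bv_scale: "a > 0 \<Longrightarrow> bv (a *\<^sub>R w) = bv w"
  by (simp add: bv_def endpoint_scale)

lemma normalize_null:
  assumes w: "w \<in> null_cone e"
  obtains u where "u \<in> null_cone e" "B x0 u = 1" "bv u = bv w"
proof (rule that[of "(1 / B x0 w) *\<^sub>R w"])
  have "B x0 w > 0" by (rule null_hyp_pos(2)[OF w x0])
  then show "(1 / B x0 w) *\<^sub>R w \<in> null_cone e" "B x0 ((1 / B x0 w) *\<^sub>R w) = 1"
    "bv ((1 / B x0 w) *\<^sub>R w) = bv w"
    using null_cone_scale[OF w] by (simp_all add: lorentz_linear bv_scale)
qed

lemma bv_unique:
  assumes "v \<in> null_cone \<omega>" "u \<in> null_cone \<omega>" "B' p v = 1" "B' p u = 1" "B' v u = 0"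
  shows "v = u"
proof -
  obtain a where "a > 0" "u = a *\<^sub>R v" using null_null(2)[OF assms(1,2)] assms(5) by blast
  then show ?thesis using assms by (simp add: lorentz_linear)
qed

lemma bv_lim:
  assumes y: "tends_to e \<G> y w"
  shows "tends_to \<omega> \<G> (\<lambda>j. f (y j)) (bv w)"
proof (rule cone_limit_tends_to)
  note w = tends_toD(1)[OF y]
  show "bv w \<in> null_cone \<omega>" by (rule bv(1)[OF w])
  have "limitin (hyp.cone_topology \<omega>) (F \<circ> (\<lambda>j. Inl (y j))) (F (Inr (endpoint e w))) \<G>"
    using cont cone_limit_of_tends_to[OF y] by (intro continuous_map_limit) (auto simp: continuous_extension_def)
  then show "limitin (hyp.cone_topology \<omega>) (\<lambda>j. Inl (f (y j))) (Inr (endpoint \<omega> (bv w))) \<G>"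
    unfolding bv(3)[OF w]
    by (rule limitin_transform_eventually[rotated])
      (use cont tends_toD(2)[OF y] in \<open>auto elim!: eventually_mono simp: continuous_extension_def\<close>)
qed

text \<open>Stated through convergence because an element of \<open>G\<close> is defined on
  \<open>H\<close> only and has no values at null vectors. The image boundary point is thus given as
  the limit of the moved points; the next two lemmas provide it for abstract isometries and for
  linear ones.\<close>

lemma bv_equivariant:
  assumes g: "g \<in> G" and y: "tends_to e \<G> y w" and gy: "tends_to e \<G> (\<lambda>j. g (y j)) w'"
    and G: "\<G> \<noteq> bot"
  shows "\<exists>a>0. \<pi> g (bv w) = a *\<^sub>R bv w'"
proof (rule tends_to_unique[OF bv_lim[OF gy] _ G])
  have "tends_to \<omega> \<G> (\<lambda>j. \<pi> g (f (y j))) (\<pi> g (bv w))"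
    by (rule isom_limit[OF pi_isometry[OF g] bv_lim[OF y]])
  then show "tends_to \<omega> \<G> (\<lambda>j. f (g (y j))) (\<pi> g (bv w))"
    by (rule tends_to_cong)
      (use tends_toD(2)[OF y] in \<open>auto elim!: eventually_mono simp: f_equi[OF g]\<close>)
qed

lemma bv_group:
  assumes g: "g \<in> G" and w: "w \<in> null_cone e"
  obtains a w' where "a > 0" "w' \<in> null_cone e" "\<pi> g (bv w) = a *\<^sub>R bv w'"
proof -
  have "hyp.geodesic_on e {0..} (\<lambda>s. g (hray e x0 w s))"
    by (rule isom_hyp_ray[OF g hray_geodesic[OF x0 w]])
  then obtain w' where w': "w' \<in> null_cone e" "(\<lambda>s. g (hray e x0 w s)) \<in> endpoint e w'"
    by (rule geodesic_ray_endpoint)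
  have "g x0 \<in> H" by (rule isom_hyp_lorentz(1)[OF g x0])
  from hray_limit[OF this w'(1)]
  have "tends_to e at_top (\<lambda>s. g (hray e x0 w s)) w'"
    by (rule tends_to_cong)
      (use endpointD(3)[OF w'(2)] in \<open>auto intro!: eventually_at_top_linorderI[of 0]\<close>)
  then show thesis
    using that w'(1) bv_equivariant[OF g hray_limit[OF x0 w]] trivial_limit_at_top_linorder by blast
qed

lemma bv_act:
  assumes A: "lorentz_isom e A" and w: "w \<in> null_cone e"
  shows "\<exists>a>0. act A (bv w) = a *\<^sub>R bv (A w)"
  unfolding act_def
proof (rule bv_equivariant[OF isom_carrier[OF A] hray_limit[OF x0 w]])
  show "tends_to e at_top (\<lambda>s. restrict A H (hray e x0 w s)) (A w)"
    using isom_limit[OF A hray_limit[OF x0 w]] hray_in[OF x0 w] by simp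
qed simp

section \<open>Normalised null vectors; totality and injectivity of the boundary values\<close>

lemma orthogonal_unit:
  fixes u :: 'a
  obtains v where "v \<bullet> e = 0" "v \<bullet> u = 0" "norm v = 1"
proof -
  have "dim {e, u} \<le> card {e, u}" by (rule dim_le_card') simp
  also have "\<dots> \<le> 2" by (rule card_insert_le_m1) auto
  \<comment> \<open>Here n \<ge> 2 enters: the ambient dimension is at least 3, so two vectors leave
    room for a third direction.\<close>
  finally have "dim {e, u} < DIM('a)" using dim by simp
  then obtain v where v: "v \<noteq> 0" "\<And>y. y \<in> span {e, u} \<Longrightarrow> orthogonal v y"
    using orthogonal_to_subspace_exists by blast
  have "v \<bullet> e = 0" "v \<bullet> u = 0" using v(2)[of e] v(2)[of u] by (auto simp: span_base orthogonal_def)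
  then show thesis using that[of "(1 / norm v) *\<^sub>R v"] v(1) by simp
qed

text \<open>The normalised null vectors form the sphere of directions at \<open>x0\<close>.
  Existence, compactness and spanning are all read off from this description.\<close>

lemma norm_null_iff:
  "w \<in> null_cone e \<and> B x0 w = 1 \<longleftrightarrow> (\<exists>u. u \<bullet> e = 0 \<and> norm u = 1 \<and> w = x0 + u)"
proof -
  have ee: "x0 \<bullet> e = norm e" "x0 \<bullet> x0 = 1" "norm e > 0"
    using e by (auto simp: x0_def dot_square_norm power2_eq_square)
  have Bx: "B x0 y = (y \<bullet> e) / norm e" for y
    using e by (simp add: x0_def lorentz_linear lorentz_commute[of e e y] lorentz_base)
  show ?thesis
  proof
    assume w: "w \<in> null_cone e \<and> B x0 w = 1"
    then have we: "w \<bullet> e = norm e" using Bx[of w] ee by simp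
    have "B w w = 2 - w \<bullet> w" using ee by (simp add: lorentz_alt we dot_square_norm power2_eq_square)
    then have ww: "w \<bullet> w = 2" using w null_coneD(1) by fastforce
    have xw: "x0 \<bullet> w = 1" using we ee by (simp add: x0_def inner_commute)
    have "(w - x0) \<bullet> (w - x0) = 1"
      by (simp add: inner_diff_left inner_diff_right ww ee xw inner_commute[of w x0])
    then have "norm (w - x0) = 1" by (simp add: norm_eq_1)
    moreover have "(w - x0) \<bullet> e = 0" by (simp add: inner_diff_left we ee)
    ultimately show "\<exists>u. u \<bullet> e = 0 \<and> norm u = 1 \<and> w = x0 + u" by (intro exI[of _ "w - x0"]) simp
  next
    assume "\<exists>u. u \<bullet> e = 0 \<and> norm u = 1 \<and> w = x0 + u"
    then obtain u where u: "u \<bullet> e = 0" "norm u = 1" "w = x0 + u" by blast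
    have xu: "B x0 u = 0" using Bx u by simp
    have uu: "B u u = - 1" using u by (simp add: lorentz_alt dot_square_norm)
    have xx: "B x0 x0 = 1" by (rule hyp_unit[OF x0])
    have "B w w = 0" "B x0 w = 1" using u xu uu xx by (simp_all add: lorentz_bilin lorentz_commute[of e u x0])
    then show "w \<in> null_cone e \<and> B x0 w = 1" using null_coneI[OF x0] by (simp add: lorentz_commute[of e w x0])
  qed
qed

lemma norm_null_exists: "\<exists>w. w \<in> null_cone e \<and> B x0 w = 1"
  using orthogonal_unit[of 0] norm_null_iff by metis

lemma bv_total:
  assumes y: "\<And>w. w \<in> null_cone e \<Longrightarrow> B' y (bv w) = 0"
  shows "y = 0"
proof -
  define V where "V = {y. \<forall>w\<in>null_cone e. B' y (bv w) = 0}"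
  obtain w0 where w0: "w0 \<in> null_cone e" using norm_null_exists by blast
  have "V = {0} \<or> V = UNIV"
  proof (rule irr)
    show "subspace V" by (auto simp: subspace_def V_def lorentz_bilin)
    have "closed {y. B' y (bv w) = 0}" for w
      by (intro closed_Collect_eq continuous_intros)
    moreover have "V = (\<Inter>w\<in>null_cone e. {y. B' y (bv w) = 0})" by (auto simp: V_def)
    ultimately show "closed V" by auto
    fix g assume g: "g \<in> G"
    \<comment> \<open>Invariance of the form moves the group element to the other argument as its
      inverse, where it permutes the boundary values up to positive factors.\<close>
    obtain h where h: "h \<in> G" "\<And>y. \<pi> h (\<pi> g y) = y" using group_inverse[OF g] by metis
    show "\<pi> g ` V \<subseteq> V"
    proof (intro image_subsetI)
      fix y assume y: "y \<in> V"
      have "B' (\<pi> g y) (bv w) = 0" if w: "w \<in> null_cone e" for w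
      proof -
        obtain a w' where a: "w' \<in> null_cone e" "\<pi> h (bv w) = a *\<^sub>R bv w'" using bv_group[OF h(1) w] by metis
        have "B' (\<pi> g y) (bv w) = B' (\<pi> h (\<pi> g y)) (\<pi> h (bv w))"
          by (rule lorentz_isomD(2)[OF pi_isometry[OF h(1)], symmetric])
        also have "\<dots> = 0" using y a by (simp add: h(2) lorentz_linear V_def)
        finally show ?thesis .
      qed
      then show "\<pi> g y \<in> V" by (simp add: V_def)
    qed
  qed
  moreover have "p \<notin> V" using bv(2)[OF w0] w0 unfolding V_def by force
  moreover have "y \<in> V" using y by (simp add: V_def)
  ultimately show ?thesis by auto
qed

lemma bv_eq_of_proportional:
  assumes "w \<in> null_cone e" "u \<in> null_cone e" "B w u = 0"
  shows "bv u = bv w"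
  using null_null(2)[OF assms(1,2)] assms(3) bv_scale by metis

text \<open>If two boundary points had the same image, then, moving the second one by a reflection that fixes
  the first, all of them would, which irreducibility forbids.\<close>
lemma bv_distinct:
  assumes w: "w \<in> null_cone e" and u: "u \<in> null_cone e" and wu: "B w u > 0"
  shows "B' (bv w) (bv u) > 0"
proof (rule ccontr)
  assume "\<not> ?thesis"
  then have "B' (bv w) (bv u) = 0" using null_null(1)[OF bv(1)[OF w] bv(1)[OF u]] by simp
  then have eq: "bv w = bv u" using bv_unique bv(1,2) w u by blast
  have "bv z = bv w" if z: "z \<in> null_cone e" for z
  proof (cases "B w z = 0")
    case True
    then show ?thesis by (rule bv_eq_of_proportional[OF w z])
  next
    case False
    then have wz: "B w z > 0" using null_null(1)[OF w z] by simp
    \<comment> \<open>With this scaling \<open>w\<close> pairs equally with \<open>u\<close> and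
      \<open>c *\<^sub>R z\<close>, so the reflection that swaps them fixes
      \<open>w\<close>.\<close>
    define c where "c = B w u / B w z"
    have c: "c > 0" using wu wz by (simp add: c_def)
    note cz = null_cone_scale[OF z c]
    have bcz: "bv (c *\<^sub>R z) = bv z" by (rule bv_scale[OF c])
    show ?thesis
    proof (cases "B u (c *\<^sub>R z) = 0")
      case True
      then show ?thesis using bv_eq_of_proportional[OF u cz] eq bcz by simp
    next
      case False
      then have "B u (c *\<^sub>R z) > 0" using null_null(1)[OF u cz] by simp
      then obtain A where A: "lorentz_isom e A" "A u = c *\<^sub>R z" "A w = w"
        using swap_null[OF u cz] wz by (metis c_def lorentz_linear(4) nonzero_eq_divide_eq less_irrefl)
      obtain a b where ab: "a > 0" "act A (bv w) = a *\<^sub>R bv w" "b > 0" "act A (bv u) = b *\<^sub>R bv (c *\<^sub>R z)"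
        using bv_act[OF A(1) w] bv_act[OF A(1) u] A by metis
      then have "a *\<^sub>R bv w = b *\<^sub>R bv z" using eq bcz by simp
      then have "B' p (a *\<^sub>R bv w) = B' p (b *\<^sub>R bv z)" by simp
      \<comment> \<open>Both boundary values pair to 1 with \<open>p\<close>, so the two factors
        agree and can be cancelled.\<close>
      then have "a = b" using bv(2)[OF w] bv(2)[OF z] by (simp add: lorentz_linear)
      then show ?thesis using \<open>a *\<^sub>R bv w = b *\<^sub>R bv z\<close> ab by simp
    qed
  qed
  then have "bv w = 0"
    using null_coneD(1)[OF bv(1)[OF w]] by (intro bv_total) simp
  then show False using null_coneD(4)[OF bv(1)[OF w]] by simp
qed

lemma isotropy_fixed_unique:
  assumes q: "q \<in> H'" and fixed: "\<And>g. g \<in> G \<Longrightarrow> g x0 = x0 \<Longrightarrow> \<rho> g q = q"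
  shows "q = p"
proof -
  have const: "B' q (bv w) = B' q (bv u)" if w: "w \<in> null_cone e" "B x0 w = 1" and u: "u \<in> null_cone e" "B x0 u = 1" for w u
  proof (cases "B w u = 0")
    case True
    then show ?thesis using bv_eq_of_proportional[OF w(1) u(1)] by simp
  next
    case False
    then have "B w u > 0" using null_null(1)[OF w(1) u(1)] by simp
    then obtain A where A: "lorentz_isom e A" "A w = u" "A x0 = x0"
      using swap_null[OF w(1) u(1)] w(2) u(2) by metis
    note g = isom_carrier[OF A(1)]
    note D = lorentz_isomD[OF act_isometry[OF A(1)]]
    have pf: "act A p = p" using act_f[OF A(1) x0] A(3) by (simp add: p_def)
    have qf: "act A q = q" using fixed[OF g] ext[OF g q] A(3) x0 by (simp add: act_def)
    obtain a where a: "act A (bv w) = a *\<^sub>R bv u" using bv_act[OF A(1) w(1)] A(2) by auto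
    have "1 = B' (act A p) (act A (bv w))" using D(2) bv(2)[OF w(1)] by simp
    \<comment> \<open>\<open>act A\<close> fixes \<open>p\<close>, against which both boundary
      values are normalised, so no factor can appear.\<close>
    then have "a = 1" using bv(2)[OF u(1)] by (simp add: pf a lorentz_linear)
    then show ?thesis using D(2)[of q "bv w"] by (simp add: qf a)
  qed
  obtain w0 where w0: "w0 \<in> null_cone e" "B x0 w0 = 1" using norm_null_exists by blast
  define c where "c = B' q (bv w0)"
  have c: "c > 0" unfolding c_def by (rule null_hyp_pos(2)[OF bv(1)[OF w0(1)] q])
  have "q - c *\<^sub>R p = 0"
  proof (rule bv_total)
    fix w assume w: "w \<in> null_cone e"
    obtain u where u: "u \<in> null_cone e" "B x0 u = 1" "bv u = bv w" by (rule normalize_null[OF w])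
    have "B' q (bv w) = c" using const[OF u(1,2) w0] u(3) by (simp add: c_def)
    then show "B' (q - c *\<^sub>R p) (bv w) = 0" using bv(2)[OF w] by (simp add: lorentz_bilin)
  qed
  then have qc: "q = c *\<^sub>R p" by simp
  then have "c * c = 1" using hyp_unit[OF q] hyp_unit[OF p] by (simp add: lorentz_linear)
  then have "c\<^sup>2 = 1" by (simp add: power2_eq_square)
  then have "c = 1" using c by (simp add: power2_eq_1_iff)
  then show ?thesis using qc by simp
qed

section \<open>The minimal set and the first hull\<close>

lemma C: "hyp.closed_convex \<omega> C" "C \<noteq> {}" "g \<in> G \<Longrightarrow> x \<in> C \<Longrightarrow> \<rho> g x \<in> C"
  using minC by (auto simp: minimal_invariant_def invariant_closed_convex_def)

lemma C_minimal:
  assumes "D \<noteq> {}" "hyp.closed_convex \<omega> D" "D \<subseteq> C" "\<And>g x. g \<in> G \<Longrightarrow> x \<in> D \<Longrightarrow> \<rho> g x \<in> D"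
  shows "D = C"
  using minC assms by (auto simp: minimal_invariant_def invariant_closed_convex_def image_subset_iff)

lemma C_sub: "C \<subseteq> H'"
  using closed_convexD(1)[OF C(1)] .

lemma p_in_C: "p \<in> C"
proof -
  obtain x where x: "x \<in> C" "\<And>y. y \<in> C \<Longrightarrow> B' p y \<le> B' p x \<Longrightarrow> y = x"
    using closed_convex_projection[OF C(1,2) p] by metis
  have xH: "x \<in> H'" using x C_sub by blast
  have "x = p"
  proof (rule isotropy_fixed_unique[OF xH])
    fix g assume g: "g \<in> G" "g x0 = x0"
    \<comment> \<open>The stabiliser of \<open>x0\<close> fixes \<open>p\<close> and maps
      \<open>C\<close> into itself, so the image of the nearest point is again at minimal distance,
      and nearest points are unique.\<close>
    have "B' p (\<rho> g x) = B' (\<pi> g p) (\<pi> g x)"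
      using f_equi[OF g(1) x0] g(2) ext[OF g(1) xH] by (simp add: p_def)
    also have "\<dots> = B' p x" by (rule lorentz_isomD(2)[OF pi_isometry[OF g(1)]])
    finally show "\<rho> g x = x" using x C(3)[OF g(1)] by simp
  qed
  then show ?thesis using x by simp
qed

lemma f_in_C:
  assumes x: "x \<in> H"
  shows "f x \<in> C"
proof -
  obtain A where A: "lorentz_isom e A" "A x0 = x" using transitive_on_points[OF x0 x] by metis
  note g = isom_carrier[OF A(1)]
  have "f x = \<rho> (restrict A H) p" using act_f[OF A(1) x0] ext[OF g p] A(2) by (simp add: p_def act_def)
  then show ?thesis using C(3)[OF g p_in_C] by simp
qed

lemma C_eq_hull: "C = hyp.closed_convex_hull \<omega> (f ` H)"
proof -
  define \<K> where "\<K> = {K. hyp.closed_convex \<omega> K \<and> f ` H \<subseteq> K}"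
  have D: "hyp.closed_convex_hull \<omega> (f ` H) = \<Inter>\<K>"
    by (simp add: hyp.closed_convex_hull_def hull_def \<K>_def)
  have CK: "C \<in> \<K>" using C(1) f_in_C by (auto simp: \<K>_def)
  have "\<Inter>\<K> = C"
  proof (rule C_minimal)
    show "\<Inter>\<K> \<noteq> {}" using x0 by (auto simp: \<K>_def)
    show "hyp.closed_convex \<omega> (\<Inter>\<K>)" using CK by (intro closed_convex_Inter) (auto simp: \<K>_def)
    show "\<Inter>\<K> \<subseteq> C" using CK by blast
    fix g x assume g: "g \<in> G" and x: "x \<in> \<Inter>\<K>"
    show "\<rho> g x \<in> \<Inter>\<K>"
    proof
      fix K assume K: "K \<in> \<K>"
      \<comment> \<open>By equivariance the image of \<open>f\<close> also lies in this preimage, so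
        \<open>x\<close>, which lies in every member of the family, lies in it too.\<close>
      have "{y \<in> H'. \<rho> g y \<in> K} \<in> \<K>"
        using K preimage_closed_convex[OF rho_in[OF g]] f_in f_equi[OF g] ext[OF g] isom_hyp_lorentz(1)[OF g]
        by (auto simp: \<K>_def image_subset_iff) (metis imageI subsetD)
      then show "\<rho> g x \<in> K" using x by blast
    qed
  qed
  then show ?thesis using D by simp
qed

end

section \<open>The limit set\<close>

text \<open>Factoring out the dominant exponentials turns the quotient into 2 powr t * (1 + exp (- 2
  t s)) / (1 + exp (- 2 s)) powr t.\<close>

lemma cosh_powr_asymptotic:
  fixes t :: real
  assumes t: "t > 0"
  shows "((\<lambda>s. 2 * cosh (t * s) / cosh s powr t) \<longlongrightarrow> 2 powr t) at_top"
proof -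
  have e0: "((\<lambda>s::real. exp (- c * s)) \<longlongrightarrow> 0) at_top" if "c > 0" for c
  proof (rule filterlim_compose[OF exp_at_bot])
    have "filterlim (\<lambda>s. c * s) at_top at_top"
      by (rule filterlim_tendsto_pos_mult_at_top[OF tendsto_const that filterlim_ident])
    then have "filterlim (\<lambda>s. - (c * s)) at_bot at_top" by (simp add: filterlim_uminus_at_top)
    then show "filterlim (\<lambda>s. - c * s) at_bot at_top" by simp
  qed
  have t2: "2 * t > 0" using t by simp
  have "((\<lambda>s. 2 powr t * (1 + exp (- (2 * t) * s)) / (1 + exp (- 2 * s)) powr t) \<longlongrightarrow>
      2 powr t * (1 + 0) / (1 + 0) powr t) at_top"
    by (intro tendsto_intros e0[OF t2] e0[of 2]) auto
  moreover have "2 powr t * (1 + exp (- (2 * t) * s)) / (1 + exp (- 2 * s)) powr t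
      = 2 * cosh (t * s) / cosh s powr t" for s
  proof -
    have "cosh s = exp s * (1 + exp (- 2 * s)) / 2"
      by (simp add: cosh_field_def distrib_left exp_add[symmetric])
    then have "cosh s powr t = (exp s * (1 + exp (- 2 * s)) / 2) powr t" by (simp only:)
    also have "\<dots> = exp s powr t * (1 + exp (- 2 * s)) powr t / 2 powr t"
      by (simp add: powr_divide powr_mult add_nonneg_nonneg)
    also have "exp s powr t = exp (t * s)" by (simp add: powr_def)
    finally have "cosh s powr t = exp (t * s) * (1 + exp (- 2 * s)) powr t / 2 powr t" .
    moreover have "2 * cosh (t * s) = exp (t * s) * (1 + exp (- (2 * t) * s))"
      by (simp add: cosh_field_def distrib_left exp_add[symmetric])
    ultimately show ?thesis by simp
  qed
  ultimately show ?thesis by simp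
qed

context exotic_setting
begin

text \<open>Two-point homogeneity: move \<open>x\<close> to \<open>x'\<close>, then reflect the
  image of \<open>y\<close> to \<open>y'\<close>. Since both are equidistant from \<open>x'\<close>,
  the second motion fixes \<open>x'\<close>.\<close>

lemma f_two_point:
  assumes H: "x \<in> H" "y \<in> H" "x' \<in> H" "y' \<in> H" and eq: "B x y = B x' y'"
  shows "B' (f x) (f y) = B' (f x') (f y')"
proof -
  obtain A where A: "lorentz_isom e A" "A x = x'" using transitive_on_points[OF H(1,3)] by metis
  note AH = lorentz_isomD(3)[OF A(1)]
  have "B x' (A y) = B x' y'" using lorentz_isomD(2)[OF A(1), of x y] A(2) eq by simp
  then obtain A' where A': "lorentz_isom e A'" "A' (A y) = y'" "A' x' = x'"
    using transitive_on_points[OF AH[OF H(2)] H(4)] by metis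
  have "B' (f x') (f y') = B' (act A' (act A (f x))) (act A' (act A (f y)))"
    using act_f[OF A(1) H(1)] act_f[OF A(1) H(2)] act_f[OF A'(1) H(3)] act_f[OF A'(1) AH[OF H(2)]] A A'
    by simp
  also have "\<dots> = B' (f x) (f y)"
    by (simp add: lorentz_isomD(2)[OF act_isometry] A A')
  finally show ?thesis by simp
qed

text \<open>The image of the boost scales the boundary values of the two ends of its axis, so it is
  itself a boost, and the displacement estimate applies to \<open>p\<close>. Both boundary values
  pair to 1 with \<open>p\<close>, which makes N equal to 1 / \<kappa>.\<close>

lemma f_ray_displacement:
  assumes w: "w \<in> null_cone e" and n: "B x0 w = 1" and s: "s > 0"
  defines "\<kappa> \<equiv> B' (bv w) (bv (opp w))"
  shows "\<bar>B' (f (hray e x0 w s)) p - 2 * cosh (t * s) / \<kappa>\<bar> \<le> 2 / \<kappa> - 1" "\<kappa> > 0"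
proof -
  obtain A where A: "lorentz_isom e A" "A w = exp s *\<^sub>R w"
    "A (opp w) = exp (- s) *\<^sub>R (opp w)" "A x0 = hray e x0 w s"
    "translation_length H (hyp_dist e) (restrict A H) = \<bar>s\<bar>"
    by (rule boost_along_ray[OF w n])
  define w' where "w' = 2 *\<^sub>R x0 - w"
  note o = norm_null_opposite[OF w n, folded w'_def]
  note A = A[folded w'_def]
  note g = isom_carrier[OF A(1)]
  note aA = act_isometry[OF A(1)]
  note v = bv(1,2)[OF w] and v' = bv(1,2)[OF o(1)]
  have k: "\<kappa> = B' (bv w) (bv w')" by (simp add: \<kappa>_def w'_def)
  show k0: "\<kappa> > 0" unfolding k using bv_distinct[OF w o(1)] o(3) by simp
  obtain a where a: "a > 0" "act A (bv w) = a *\<^sub>R bv w"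
    using bv_act[OF A(1) w] A(2) bv_scale[of "exp s" w] by auto
  obtain b where b: "b > 0" "act A (bv w') = b *\<^sub>R bv w'"
    using bv_act[OF A(1) o(1)] A(3) bv_scale[of "exp (- s)" w'] by auto
  \<comment> \<open>The form is preserved and the two boundary values pair nontrivially, so the two
    scaling factors are inverse to each other.\<close>
  have "\<kappa> = B' (act A (bv w)) (act A (bv w'))" by (simp add: lorentz_isomD(2)[OF aA] k)
  also have "\<dots> = a * b * \<kappa>" by (simp add: a b lorentz_linear k)
  finally have ab: "b = 1 / a" using k0 a(1) by (simp add: field_simps)
  have "translation_length H' (hyp_dist \<omega>) (\<rho> (restrict A H)) = \<bar>ln a\<bar>"
    by (rule boost_translation_length[OF aA v(1) v'(1) _ a(1) a(2)])
      (use k0 b ab ext[OF g] in \<open>auto simp: k act_def\<close>)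
  then have "\<bar>ln a\<bar> = t * s" using tl[OF g] A(5) s by simp
  then have "cosh \<bar>ln a\<bar> = cosh (t * s)" by simp
  \<comment> \<open>The translation length determines \<open>a\<close> only up to inversion, but the
    sum a + 1 / a is symmetric under it.\<close>
  then have ca: "a + 1 / a = 2 * cosh (t * s)"
    using a(1) by (simp add: abs_if cosh_field_def exp_minus inverse_eq_divide split: if_splits)
  have "\<bar>B' (act A p) p - (B' p (bv w) * B' p (bv w') / B' (bv w) (bv w')) * (a + 1 / a)\<bar>
      \<le> 2 * (B' p (bv w) * B' p (bv w') / B' (bv w) (bv w')) - 1"
    by (rule boost_displacement[OF aA v(1) v'(1) _ a(1) a(2) _ p]) (use k0 b ab in \<open>auto simp: k\<close>)
  moreover have "act A p = f (hray e x0 w s)" using act_f[OF A(1) x0] A(4) by (simp add: p_def)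
  ultimately show "\<bar>B' (f (hray e x0 w s)) p - 2 * cosh (t * s) / \<kappa>\<bar> \<le> 2 / \<kappa> - 1"
    using v(2) v'(2) by (simp add: ca k)
qed

text \<open>The pairing of two image points depends on their distance only, so \<open>\<Phi>\<close>
  may be sampled along a single ray from \<open>x0\<close>. The lower bound by translation length
  gives the injectivity of \<open>f\<close>.\<close>

lemma displacement_function:
  obtains \<Phi> L where "L > 0" "((\<lambda>r. \<Phi> r / r powr t) \<longlongrightarrow> L) at_top"
    "\<And>x y. x \<in> H \<Longrightarrow> y \<in> H \<Longrightarrow> B' (f x) (f y) = \<Phi> (B x y)"
    "\<And>x y. x \<in> H \<Longrightarrow> y \<in> H \<Longrightarrow> B' (f x) (f y) \<ge> cosh (t * hyp_dist e x y)"
proof -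
  obtain w where w: "w \<in> null_cone e" "B x0 w = 1" using norm_null_exists by blast
  define \<kappa> where "\<kappa> = B' (bv w) (bv (opp w))"
  note disp = f_ray_displacement[OF w, folded \<kappa>_def]
  have k0: "\<kappa> > 0" using disp(2)[of 1] by simp
  define \<Phi> where "\<Phi> r = B' (f (hray e x0 w (arcosh r))) p" for r
  define L where "L = 2 powr t / \<kappa>"
  have "((\<lambda>s. B' (f (hray e x0 w s)) p / cosh s powr t) \<longlongrightarrow> L) at_top"
  proof -
    have "((\<lambda>s. cosh s powr (- t)) \<longlongrightarrow> 0) at_top"
      using t by (intro tendsto_neg_powr cosh_real_at_top) simp
    then have "((\<lambda>s. (2 / \<kappa> - 1) * cosh s powr (- t)) \<longlongrightarrow> 0) at_top"
      by (rule tendsto_mult_right_zero)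
    then have z: "((\<lambda>s. (2 / \<kappa> - 1) / cosh s powr t) \<longlongrightarrow> 0) at_top"
      by (simp add: powr_minus_divide)
    \<comment> \<open>The deviation from the model displacement 2 cosh (t s) / \<kappa> is bounded,
      and so vanishes after division by a power of cosh s that tends to infinity.\<close>
    let ?d = "\<lambda>s. B' (f (hray e x0 w s)) p / cosh s powr t - (2 * cosh (t * s) / cosh s powr t) / \<kappa>"
    have "(?d \<longlongrightarrow> 0) at_top"
    proof (rule Lim_null_comparison[OF _ z])
      show "\<forall>\<^sub>F s in at_top. norm (?d s) \<le> (2 / \<kappa> - 1) / cosh s powr t"
        using eventually_gt_at_top[of 0]
      proof eventually_elim
        case (elim s)
        have c: "cosh s powr t > 0" using cosh_real_pos[of s] by simp
        have "?d s = (B' (f (hray e x0 w s)) p - 2 * cosh (t * s) / \<kappa>) / cosh s powr t"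
          by (simp add: diff_divide_distrib mult.commute)
        then have "norm (?d s) = \<bar>B' (f (hray e x0 w s)) p - 2 * cosh (t * s) / \<kappa>\<bar> / cosh s powr t"
          using c by simp
        also have "\<dots> \<le> (2 / \<kappa> - 1) / cosh s powr t"
          using disp(1)[OF elim] c by (intro divide_right_mono) auto
        finally show ?case .
      qed
    qed
    moreover have "((\<lambda>s. (2 * cosh (t * s) / cosh s powr t) / \<kappa>) \<longlongrightarrow> L) at_top"
      unfolding L_def using k0 by (intro tendsto_intros cosh_powr_asymptotic t) auto
    ultimately have "((\<lambda>s. ?d s + (2 * cosh (t * s) / cosh s powr t) / \<kappa>) \<longlongrightarrow> 0 + L) at_top"
      by (rule tendsto_add)
    then show ?thesis by simp
  qed
  then have lim: "((\<lambda>r. B' (f (hray e x0 w (arcosh r))) p / cosh (arcosh r) powr t) \<longlongrightarrow> L) at_top"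
    by (rule filterlim_compose[OF _ arcosh_real_at_top])
  have ray: "B' (f x) (f y) = B' (f (hray e x0 w (hyp_dist e x y))) p" if xy: "x \<in> H" "y \<in> H" for x y
    unfolding p_def
    by (rule f_two_point[OF xy hray_in[OF x0 w(1)] x0])
      (simp add: hray_lorentz[OF x0 w(1)] hyp_dist_cosh[OF xy])
  show thesis
  proof (rule that)
    show "L > 0" using k0 by (simp add: L_def)
    show "((\<lambda>r. \<Phi> r / r powr t) \<longlongrightarrow> L) at_top"
      using lim
    proof (rule Lim_transform_eventually)
      show "\<forall>\<^sub>F r in at_top. B' (f (hray e x0 w (arcosh r))) p / cosh (arcosh r) powr t = \<Phi> r / r powr t"
        using eventually_ge_at_top[of 1] by eventually_elim (simp add: \<Phi>_def)
    qed
    fix x y assume xy: "x \<in> H" "y \<in> H"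
    show "B' (f x) (f y) = \<Phi> (B x y)" using ray[OF xy] xy by (simp add: \<Phi>_def hyp_dist_def)
    have "cosh (t * s) \<le> B' (f (hray e x0 w s)) p" if "s \<ge> 0" for s
    proof -
      have fr: "f (hray e x0 w s) \<in> H'" by (rule f_in[OF hray_in[OF x0 w(1)]])
      have "cosh (t * s) \<le> cosh (hyp_dist \<omega> (f (hray e x0 w s)) p)"
        using f_ray_dist[OF w that] that t
        by (subst cosh_real_nonneg_le_iff) auto
      then show ?thesis by (simp add: hyp_dist_cosh[OF fr p])
    qed
    then show "B' (f x) (f y) \<ge> cosh (t * hyp_dist e x y)" using ray[OF xy] by simp
  qed
qed

lemma f_inj:
  assumes "x \<in> H" "y \<in> H" "f x = f y"
  shows "x = y"
proof -
  obtain \<Phi> L where "\<And>x y. x \<in> H \<Longrightarrow> y \<in> H \<Longrightarrow> B' (f x) (f y) \<ge> cosh (t * hyp_dist e x y)"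
    using displacement_function by metis
  then have "cosh (t * hyp_dist e x y) \<le> B' (f y) (f y)" using assms by metis
  then have "cosh (t * hyp_dist e x y) \<le> cosh 0" using hyp_unit[OF f_in[OF assms(2)]] by simp
  then have "t * hyp_dist e x y \<le> 0" using t by (subst (asm) cosh_real_nonneg_le_iff) auto
  then have "hyp_dist e x y = 0"
    using t by (metis hyp.nonneg linorder_not_le mult_pos_pos order_antisym_conv)
  then show ?thesis using hyp.zero assms by blast
qed

text \<open>The Gram matrix is an iterated limit: sending one argument of \<open>\<Phi>(B x y)\<close> to the boundary gives
  the Poisson kernel \<open>B' (bv w) (f x) = (B w x)\<^sup>t\<close>, sending the other one there as well gives the claim.\<close>
lemma bv_gram:
  obtains L where "L > 0"
    "\<And>w u. w \<in> null_cone e \<Longrightarrow> u \<in> null_cone e \<Longrightarrow> B x0 w = 1 \<Longrightarrow> B x0 u = 1 \<Longrightarrow>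
      B' (bv w) (bv u) = B w u powr t / L"
proof -
  obtain \<Phi> L where L: "L > 0" and lim: "((\<lambda>r. \<Phi> r / r powr t) \<longlongrightarrow> L) at_top"
    and \<Phi>: "\<And>x y. x \<in> H \<Longrightarrow> y \<in> H \<Longrightarrow> B' (f x) (f y) = \<Phi> (B x y)"
    using displacement_function by metis
  have poisson: "B' (bv w) (f x) = B w x powr t" if w: "w \<in> null_cone e" "B x0 w = 1" and x: "x \<in> H" for w x
  proof -
    define y where "y = hray e x0 w"
    have y: "tends_to e at_top y w" unfolding y_def by (rule hray_limit[OF x0 w(1)])
    have yH: "y s \<in> H" for s unfolding y_def by (rule hray_in[OF x0 w(1)])
    have wx: "B w x > 0" by (rule null_hyp_pos(1)[OF w(1) x])
    have w0: "B w x0 = 1" using w(2) by (simp add: lorentz_commute)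
    have "((\<lambda>s. B' (f (y s)) (f x) / B' (f (y s)) p) \<longlongrightarrow> B' (bv w) (f x) / B' (bv w) p) at_top"
      by (rule tends_to_ratio(2)[OF bv_lim[OF y] p])
    then have 1: "((\<lambda>s. B' (f (y s)) (f x) / B' (f (y s)) p) \<longlongrightarrow> B' (bv w) (f x)) at_top"
      using bv(2)[OF w(1)] by (simp add: lorentz_commute[of \<omega> _ p])
    note a = tends_to_ratio(1)[OF y x] and b = tends_to_ratio(1)[OF y x0]
    \<comment> \<open>Each value of \<open>\<Phi>\<close> is divided by its growth rate. The two
      quotients have the same limit L and cancel, leaving the power of B w x / B w x0, where B w x0
      = 1.\<close>
    let ?q = "\<lambda>s. (\<Phi> (B (y s) x) / B (y s) x powr t) / (\<Phi> (B (y s) x0) / B (y s) x0 powr t)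
        * (B (y s) x / B (y s) x0) powr t"
    have "(?q \<longlongrightarrow> L / L * (B w x / B w x0) powr t) at_top"
      using wx L w0
      by (intro tendsto_mult[OF tendsto_divide[OF filterlim_compose[OF lim a] filterlim_compose[OF lim b]]
          tendsto_powr[OF tends_to_ratio(2)[OF y x0] tendsto_const]]) auto
    then have 2: "(?q \<longlongrightarrow> B w x powr t) at_top" using L w0 by simp
    have "?q s = B' (f (y s)) (f x) / B' (f (y s)) p" for s
    proof -
      have "B (y s) x \<ge> 1" "B (y s) x0 \<ge> 1" using lorentz_ge_1(1)[OF yH] x x0 by auto
      then have pw: "B (y s) x powr t > 0" "B (y s) x0 powr t > 0"
        "(B (y s) x / B (y s) x0) powr t = B (y s) x powr t / B (y s) x0 powr t"
        by (auto simp: powr_divide)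
      have "(a / c) / (b / d) * (c / d) = a / b" if "c > 0" "d > 0" for a b c d :: real
        using that by (simp add: field_simps)
      then show ?thesis using pw \<Phi>[OF yH x] \<Phi>[OF yH x0] by (simp add: p_def)
    qed
    with 2 have "((\<lambda>s. B' (f (y s)) (f x) / B' (f (y s)) p) \<longlongrightarrow> B w x powr t) at_top" by simp
    then show ?thesis using 1 tendsto_unique[OF trivial_limit_at_top_linorder] by blast
  qed
  show thesis
  proof (rule that[OF L])
    fix w u assume w: "w \<in> null_cone e" "B x0 w = 1" and u: "u \<in> null_cone e" "B x0 u = 1"
    define y where "y = hray e x0 u"
    have y: "tends_to e at_top y u" unfolding y_def by (rule hray_limit[OF x0 u(1)])
    have yH: "y s \<in> H" for s unfolding y_def by (rule hray_in[OF x0 u(1)])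
    have u0: "B u x0 = 1" using u(2) by (simp add: lorentz_commute)
    have "((\<lambda>s. B' (f (y s)) (bv w) / B' (f (y s)) p) \<longlongrightarrow> B' (bv u) (bv w) / B' (bv u) p) at_top"
      by (rule tends_to_ratio(2)[OF bv_lim[OF y] p])
    then have 1: "((\<lambda>s. B' (f (y s)) (bv w) / B' (f (y s)) p) \<longlongrightarrow> B' (bv u) (bv w)) at_top"
      using bv(2)[OF u(1)] by (simp add: lorentz_commute[of \<omega> _ p])
    note b = tends_to_ratio(1)[OF y x0]
    \<comment> \<open>The numerator is now the Poisson kernel, known exactly; only the denominator
      involves \<open>\<Phi>\<close>, so one factor L survives.\<close>
    let ?q = "\<lambda>s. (B (y s) w / B (y s) x0) powr t / (\<Phi> (B (y s) x0) / B (y s) x0 powr t)"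
    have "(?q \<longlongrightarrow> (B u w / B u x0) powr t / L) at_top"
    \<comment> \<open>For u = w the base tends to 0; the power still converges because t > 0 and the
      bases are nonnegative.\<close>
    proof (rule tendsto_divide[OF tendsto_powr'[OF tends_to_ratio(2)[OF y x0] tendsto_const]
          filterlim_compose[OF lim b]])
      have "B (y s) w / B (y s) x0 \<ge> 0" for s
        using null_hyp_pos(2)[OF w(1) yH[of s]] lorentz_ge_1(1)[OF yH[of s] x0] by simp
      then show "B u w / B u x0 \<noteq> 0 \<or> 0 < t \<and> (\<forall>\<^sub>F s in at_top. 0 \<le> B (y s) w / B (y s) x0)"
        using t by simp
    qed (use L in auto)
    then have 2: "(?q \<longlongrightarrow> B u w powr t / L) at_top" using u0 by simp
    have "?q s = B' (f (y s)) (bv w) / B' (f (y s)) p" for s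
    proof -
      have "B (y s) x0 \<ge> 1" "B (y s) w > 0"
        using lorentz_ge_1(1)[OF yH x0] null_hyp_pos(2)[OF w(1) yH] by auto
      then have pw: "B (y s) x0 powr t > 0"
        "(B (y s) w / B (y s) x0) powr t = B (y s) w powr t / B (y s) x0 powr t"
        by (auto simp: powr_divide)
      have "(a / c) / (b / c) = a / b" if "c > 0" for a b c :: real using that by simp
      then show ?thesis
        using pw \<Phi>[OF yH x0] poisson[OF w yH[of s]]
        by (simp add: p_def lorentz_commute[of \<omega> _ "bv w"] lorentz_commute[of e _ w])
    qed
    with 2 have "((\<lambda>s. B' (f (y s)) (bv w) / B' (f (y s)) p) \<longlongrightarrow> B u w powr t / L) at_top" by simp
    then have "B' (bv u) (bv w) = B u w powr t / L"
      using 1 tendsto_unique[OF trivial_limit_at_top_linorder] by blast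
    then show "B' (bv w) (bv u) = B w u powr t / L" by (simp add: lorentz_commute)
  qed
qed

lemma boundary_image: "F ` Inr ` hyp.boundary e = Inr ` endpoint \<omega> ` bv ` null_cone e"
  unfolding boundary_eq image_image using bv(3) by (intro image_cong) auto

lemma bv_ray_in:
  assumes K: "hyp.closed_convex \<omega> K" and f: "\<And>x. x \<in> H \<Longrightarrow> f x \<in> K" and w: "w \<in> null_cone e"
    and x: "x \<in> K" and s: "s \<ge> 0"
  shows "hray \<omega> x (bv w) s \<in> K"
  by (rule closed_convex_ray[OF K x _ bv_lim[OF hray_limit[OF x0 w]] _ s])
    (use f hray_in[OF x0 w] in auto)

lemma bv_boundary_C:
  assumes "w \<in> null_cone e"
  shows "endpoint \<omega> (bv w) \<in> hyp.boundary_of \<omega> C"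
  using boundary_of_iff[OF bv(1)[OF assms] C_sub] p_in_C bv_ray_in[OF C(1) f_in_C assms] by blast

text \<open>Minimality of \<open>C\<close> applies once the intersection is known to be nonempty.
  This is not immediate, since the competing sets are only required to share boundary points; a
  point on the geodesic line joining two of the boundary values lies in all of them.\<close>

lemma C_eq_boundary_hull: "C = hyp.boundary_hull \<omega> (F ` Inr ` hyp.boundary e)"
proof -
  define \<K> where "\<K> = {K. hyp.closed_convex \<omega> K \<and> (\<forall>w\<in>null_cone e. endpoint \<omega> (bv w) \<in> hyp.boundary_of \<omega> K)}"
  have *: "Inr ` endpoint \<omega> ` bv ` null_cone e \<subseteq> Inr ` X \<longleftrightarrow> (\<forall>w\<in>null_cone e. endpoint \<omega> (bv w) \<in> X)" for X
    by (auto simp: image_subset_iff)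
  then have D: "hyp.boundary_hull \<omega> (F ` Inr ` hyp.boundary e) = \<Inter>\<K>"
    unfolding boundary_image hyp.boundary_hull_def \<K>_def by (simp only: *)
  have CK: "C \<in> \<K>" using C(1) bv_boundary_C by (simp add: \<K>_def)
  have "\<Inter>\<K> = C"
  proof (rule C_minimal)
    show "hyp.closed_convex \<omega> (\<Inter>\<K>)" using CK by (intro closed_convex_Inter) (auto simp: \<K>_def)
    show "\<Inter>\<K> \<subseteq> C" using CK by blast
    obtain w where w: "w \<in> null_cone e" "B x0 w = 1" using norm_null_exists by blast
    note o = norm_null_opposite[OF w]
    define k where "k = B' (bv w) (bv (opp w))"
    have k: "k > 0" unfolding k_def using bv_distinct[OF w(1) o(1)] o(3) by simp
    \<comment> \<open>The factor 1 / (2 k) makes the pairing of the two null vectors 1 / 2, as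
      \<open>boundary_midpoint\<close> requires, without changing the boundary point.\<close>
    have ep: "endpoint \<omega> ((1 / (2 * k)) *\<^sub>R bv (opp w)) = endpoint \<omega> (bv (opp w))"
      using k by (intro endpoint_scale) simp
    have "bv w + (1 / (2 * k)) *\<^sub>R bv (opp w) \<in> K" if K: "K \<in> \<K>" for K
      by (rule boundary_midpoint[OF _ bv(1)[OF w(1)] null_cone_scale[OF bv(1)[OF o(1)]]])
        (use K k w o ep in \<open>auto simp: \<K>_def lorentz_linear k_def[symmetric]\<close>)
    then show "\<Inter>\<K> \<noteq> {}" by blast
    fix g x assume g: "g \<in> G" and x: "x \<in> \<Inter>\<K>"
    show "\<rho> g x \<in> \<Inter>\<K>"
    proof
      fix K assume K: "K \<in> \<K>"
      then have Kc: "hyp.closed_convex \<omega> K" by (simp add: \<K>_def)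
      let ?K = "{y \<in> H'. \<rho> g y \<in> K}"
      \<comment> \<open>A ray of \<open>K\<close> towards the image of the boundary point of
        \<open>bv w\<close> is pulled back by \<open>\<rho> g\<close> to a ray towards that
        point.\<close>
      have "endpoint \<omega> (bv w) \<in> hyp.boundary_of \<omega> ?K" if w: "w \<in> null_cone e" for w
      proof -
        obtain a w' where a: "a > 0" "w' \<in> null_cone e" "\<pi> g (bv w) = a *\<^sub>R bv w'"
          by (rule bv_group[OF g w])
        have "endpoint \<omega> (bv w') \<in> hyp.boundary_of \<omega> K" using K a by (simp add: \<K>_def)
        then obtain y where y: "y \<in> K" "\<And>s. s \<ge> 0 \<Longrightarrow> hray \<omega> y (bv w') s \<in> K"
          using boundary_of_iff[OF bv(1)[OF a(2)] closed_convexD(1)[OF Kc]] by blast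
        have "y \<in> H'" using y(1) closed_convexD(1)[OF Kc] by blast
        then obtain y' where y': "y' \<in> H'" "y = \<rho> g y'"
          using isom_hyp_image[OF rho_in[OF g]] by blast
        have "hray \<omega> y' (bv w) s \<in> ?K" if s: "s \<ge> 0" for s
        proof -
          have h: "hray \<omega> y' (bv w) s \<in> H'" by (rule hray_in[OF y'(1) bv(1)[OF w]])
          have "\<rho> g (hray \<omega> y' (bv w) s) = hray \<omega> (\<pi> g y') (\<pi> g (bv w)) s"
            using ext[OF g h] lorentz_isom_hray[OF pi_isometry[OF g]] by metis
          also have "\<dots> = hray \<omega> y (bv w') s"
            using y' ext[OF g y'(1)] by (simp add: a hray_scale)
          finally show ?thesis using y(2)[OF s] h by simp
        qed
        moreover have "y' \<in> ?K" using y y' by simp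
        ultimately show ?thesis using boundary_of_iff[OF bv(1)[OF w], of ?K] by blast
      qed
      then have "?K \<in> \<K>" using preimage_closed_convex[OF rho_in[OF g] Kc] by (simp add: \<K>_def)
      then show "\<rho> g x \<in> K" using x by blast
    qed
  qed
  then show ?thesis using D by simp
qed

section \<open>Compactness of the limit set and the boundary of C\<close>

lemma norm_null_compact: "compact {w. w \<in> null_cone e \<and> B x0 w = 1}"
proof -
  have eq: "{w. w \<in> null_cone e \<and> B x0 w = 1} = (\<lambda>u. x0 + u) ` ({u. u \<bullet> e = 0} \<inter> sphere 0 1)"
    using norm_null_iff by force
  have "closed {u. u \<bullet> e = 0}" by (intro closed_Collect_eq continuous_intros)
  then have "compact ({u. u \<bullet> e = 0} \<inter> sphere 0 1)" by (intro closed_Int_compact) auto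
  then show ?thesis unfolding eq by (intro compact_continuous_image continuous_intros)
qed

text \<open>On null vectors normalised by \<open>p\<close> the form is half of a squared distance, so the limit set
  inherits compactness from the sphere by the Gram formula above.\<close>
lemma bv_gap:
  assumes u: "u \<in> null_cone \<omega>" "B' p u = 1" and notin: "u \<notin> bv ` null_cone e"
  shows "\<exists>\<delta>>0. \<forall>w\<in>null_cone e. B' (bv w) u \<ge> \<delta>"
proof (rule ccontr)
  assume neg: "\<not> ?thesis"
  have "\<exists>w. w \<in> null_cone e \<and> B x0 w = 1 \<and> B' (bv w) u < 1 / Suc j" for j
  proof -
    have "(1::real) / Suc j > 0" by simp
    then obtain w where w: "w \<in> null_cone e" "B' (bv w) u < 1 / Suc j" using neg by (meson not_le)
    then show ?thesis using normalize_null[OF w(1)] by metis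
  qed
  then obtain w where w: "\<And>j. w j \<in> null_cone e" "\<And>j. B x0 (w j) = 1" "\<And>j. B' (bv (w j)) u < 1 / Suc j"
    by metis
  have "\<forall>j. w j \<in> {w. w \<in> null_cone e \<and> B x0 w = 1}" using w by simp
  then obtain l r where l: "l \<in> null_cone e" "B x0 l = 1" and r: "strict_mono r" "(w \<circ> r) \<longlonglongrightarrow> l"
    using norm_null_compact[unfolded compact_def] by blast
  obtain L where L: "L > 0" "\<And>w u. w \<in> null_cone e \<Longrightarrow> u \<in> null_cone e \<Longrightarrow> B x0 w = 1 \<Longrightarrow> B x0 u = 1 \<Longrightarrow>
      B' (bv w) (bv u) = B w u powr t / L"
    by (rule bv_gram) blast
  define v where "v j = bv (w (r j))" for j
  have v: "v j \<in> null_cone \<omega>" "B' p (v j) = 1" for j using bv(1,2)[OF w(1)] by (auto simp: v_def)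
  note bl = bv(1,2)[OF l(1)]
  have "(\<lambda>j. B (w (r j)) l) \<longlonglongrightarrow> B l l"
    using r(2) by (intro tendsto_lorentz tendsto_const) (simp add: o_def)
  then have Bl: "(\<lambda>j. B (w (r j)) l) \<longlonglongrightarrow> 0" using null_coneD(1)[OF l(1)] by simp
  have "(\<lambda>j. B (w (r j)) l powr t / L) \<longlonglongrightarrow> 0 powr t / L"
    using L(1) t null_null(1)[OF w(1) l(1)]
    by (intro tendsto_divide tendsto_powr' Bl tendsto_const) auto
  then have 1: "(\<lambda>j. B' (v j) (bv l)) \<longlonglongrightarrow> 0"
    using L(2)[OF w(1) l(1) w(2) l(2)] by (simp add: v_def)
  have 2: "(\<lambda>j. B' (v j) u) \<longlonglongrightarrow> 0"
  proof (rule tendsto_sandwich[OF _ _ tendsto_const])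
    show "\<forall>\<^sub>F j in sequentially. 0 \<le> B' (v j) u" using null_null(1)[OF v(1) u(1)] by simp
    show "\<forall>\<^sub>F j in sequentially. B' (v j) u \<le> 1 / Suc (r j)"
      using less_imp_le[OF w(3)] by (simp add: v_def)
    have "filterlim (\<lambda>j. 1 / real (Suc j)) (nhds 0) sequentially"
      by (rule LIMSEQ_Suc[OF lim_1_over_n])
    then show "(\<lambda>j. 1 / real (Suc (r j))) \<longlonglongrightarrow> 0"
      using LIMSEQ_subseq_LIMSEQ[OF _ r(1)] by (fastforce simp: o_def)
  qed
  \<comment> \<open>The inequality \<bar>a + b\<bar>^2 \<le> 2 \<bar>a\<bar>^2 + 2 \<bar>b\<bar>^2
    for the squared distance: \<open>z\<close> is 2 v - u - bv l, which is orthogonal to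
    \<open>p\<close>, and there the form is negative semidefinite.\<close>
  have bound: "B' u (bv l) \<le> 2 * B' (v j) u + 2 * B' (v j) (bv l)" for j
  proof -
    define z where "z = (v j - u) + (v j - bv l)"
    have "B' z p = 0" using v(2) u(2) bl(2) by (simp add: z_def lorentz_bilin lorentz_commute[of \<omega> _ p])
    then have "B' z z \<le> 0" by (rule lorentz_neg_def(1)[OF p])
    moreover have "B' z z = 2 * B' u (bv l) - 4 * B' (v j) u - 4 * B' (v j) (bv l)"
      using null_coneD(1)[OF v(1)] null_coneD(1)[OF u(1)] null_coneD(1)[OF bl(1)]
      by (simp add: z_def lorentz_bilin lorentz_commute[of \<omega> u "v j"] lorentz_commute[of \<omega> "bv l" "v j"]
          lorentz_commute[of \<omega> "bv l" u])
    ultimately show ?thesis by simp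
  qed
  have "(\<lambda>j. 2 * B' (v j) u + 2 * B' (v j) (bv l)) \<longlonglongrightarrow> 2 * 0 + 2 * 0"
    by (intro tendsto_intros 1 2)
  then have "B' u (bv l) \<le> 2 * 0 + 2 * 0" by (rule tendsto_lowerbound) (use bound in auto)
  then have "B' u (bv l) = 0" using null_null(1)[OF u(1) bl(1)] by simp
  then have "u = bv l" using bv_unique u bl by blast
  then show False using notin l by blast
qed

lemma boundary_of_C: "hyp.boundary_of \<omega> C = endpoint \<omega> ` bv ` null_cone e"
proof (intro equalityI subsetI)
  fix \<xi> assume \<xi>: "\<xi> \<in> hyp.boundary_of \<omega> C"
  then have "\<xi> \<in> hyp.boundary \<omega>" by (simp add: hyp.boundary_of_def)
  then obtain u' where u': "u' \<in> null_cone \<omega>" "\<xi> = endpoint \<omega> u'" by (auto simp: boundary_eq)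
  define u where "u = (1 / B' p u') *\<^sub>R u'"
  have "B' p u' > 0" by (rule null_hyp_pos(2)[OF u'(1) p])
  then have u: "u \<in> null_cone \<omega>" "B' p u = 1" "\<xi> = endpoint \<omega> u"
    using null_cone_scale[OF u'(1)] u' by (auto simp: u_def lorentz_linear endpoint_scale)
  show "\<xi> \<in> endpoint \<omega> ` bv ` null_cone e"
  proof (cases "u \<in> bv ` null_cone e")
    case True
    then show ?thesis using u by simp
  next
    case False
    obtain \<delta> where \<delta>: "\<delta> > 0" "\<And>w. w \<in> null_cone e \<Longrightarrow> B' (bv w) u \<ge> \<delta>"
      using bv_gap[OF u(1,2) False] by blast
    \<comment> \<open>Pairing with \<open>a\<close> is at least \<delta> / 2 on all boundary values
      and equals - \<delta> / 2 on \<open>u\<close>. The half-space thus contains the hull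
      \<open>C\<close>, while any ray towards \<open>u\<close> eventually leaves it.\<close>
    define a where "a = u - (\<delta> / 2) *\<^sub>R p"
    define K where "K = {x \<in> H'. B' x a \<ge> 0}"
    have Kc: "hyp.closed_convex \<omega> K" unfolding K_def by (rule halfspace_closed_convex[OF \<omega>])
    have "endpoint \<omega> (bv w) \<in> hyp.boundary_of \<omega> K" if w: "w \<in> null_cone e" for w
    proof -
      let ?c = "hray \<omega> p (bv w)"
      have c: "tends_to \<omega> at_top ?c (bv w)" by (rule hray_limit[OF p bv(1)[OF w]])
      have bp: "B' (bv w) p = 1" using bv(2)[OF w] by (simp add: lorentz_commute)
      have "((\<lambda>s. B' (?c s) a / B' (?c s) p) \<longlongrightarrow> B' (bv w) a / B' (bv w) p) at_top"
        by (rule tends_to_ratio(2)[OF c p])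
      moreover have "B' (bv w) a / B' (bv w) p > 0"
        using \<delta>(1) \<delta>(2)[OF w] by (simp add: a_def lorentz_bilin bp)
      ultimately have "\<forall>\<^sub>F s in at_top. B' (?c s) a / B' (?c s) p > 0" by (rule order_tendstoD(1))
      then have ev: "\<forall>\<^sub>F s in at_top. ?c s \<in> K"
      proof eventually_elim
        case (elim s)
        have cH: "?c s \<in> H'" by (rule hray_in[OF p bv(1)[OF w]])
        then have "B' (?c s) p > 0" using lorentz_ge_1(1)[OF cH p] by simp
        then show ?case using elim cH by (simp add: K_def zero_less_divide_iff)
      qed
      then obtain s0 where s0: "?c s0 \<in> K"
        using eventually_happens'[OF trivial_limit_at_top_linorder] by blast
      have "hray \<omega> (?c s0) (bv w) s \<in> K" if "s \<ge> 0" for s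
        by (rule closed_convex_ray[OF Kc s0 ev c _ that]) simp
      then show ?thesis using boundary_of_iff[OF bv(1)[OF w] closed_convexD(1)[OF Kc]] s0 by blast
    qed
    then have "F ` Inr ` hyp.boundary e \<subseteq> Inr ` hyp.boundary_of \<omega> K"
      unfolding boundary_image by blast
    then have CK: "C \<subseteq> K"
      using Kc C_eq_boundary_hull unfolding hyp.boundary_hull_def by blast
    obtain x where x: "x \<in> C" "\<And>s. s \<ge> 0 \<Longrightarrow> hray \<omega> x u s \<in> C"
      using \<xi> u(3) boundary_of_iff[OF u(1) C_sub] by blast
    have xH: "x \<in> H'" using x C_sub by blast
    have up: "B' u p = 1" using u(2) by (simp add: lorentz_commute)
    have "((\<lambda>s. B' (hray \<omega> x u s) a / B' (hray \<omega> x u s) p) \<longlongrightarrow> B' u a / B' u p) at_top"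
      by (rule tends_to_ratio(2)[OF hray_limit[OF xH u(1)] p])
    moreover have "\<forall>\<^sub>F s in at_top. B' (hray \<omega> x u s) a / B' (hray \<omega> x u s) p \<ge> 0"
      using eventually_ge_at_top[of 0]
    proof eventually_elim
      case (elim s)
      have h: "hray \<omega> x u s \<in> K" using x(2)[OF elim] CK by blast
      then have "B' (hray \<omega> x u s) p \<ge> 1" by (intro lorentz_ge_1(1)[OF _ p]) (simp add: K_def)
      then show ?case using h by (simp add: K_def)
    qed
    ultimately have "B' u a / B' u p \<ge> 0" by (rule tendsto_lowerbound) simp
    then show ?thesis using \<delta>(1) null_coneD(1)[OF u(1)] by (simp add: a_def lorentz_bilin up)
  qed
next
  fix \<xi> assume "\<xi> \<in> endpoint \<omega> ` bv ` null_cone e"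
  then show "\<xi> \<in> hyp.boundary_of \<omega> C" using bv_boundary_C by auto
qed

lemma boundary_C: "Inr ` hyp.boundary_of \<omega> C = F ` Inr ` hyp.boundary e"
  by (simp add: boundary_of_C boundary_image)

end

section \<open>Isometries of the convex core\<close>

context exotic_setting
begin

text \<open>The antipode of \<open>w\<close> and a direction perpendicular to both: the pairings are
  2, 1 and 1. The perpendicular direction exists because n \<ge> 2.\<close>

lemma two_more_null:
  assumes w: "w \<in> null_cone e" "B x0 w = 1"
  obtains u z where "u \<in> null_cone e" "B x0 u = 1" "z \<in> null_cone e" "B x0 z = 1"
    "B w u > 0" "B w z > 0" "B u z > 0"
proof -
  obtain a where a: "a \<bullet> e = 0" "norm a = 1" "w = x0 + a" using norm_null_iff w by blast
  obtain b where b: "b \<bullet> e = 0" "b \<bullet> a = 0" "norm b = 1" by (rule orthogonal_unit)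
  note o = norm_null_opposite[OF w]
  define z where "z = x0 + b"
  have z: "z \<in> null_cone e" "B x0 z = 1" using norm_null_iff b z_def by blast+
  have "B a b = 0" using a b by (simp add: lorentz_alt inner_commute)
  moreover have "B x0 b = 0" using z(2) hyp_unit[OF x0] by (simp add: z_def lorentz_add)
  ultimately have wz: "B w z = 1"
    using w(2) hyp_unit[OF x0]
    by (simp add: a(3) z_def lorentz_add lorentz_commute[of e a x0])
  then have "B (opp w) z = 1" using z(2) by (simp add: lorentz_linear)
  then show thesis using that[OF o(1,2) z] o(3) wz by simp
qed

lemma span_normalized_null: "span {w. w \<in> null_cone e \<and> B x0 w = 1} = UNIV"
proof -
  let ?N = "{w. w \<in> null_cone e \<and> B x0 w = 1}"
  obtain w where w: "w \<in> null_cone e" "B x0 w = 1" using norm_null_exists by blast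
  have "w \<in> span ?N" "2 *\<^sub>R x0 - w \<in> span ?N"
    using w norm_null_opposite[OF w] by (auto intro: span_base)
  then have "(1/2) *\<^sub>R (w + (opp w)) \<in> span ?N" by (intro span_scale span_add)
  then have x: "x0 \<in> span ?N" by simp
  have "y \<in> span ?N" for y
  proof -
    define c where "c = (y \<bullet> e) / (x0 \<bullet> e)"
    define q where "q = y - c *\<^sub>R x0"
    have "x0 \<bullet> e \<noteq> 0" using hyperbolic_space_pos[OF x0] by (simp add: lorentz_base)
    then have qe: "q \<bullet> e = 0" by (simp add: q_def c_def inner_diff_left)
    have "q \<in> span ?N"
    proof (cases "q = 0")
      case True
      then show ?thesis by (simp add: span_zero)
    next
      case False
      have "x0 + (1 / norm q) *\<^sub>R q \<in> ?N"
        using norm_null_iff False qe by (intro CollectI) (auto intro!: exI[of _ "(1 / norm q) *\<^sub>R q"])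
      then have "norm q *\<^sub>R ((x0 + (1 / norm q) *\<^sub>R q) - x0) \<in> span ?N"
        by (intro span_scale span_diff x span_base)
      then show ?thesis using False by simp
    qed
    then have "q + c *\<^sub>R x0 \<in> span ?N" by (intro span_add span_scale x)
    then show ?thesis by (simp add: q_def)
  qed
  then show ?thesis by auto
qed

text \<open>\<open>T\<close> is not assumed linear or continuous. Prescribe a linear
  \<open>A\<close> on a basis of normalised null vectors; it preserves the nondegenerate form, hence
  is bijective. For any other \<open>w\<close> the difference A w - T w is orthogonal to the images
  of the basis, so it vanishes.\<close>

lemma extend_gram_preserving:
  assumes T: "\<And>w. w \<in> null_cone e \<Longrightarrow> B x0 w = 1 \<Longrightarrow> T w \<in> null_cone e"
    and gram: "\<And>w u. w \<in> null_cone e \<Longrightarrow> B x0 w = 1 \<Longrightarrow> u \<in> null_cone e \<Longrightarrow> B x0 u = 1 \<Longrightarrow>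
      B (T w) (T u) = B w u"
  obtains A where "lorentz_isom e A" "\<And>w. w \<in> null_cone e \<Longrightarrow> B x0 w = 1 \<Longrightarrow> A w = T w"
proof -
  let ?N = "{w. w \<in> null_cone e \<and> B x0 w = 1}"
  obtain S where S: "S \<subseteq> ?N" "independent S" "?N \<subseteq> span S" by (rule maximal_independent_subset)
  have sp: "span S = UNIV" using S(3) span_normalized_null span_mono[OF S(3)] by (simp add: span_span top.extremum_uniqueI)
  obtain A where A: "linear A" "\<And>x. x \<in> S \<Longrightarrow> A x = T x"
    using linear_independent_extend[OF S(2)] by blast
  have AB: "B (A x) (A y) = B x y" for x y
  proof (rule bilinear_eq[of "\<lambda>x y. B (A x) (A y)" B UNIV S UNIV S])
    show "bilinear (\<lambda>x y. B (A x) (A y))"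
      unfolding bilinear_def
      by (intro conjI allI linearI) (simp_all add: linear_add[OF A(1)] linear_scale[OF A(1)] lorentz_bilin)
    show "bilinear B"
      unfolding bilinear_def by (intro conjI allI linearI) (simp_all add: lorentz_bilin)
    show "B (A x) (A y) = B x y" if "x \<in> S" "y \<in> S" for x y
      using that gram S(1) A(2) by auto
  qed (use sp in auto)
  have "inj A"
    unfolding linear_injective_0[OF A(1)]
  proof (intro allI impI)
    fix x assume "A x = 0"
    then have "B x y = 0" for y using AB[of x y] by simp
    then show "x = 0" by (rule lorentz_nondegenerate[OF e])
  qed
  then have surj: "surj A" by (rule linear_injective_imp_surjective[OF A(1)]) simp
  have AT: "A w = T w" if w: "w \<in> null_cone e" "B x0 w = 1" for w
  proof -
    define z where "z = A w - T w"
    have zS: "B z (A u) = 0" if u: "u \<in> S" for u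
      using AB[of w u] gram[OF w, of u] A(2)[OF u] S(1) u by (auto simp: z_def lorentz_linear)
    have "B z (A y) = 0" for y
    proof -
      have "y \<in> span S" using sp by simp
      then show ?thesis
        by (induction rule: span_induct_alt)
          (auto simp: linear_0[OF A(1)] linear_add[OF A(1)] linear_scale[OF A(1)] lorentz_bilin zS)
    qed
    then have "B z y = 0" for y using surj by (metis surjD)
    then have "z = 0" by (rule lorentz_nondegenerate[OF e])
    then show ?thesis by (simp add: z_def)
  qed
  obtain w where w: "w \<in> null_cone e" "B x0 w = 1" using norm_null_exists by blast
  note o = norm_null_opposite[OF w]
  \<comment> \<open>\<open>x0\<close> is the midpoint of two normalised null vectors, so its image
    is half the sum of two vectors of the null cone; this decides the sheet.\<close>
  have "A x0 = (1/2) *\<^sub>R (A w + A (opp w))"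
    by (simp add: linear_diff[OF A(1)] linear_scale[OF A(1)])
  also have "\<dots> = (1/2) *\<^sub>R (T w + T (opp w))" using AT w o by simp
  finally have "B (A x0) e > 0"
    using null_coneD(2)[OF T[OF w]] null_coneD(2)[OF T[OF o(1,2)]] by (simp add: lorentz_bilin)
  then have Ax0: "A x0 \<in> H" using AB[of x0 x0] hyp_unit[OF x0] by (simp add: hyperbolic_space_def)
  have "A ` H = H"
  proof (intro equalityI subsetI)
    fix y assume "y \<in> A ` H"
    then obtain x where x: "x \<in> H" "y = A x" by blast
    show "y \<in> H"
      by (rule hyperbolic_spaceI[OF Ax0])
        (use x AB hyp_unit[OF x(1)] lorentz_ge_1(1)[OF x(1) x0] in auto)
  next
    fix y assume y: "y \<in> H"
    obtain x where x: "y = A x" using surj by blast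
    have "x \<in> H"
      by (rule hyperbolic_spaceI[OF x0])
        (use x AB hyp_unit[OF y] lorentz_ge_1(1)[OF y Ax0] in auto)
    then show "y \<in> A ` H" using x by blast
  qed
  then have "lorentz_isom e A" using A(1) AB by (simp add: lorentz_isom_def)
  then show thesis using that AT by blast
qed

text \<open>\<open>h\<close> carries the rays from \<open>p\<close> to rays from \<open>h p\<close>,
  with null vectors \<open>hv w\<close> normalised against \<open>h p\<close>. Rewritten in terms of
  boundary values normalised against \<open>p\<close>, they acquire factors \<open>m w\<close>, and
  these are what the linear isometry has to reproduce.\<close>

lemma isometry_of_C_extends:
  assumes h: "h \<in> carrier (isom_group C (hyp_dist \<omega>))"
  obtains g where "g \<in> G" "\<And>x. x \<in> C \<Longrightarrow> h x = \<rho> g x"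
proof -
  have hC: "h x \<in> C" if "x \<in> C" for x using isom_hyp_image[OF h] that by blast
  have hB: "B' (h x) (h y) = B' x y" if xy: "x \<in> C" "y \<in> C" for x y
  proof -
    have H: "x \<in> H'" "y \<in> H'" "h x \<in> H'" "h y \<in> H'" using xy hC C_sub by auto
    have "hyp_dist \<omega> (h x) (h y) = hyp_dist \<omega> x y" using h xy by (simp add: isom_group_carrier_iff)
    then show ?thesis using hyp_dist_cosh[OF H(1,2)] hyp_dist_cosh[OF H(3,4)] by simp
  qed
  have hp: "h p \<in> C" "h p \<in> H'" using hC[OF p_in_C] C_sub by auto
  let ?N = "{w. w \<in> null_cone e \<and> B x0 w = 1}"
  have rayC: "hray \<omega> p (bv w) s \<in> C" if "w \<in> ?N" "s \<ge> 0" for w s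
    using bv_ray_in[OF C(1) f_in_C _ p_in_C that(2)] that(1) by simp
  have "\<exists>v. v \<in> null_cone \<omega> \<and> B' (h p) v = 1 \<and> (\<forall>s\<ge>0. h (hray \<omega> p (bv w) s) = hray \<omega> (h p) v s)"
    if w: "w \<in> ?N" for w
  proof -
    have bw: "bv w \<in> null_cone \<omega>" using bv(1) w by simp
    have "hyp.geodesic_on \<omega> {0..} (\<lambda>s. h (hray \<omega> p (bv w) s))"
      by (rule geodesic_onI)
        (use hC rayC[OF w] C_sub hB hray_lorentz(1)[OF p bw] in auto)
    then obtain v where v: "v \<in> null_cone \<omega>" "B' (h (hray \<omega> p (bv w) 0)) v = 1"
        "(\<lambda>s. h (hray \<omega> p (bv w) s)) \<in> endpoint \<omega> v"
      by (rule geodesic_ray_endpoint)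
    show ?thesis using v endpointD(3)[OF v(3)] by auto
  qed
  then have "\<forall>w\<in>?N. \<exists>v. v \<in> null_cone \<omega> \<and> B' (h p) v = 1 \<and>
      (\<forall>s\<ge>0. h (hray \<omega> p (bv w) s) = hray \<omega> (h p) v s)"
    by blast
  from bchoice[OF this] obtain hv where hv: "\<And>w. w \<in> ?N \<Longrightarrow> hv w \<in> null_cone \<omega>" "\<And>w. w \<in> ?N \<Longrightarrow> B' (h p) (hv w) = 1"
      "\<And>w s. w \<in> ?N \<Longrightarrow> s \<ge> 0 \<Longrightarrow> h (hray \<omega> p (bv w) s) = hray \<omega> (h p) (hv w) s"
    by blast
  have s1: "sinh 1 \<noteq> (0::real)" by simp
  \<comment> \<open>The point at time 1 on a ray is a combination of its start and its null vector.
    Pairings with the start are preserved, so those with the null vector are too.\<close>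
  have hv_C: "B' (hv w) (h x) = B' (bv w) x" if w: "w \<in> ?N" and x: "x \<in> C" for w x
  proof -
    have "B' (hray \<omega> (h p) (hv w) 1) (h x) = B' (hray \<omega> p (bv w) 1) x"
      using hB[OF rayC[OF w] x, of 1] hv(3)[OF w, of 1] by simp
    then have "sinh 1 * B' (hv w) (h x) = sinh 1 * B' (bv w) x"
      using hB[OF p_in_C x] hv(2)[OF w] bv(2)[of w] w by (simp add: hray_def lorentz_bilin)
    then show ?thesis using s1 by simp
  qed
  have hv_gram: "B' (hv w) (hv u) = B' (bv w) (bv u)" if w: "w \<in> ?N" and u: "u \<in> ?N" for w u
  proof -
    have "B' (hv w) (hray \<omega> (h p) (hv u) 1) = B' (bv w) (hray \<omega> p (bv u) 1)"
      using hv_C[OF w rayC[OF u], of 1] hv(3)[OF u, of 1] by simp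
    then have "sinh 1 * B' (hv w) (hv u) = sinh 1 * B' (bv w) (bv u)"
      using hv(2)[OF w] hv(2)[OF u] bv(2)[of u] bv(2)[of w] w u
      by (simp add: hray_def lorentz_bilin lorentz_commute[of \<omega> _ p] lorentz_commute[of \<omega> _ "h p"])
    then show ?thesis using s1 by simp
  qed
  \<comment> \<open>The image ray stays in \<open>C\<close>, so its end belongs to the boundary of
    \<open>C\<close>, which consists of boundary values only.\<close>
  have ex: "\<exists>b m. b \<in> ?N \<and> m > 0 \<and> hv w = m *\<^sub>R bv b" if w: "w \<in> ?N" for w
  proof -
    have "endpoint \<omega> (hv w) \<in> hyp.boundary_of \<omega> C"
      using boundary_of_iff[OF hv(1)[OF w] C_sub] hp(1) hv(3)[OF w] hC[OF rayC[OF w]] by metis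
    then obtain u where u: "u \<in> null_cone e" "endpoint \<omega> (bv u) = endpoint \<omega> (hv w)"
      unfolding boundary_of_C by (metis imageE)
    then obtain m where m: "m > 0" "hv w = m *\<^sub>R bv u"
      using endpoint_eq_iff[OF bv(1)[OF u(1)] hv(1)[OF w]] by blast
    obtain b where "b \<in> null_cone e" "B x0 b = 1" "bv b = bv u" by (rule normalize_null[OF u(1)])
    then show ?thesis using m by (intro exI[of _ b] exI[of _ m]) simp
  qed
  have "\<forall>w\<in>?N. \<exists>bm. fst bm \<in> ?N \<and> snd bm > 0 \<and> hv w = snd bm *\<^sub>R bv (fst bm)"
  proof
    fix w assume "w \<in> ?N"
    from ex[OF this] obtain b m where "b \<in> ?N \<and> m > 0 \<and> hv w = m *\<^sub>R bv b" by (elim exE)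
    then show "\<exists>bm. fst bm \<in> ?N \<and> snd bm > 0 \<and> hv w = snd bm *\<^sub>R bv (fst bm)"
      by (intro exI[of _ "(b, m)"]) (simp only: fst_conv snd_conv)
  qed
  from bchoice[OF this] obtain bm where
    bm: "\<forall>w\<in>?N. fst (bm w) \<in> ?N \<and> snd (bm w) > 0 \<and> hv w = snd (bm w) *\<^sub>R bv (fst (bm w))"
    by blast
  define b where "b w = fst (bm w)" for w
  define m where "m w = snd (bm w)" for w
  have bm: "\<And>w. w \<in> ?N \<Longrightarrow> b w \<in> ?N" "\<And>w. w \<in> ?N \<Longrightarrow> m w > 0"
      "\<And>w. w \<in> ?N \<Longrightarrow> hv w = m w *\<^sub>R bv (b w)"
    using bm unfolding b_def m_def by blast+
  obtain L where L: "L > 0" "\<And>w u. w \<in> null_cone e \<Longrightarrow> u \<in> null_cone e \<Longrightarrow> B x0 w = 1 \<Longrightarrow> B x0 u = 1 \<Longrightarrow>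
      B' (bv w) (bv u) = B w u powr t / L"
    by (rule bv_gram) blast
  \<comment> \<open>The Gram formula gives m w * m u * B (b w) (b u) powr t = B w u powr t. Taking
    the power 1 / t absorbs the factors into a rescaling of the source null vectors.\<close>
  define T where "T w = (m w powr (1 / t)) *\<^sub>R b w" for w
  have gram: "B (T w) (T u) = B w u" if w: "w \<in> ?N" and u: "u \<in> ?N" for w u
  proof -
    have nn: "B w u \<ge> 0" "B (b w) (b u) \<ge> 0" using null_null(1) w u bm(1)[OF w] bm(1)[OF u] by auto
    have "m w * m u * (B (b w) (b u) powr t / L) = B w u powr t / L"
      using hv_gram[OF w u] L(2) w u bm(1)[OF w] bm(1)[OF u]
      by (simp add: bm(3)[OF w] bm(3)[OF u] lorentz_linear mult_ac)
    then have "m w * m u * B (b w) (b u) powr t = B w u powr t" using L(1) by (simp add: field_simps)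
    then have "(m w * m u * B (b w) (b u) powr t) powr (1 / t) = (B w u powr t) powr (1 / t)" by simp
    then have "(m w powr (1 / t)) * (m u powr (1 / t)) * B (b w) (b u) = B w u"
      using nn t bm(2)[OF w] bm(2)[OF u] by (simp add: powr_mult powr_powr)
    then show ?thesis by (simp add: T_def lorentz_linear mult_ac)
  qed
  have TN: "T w \<in> null_cone e" if w: "w \<in> ?N" for w
    unfolding T_def using bm(1)[OF w] bm(2)[OF w] by (intro null_cone_scale) auto
  obtain A where A: "lorentz_isom e A" "\<And>w. w \<in> ?N \<Longrightarrow> A w = T w"
    by (rule extend_gram_preserving[of T]) (use TN gram in auto)
  note aA = act_isometry[OF A(1)]
  have "\<exists>a>0. act A (bv w) = a *\<^sub>R bv (b w)" if w: "w \<in> ?N" for w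
    using bv_act[OF A(1), of w] w A(2)[OF w] bv_scale[of "m w powr (1 / t)" "b w"] bm(2)[OF w]
    by (auto simp: T_def)
  then have "\<forall>w\<in>?N. \<exists>a. a > 0 \<and> act A (bv w) = a *\<^sub>R bv (b w)" by blast
  from bchoice[OF this] obtain a where a: "\<And>w. w \<in> ?N \<Longrightarrow> a w > 0" "\<And>w. w \<in> ?N \<Longrightarrow> act A (bv w) = a w *\<^sub>R bv (b w)"
    by blast
  \<comment> \<open>\<open>act A\<close> and \<open>h\<close> send \<open>bv w\<close> to multiples
    of the same boundary value. Both preserve pairings, so the products of their factors agree
    wherever the pairing is nonzero.\<close>
  have am2: "a w * a u = m w * m u" if w: "w \<in> ?N" and u: "u \<in> ?N" and wu: "B w u > 0" for w u
  proof -
    have "B' (bv w) (bv u) > 0" using bv_distinct w u wu by simp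
    moreover have "B' (bv w) (bv u) = a w * a u * B' (bv (b w)) (bv (b u))"
      using lorentz_isomD(2)[OF aA, of "bv w" "bv u"] by (simp add: a(2)[OF w] a(2)[OF u] lorentz_linear mult_ac)
    moreover have "B' (bv w) (bv u) = m w * m u * B' (bv (b w)) (bv (b u))"
      using hv_gram[OF w u] by (simp add: bm(3)[OF w] bm(3)[OF u] lorentz_linear mult_ac)
    ultimately show ?thesis by (metis mult_cancel_right mult_zero_right less_irrefl)
  qed
  have am: "a w = m w" if w: "w \<in> ?N" for w
  proof -
    obtain u z where uz: "u \<in> ?N" "z \<in> ?N" "B w u > 0" "B w z > 0" "B u z > 0"
      by (rule two_more_null[of w]) (use w in auto)
    \<comment> \<open>With three distinct points the products over the pairs w u and w z, divided by
      that over u z, isolate the square of the factor at \<open>w\<close>.\<close>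
    have "(a w * a w) * (a u * a z) = (a w * a u) * (a w * a z)" by (simp only: mult_ac)
    also have "\<dots> = (m w * m w) * (m u * m z)"
      unfolding am2[OF w uz(1,3)] am2[OF w uz(2,4)] by (simp only: mult_ac)
    finally have "(a w * a w) * (a u * a z) = (m w * m w) * (a u * a z)" by (simp add: am2[OF uz(1,2,5)])
    then have "a w * a w = m w * m w" using a(1)[OF uz(1)] a(1)[OF uz(2)] by simp
    then have "(a w)\<^sup>2 = (m w)\<^sup>2" by (simp add: power2_eq_square)
    then show ?thesis using a(1)[OF w] bm(2)[OF w] by (simp add: power2_eq_iff_nonneg)
  qed
  have "h x = \<rho> (restrict A H) x" if x: "x \<in> C" for x
  proof -
    \<comment> \<open>The discrepancy is pulled back by \<open>act A\<close>, so that it can be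
      tested against all boundary values and killed by \<open>bv_total\<close>.\<close>
    obtain y where y: "act A y = h x - act A x" using isom_surj[OF \<omega> aA] by blast
    have yN: "B' y (bv w) = 0" if w: "w \<in> ?N" for w
    proof -
      have "B' y (bv w) = B' (h x - act A x) (act A (bv w))"
        using lorentz_isomD(2)[OF aA, of y "bv w"] y by simp
      also have "\<dots> = B' (h x) (hv w) - B' (act A x) (act A (bv w))"
        by (simp add: lorentz_linear a(2)[OF w] am[OF w] bm(3)[OF w] right_diff_distrib)
      also have "\<dots> = 0"
        using hv_C[OF w x] lorentz_isomD(2)[OF aA, of x "bv w"]
          lorentz_commute[of \<omega> "h x" "hv w"] lorentz_commute[of \<omega> x "bv w"] by linarith
      finally show ?thesis .
    qed
    have "y = 0"
    proof (rule bv_total)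
      fix w assume w: "w \<in> null_cone e"
      obtain u where "u \<in> null_cone e" "B x0 u = 1" "bv u = bv w" by (rule normalize_null[OF w])
      then show "B' y (bv w) = 0" using yN[of u] by simp
    qed
    then have "h x = act A x" using y linear_0[OF lorentz_isomD(1)[OF aA]] by simp
    also have "\<dots> = \<rho> (restrict A H) x"
      unfolding act_def using x C_sub by (intro ext[OF isom_carrier[OF A(1)]]) auto
    finally show ?thesis .
  qed
  then show thesis using that isom_carrier[OF A(1)] by blast
qed

section \<open>The isomorphism of the isometry groups\<close>

lemma rho_mult:
  assumes "g \<in> G" "h \<in> G" "x \<in> H'"
  shows "\<rho> (g \<otimes>\<^bsub>Isom_hyp e\<^esub> h) x = \<rho> g (\<rho> h x)"
  using hom_mult[OF hom assms(1,2)] isom_group_mult[OF rho_in[OF assms(1)] rho_in[OF assms(2)] assms(3)] by simp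

lemma restrict_rho_in:
  assumes g: "g \<in> G"
  shows "restrict (\<rho> g) C \<in> carrier (isom_group C (hyp_dist \<omega>))"
proof -
  have d: "hyp_dist \<omega> (\<rho> g x) (\<rho> g y) = hyp_dist \<omega> x y" if "x \<in> C" "y \<in> C" for x y
    using rho_in[OF g] that C_sub by (auto simp: isom_group_carrier_iff)
  have "inj_on (\<rho> g) H'" using rho_in[OF g] by (simp add: isom_group_carrier_iff Bij_def bij_betw_def)
  then have inj: "inj_on (\<rho> g) C" using C_sub by (rule inj_on_subset)
  obtain g' where g': "g' \<in> G" "\<And>y. \<pi> g (\<pi> g' y) = y" using group_inverse[OF g] by metis
  have "\<rho> g ` C = C"
  proof (intro equalityI subsetI)
    fix x assume x: "x \<in> C"
    have xH: "x \<in> H'" "\<rho> g' x \<in> H'" using x C(3)[OF g'(1) x] C_sub by auto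
    have "x = \<rho> g (\<rho> g' x)" using g'(2)[of x] ext[OF g'(1) xH(1)] ext[OF g xH(2)] by simp
    then show "x \<in> \<rho> g ` C" using C(3)[OF g'(1) x] by blast
  qed (use C(3)[OF g] in blast)
  then have "bij_betw (restrict (\<rho> g) C) C C" using inj by (simp add: bij_betw_def inj_on_def)
  then show ?thesis using d by (simp add: isom_group_carrier_iff Bij_def)
qed

lemma isom_C: "(\<lambda>g. restrict (\<rho> g) C) \<in> iso (Isom_hyp e) (isom_group C (hyp_dist \<omega>))"
  unfolding iso_def
proof (intro CollectI conjI)
  let ?I = "isom_group C (hyp_dist \<omega>)"
  let ?r = "\<lambda>g. restrict (\<rho> g) C"
  have ext_eq: "a = b" if "a \<in> carrier ?I" "b \<in> carrier ?I"
      "\<And>x. x \<in> C \<Longrightarrow> a x = b x" for a b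
    using that by (intro extensionalityI[of _ C]) (auto simp: isom_group_carrier_iff Bij_def)
  show "?r \<in> Group.hom (Isom_hyp e) (?I)"
  proof (rule homI)
    show "?r g \<in> carrier ?I" if "g \<in> G" for g
      by (rule restrict_rho_in[OF that])
    fix g h assume gh: "g \<in> G" "h \<in> G"
    interpret GC: group "isom_group C (hyp_dist \<omega>)" by (rule group_isom_group)
    interpret GH: group "Isom_hyp e" by (rule group_isom_group)
    show "restrict (\<rho> (g \<otimes>\<^bsub>Isom_hyp e\<^esub> h)) C =
      ?r g \<otimes>\<^bsub>?I\<^esub> ?r h"
    proof (rule ext_eq)
      show "restrict (\<rho> (g \<otimes>\<^bsub>Isom_hyp e\<^esub> h)) C \<in> carrier ?I"
        using gh by (intro restrict_rho_in GH.m_closed)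
      show "?r g \<otimes>\<^bsub>?I\<^esub> ?r h \<in> carrier ?I"
        using gh by (intro GC.m_closed restrict_rho_in)
      fix x assume x: "x \<in> C"
      show "restrict (\<rho> (g \<otimes>\<^bsub>Isom_hyp e\<^esub> h)) C x =
          (?r g \<otimes>\<^bsub>?I\<^esub> ?r h) x"
        unfolding isom_group_mult[OF restrict_rho_in[OF gh(1)] restrict_rho_in[OF gh(2)] x]
        using x C(3)[OF gh(2) x] C_sub by (auto simp: rho_mult[OF gh])
    qed
  qed
  show "bij_betw ?r G (carrier ?I)"
    unfolding bij_betw_def
  proof
    show "inj_on ?r G"
    proof (rule inj_onI)
      fix g h assume gh: "g \<in> G" "h \<in> G" and eq: "?r g = ?r h"
      \<comment> \<open>The image of \<open>f\<close> lies in \<open>C\<close>, so agreement on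
        \<open>C\<close> gives f (g x) = f (h x), and \<open>f\<close> is injective.\<close>
      have "g x = h x" if x: "x \<in> H" for x
      proof (rule f_inj)
        show "g x \<in> H" "h x \<in> H" using isom_hyp_lorentz(1) gh x by blast+
        have "?r g (f x) = ?r h (f x)" using eq by simp
        then have "\<rho> g (f x) = \<rho> h (f x)" using f_in_C[OF x] by simp
        then show "f (g x) = f (h x)" using f_equi x gh ext f_in[OF x] by simp
      qed
      then show "g = h" using gh by (intro extensionalityI[of _ H]) (auto simp: isom_group_carrier_iff Bij_def)
    qed
    show "?r ` G = carrier ?I"
    proof (intro equalityI subsetI)
      fix h assume h: "h \<in> carrier ?I"
      obtain g where g: "g \<in> G" "\<And>x. x \<in> C \<Longrightarrow> h x = \<rho> g x"
        by (rule isometry_of_C_extends[OF h]) blast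
      have "h = ?r g" by (rule ext_eq[OF h restrict_rho_in[OF g(1)]]) (simp add: g)
      then show "h \<in> ?r ` G" using g by blast
    qed (use restrict_rho_in in blast)
  qed
qed

end

section \<open>The case t = 1, and the result\<close>

lemma null_cone_nonempty:
  fixes e :: "'a::euclidean_space"
  assumes "DIM('a) \<ge> 2" "e \<noteq> 0"
  shows "\<exists>v. v \<in> null_cone e"
proof -
  have "dim {e} < DIM('a)" using assms by simp
  then obtain v where v: "v \<noteq> 0" "\<And>y. y \<in> span {e} \<Longrightarrow> orthogonal v y"
    using orthogonal_to_subspace_exists by blast
  have ve: "v \<bullet> e = 0" using v(2)[of e] by (simp add: span_base orthogonal_def)
  define c where "c = norm v / norm e"
  have c: "c > 0" "c * c * (e \<bullet> e) = v \<bullet> v"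
    using assms v(1) by (auto simp: c_def dot_square_norm power2_eq_square)
  have "lorentz e v v = - (v \<bullet> v)" by (simp add: lorentz_alt ve)
  then have "c *\<^sub>R e + v \<in> null_cone e"
    using c assms
    by (simp add: null_cone_def lorentz_bilin lorentz_base ve lorentz_commute[of e e v] algebra_simps)
  then show ?thesis by blast
qed

lemma boundary_of_whole: "hyp.boundary_of e (\<H> e) = hyp.boundary e"
proof (intro equalityI subsetI)
  fix \<xi> assume "\<xi> \<in> hyp.boundary e"
  then obtain v where v: "v \<in> null_cone e" "\<xi> = endpoint e v" by (auto simp: boundary_eq)
  show "\<xi> \<in> hyp.boundary_of e (\<H> e)"
    using boundary_of_iff[OF v(1) order_refl] base_point[OF null_coneD(3)[OF v(1)]] hray_in[OF _ v(1)] v(2)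
    by blast
qed (simp add: hyp.boundary_of_def)

text \<open>Every point lies on a geodesic line: with \<open>v\<close> scaled to B x v = 1 / 2 the
  vector x - v is null, and x = v + (x - v) is the point supplied by
  \<open>boundary_midpoint\<close>.\<close>

lemma closed_convex_full_boundary:
  assumes K: "hyp.closed_convex e K" and b: "hyp.boundary e \<subseteq> hyp.boundary_of e K" and u: "u \<in> null_cone e"
  shows "K = \<H> e"
proof (intro equalityI subsetI)
  fix x assume x: "x \<in> \<H> e"
  define v where "v = (1 / (2 * lorentz e x u)) *\<^sub>R u"
  have p: "lorentz e x u > 0" by (rule null_hyp_pos(2)[OF u x])
  have v: "v \<in> null_cone e" unfolding v_def using p by (intro null_cone_scale[OF u]) simp
  have xv: "lorentz e x v = 1 / 2" "lorentz e v x = 1 / 2"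
    using p by (simp_all add: v_def lorentz_linear lorentz_commute[of e u x])
  note N = hyp_unit[OF x] null_coneD(1)[OF v] xv
  have w: "x - v \<in> null_cone e" by (rule null_coneI[OF x]) (simp_all add: lorentz_bilin N)
  have "v + (x - v) \<in> K"
    by (rule boundary_midpoint[OF K v w])
      (use b endpoint_boundary[OF v] endpoint_boundary[OF w] in \<open>auto simp: lorentz_linear N\<close>)
  then show "x \<in> K" by simp
qed (use closed_convexD(1)[OF K] in blast)

theorem proposition5:
  fixes e :: "'a::euclidean_space" and \<omega> :: "'h::{real_inner, polish_space}"
    and n :: nat and t :: real
    and \<rho> :: "('a \<Rightarrow> 'a) \<Rightarrow> 'h \<Rightarrow> 'h" and C :: "'h set" and f :: "'a \<Rightarrow> 'h"
    and F :: "'a + (real \<Rightarrow> 'a) set \<Rightarrow> 'h + (real \<Rightarrow> 'h) set"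
  assumes "n \<ge> 2" and "DIM('a) = n + 1" and "e \<noteq> 0"
    and "\<nexists>S :: 'h set. finite S \<and> span S = UNIV" and "\<omega> \<noteq> 0"
    and "0 < t" and "t \<le> 1"
  shows
    "(t < 1 \<and> exotic_rep t e \<omega> \<rho> \<and> minimal_invariant (Isom_hyp e) \<omega> \<rho> C \<and>
      equivariant_map e \<omega> \<rho> f \<and> continuous_extension e \<omega> f F \<longrightarrow>
        C = hyp.closed_convex_hull \<omega> (f ` hyperbolic_space e) \<and>
        C = hyp.boundary_hull \<omega> (F ` Inr ` hyp.boundary e) \<and>
        Inr ` hyp.boundary_of \<omega> C = F ` Inr ` hyp.boundary e \<and>
        (\<lambda>g. restrict (\<rho> g) C) \<in> iso (Isom_hyp e) (isom_group C (hyp_dist \<omega>))) \<and>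
     (t = 1 \<longrightarrow>
        hyperbolic_space e = hyp.closed_convex_hull e (id ` hyperbolic_space e) \<and>
        hyperbolic_space e = hyp.boundary_hull e (id ` Inr ` hyp.boundary e) \<and>
        Inr ` hyp.boundary_of e (hyperbolic_space e) = id ` Inr ` hyp.boundary e \<and>
        (\<lambda>g. restrict (id g) (hyperbolic_space e))
          \<in> iso (Isom_hyp e) (isom_group (hyperbolic_space e) (hyp_dist e)))"
proof (intro conjI impI)
  assume H: "t < 1 \<and> exotic_rep t e \<omega> \<rho> \<and> minimal_invariant (Isom_hyp e) \<omega> \<rho> C \<and>
      equivariant_map e \<omega> \<rho> f \<and> continuous_extension e \<omega> f F"
  then have "irreducible_rep (Isom_hyp e) \<omega> \<rho>" by (simp add: exotic_rep_def)
  then obtain \<pi> where \<pi>: "\<forall>g\<in>carrier (Isom_hyp e). bounded_linear (\<pi> g) \<and> (\<forall>x\<in>hyperbolic_space \<omega>. \<pi> g x = \<rho> g x)"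
      "\<forall>V. subspace V \<and> closed V \<and> (\<forall>g\<in>carrier (Isom_hyp e). \<pi> g ` V \<subseteq> V) \<longrightarrow> V = {0} \<or> V = UNIV"
    unfolding irreducible_rep_def by (elim exE conjE)
  interpret exotic_setting e \<omega> t \<rho> \<pi> C f F
  proof (rule exotic_setting.intro)
    show "linear (\<pi> g)" if "g \<in> carrier (Isom_hyp e)" for g
      using \<pi>(1) that by (simp add: bounded_linear.linear)
    show "V = {0} \<or> V = UNIV" if "subspace V" "closed V" "\<And>g. g \<in> carrier (Isom_hyp e) \<Longrightarrow> \<pi> g ` V \<subseteq> V" for V
      using \<pi>(2) that by blast
    show "\<pi> g x = \<rho> g x" if "g \<in> carrier (Isom_hyp e)" "x \<in> hyperbolic_space \<omega>" for g x
      using \<pi>(1) that by blast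
  qed (use H assms(1-3,5,6) in \<open>simp_all add: exotic_rep_def\<close>)
  show "C = hyp.closed_convex_hull \<omega> (f ` hyperbolic_space e)" by (rule C_eq_hull)
  show "C = hyp.boundary_hull \<omega> (F ` Inr ` hyp.boundary e)" by (rule C_eq_boundary_hull)
  show "Inr ` hyp.boundary_of \<omega> C = F ` Inr ` hyp.boundary e" by (rule boundary_C)
  show "(\<lambda>g. restrict (\<rho> g) C) \<in> iso (Isom_hyp e) (isom_group C (hyp_dist \<omega>))" by (rule isom_C)
next
  let ?H = "hyperbolic_space e"
  show "?H = hyp.closed_convex_hull e (id ` ?H)"
    using closed_convex_whole closed_convexD(1) by (auto simp: hyp.closed_convex_hull_def hull_def)
  show "Inr ` hyp.boundary_of e ?H = id ` Inr ` hyp.boundary e" by (simp add: boundary_of_whole)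
  obtain u where u: "u \<in> null_cone e" using null_cone_nonempty[of e] assms by auto
  show "?H = hyp.boundary_hull e (id ` Inr ` hyp.boundary e)"
  proof -
    let ?T = "id ` Inr ` hyp.boundary e :: ('a + (real \<Rightarrow> 'a) set) set"
    have "{K. hyp.closed_convex e K \<and> ?T \<subseteq> Inr ` hyp.boundary_of e K} = {?H}"
    proof (intro equalityI subsetI)
      fix K assume "K \<in> {K. hyp.closed_convex e K \<and> ?T \<subseteq> Inr ` hyp.boundary_of e K}"
      then have "hyp.closed_convex e K" "hyp.boundary e \<subseteq> hyp.boundary_of e K" by auto
      then show "K \<in> {?H}" using closed_convex_full_boundary[OF _ _ u] by simp
    qed (simp add: closed_convex_whole boundary_of_whole)
    then show ?thesis
      unfolding hyp.boundary_hull_def by (simp only: Inter_insert Inter_empty Int_UNIV_right)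
  qed
  have r: "restrict (id g) ?H = g" if "g \<in> carrier (Isom_hyp e)" for g
    using that by (auto simp: isom_group_carrier_iff Bij_def extensional_restrict)
  interpret group "Isom_hyp e" by (rule group_isom_group)
  show "(\<lambda>g. restrict (id g) ?H) \<in> iso (Isom_hyp e) (isom_group ?H (hyp_dist e))"
    unfolding iso_def
  proof (intro CollectI conjI homI)
    show "bij_betw (\<lambda>g. restrict (id g) ?H) (carrier (Isom_hyp e)) (carrier (Isom_hyp e))"
      using r by (subst bij_betw_cong[of _ _ id]) auto
  qed (simp_all only: r m_closed)
qed

end
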